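(* Let $\Omega\subset\mathbb{R}^2$ be a bounded open convex set containing the origin in its interior, and suppose $$\sup_{\theta\in S^1}\sup_{\delta>0}\delta^{-1/2}\mu(\theta,\delta)<\infty.$$ Then there is a constant $C_\Omega$ such that for all $R\ge2$ and all $h$ with $1\le h\le R$, $$\mathcal{G}_\Omega(R,h)\le C_\Omega (R\log R)^{1/2}.$$
   Context: For $t>0$ let $\mathcal{N}_\Omega(t)=\mathrm{card}(t\Omega\cap\mathbb{Z}^2)$, $E_\Omega(t)=\mathcal{N}_\Omega(t)-t^2\,\mathrm{area}(\Omega)$, and $\mathcal{G}_\Omega(R,h)=\big(\frac1h\int_R^{R+h}|E_\Omega(t)|^2dt\big)^{1/2}$. Let $\rho^*(\xi)=\sup\{\langle x,\xi\rangle:x\in\Omega\}$ for $\xi\in\mathbb{R}^2$. For $\theta\in S^1$ and $\delta>0$ let $\mathcal{C}(\theta,\delta)=\{x\in\partial\Omega:\langle x,\theta\rangle=\rho^*(\theta)-\delta\}$ and $\mu(\theta,\delta)=\mathrm{diam}(\mathcal{C}(\theta,\delta))$ (with $\mathrm{diam}(\emptyset)=0$). *)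

theory Defs
  imports "HOL-Analysis.Analysis"
begin

definition lattice_Z2 :: "(real \<times> real) set" where
  "lattice_Z2 = {z. fst z \<in> \<int> \<and> snd z \<in> \<int>}"

definition lattice_count :: "(real \<times> real) set \<Rightarrow> real \<Rightarrow> nat" where
  "lattice_count \<Omega> t = card (((\<lambda>x. t *\<^sub>R x) ` \<Omega>) \<inter> lattice_Z2)"

definition lattice_error :: "(real \<times> real) set \<Rightarrow> real \<Rightarrow> real" where
  "lattice_error \<Omega> t = real (lattice_count \<Omega> t) - t\<^sup>2 * measure lebesgue \<Omega>"

definition G_mean :: "(real \<times> real) set \<Rightarrow> real \<Rightarrow> real \<Rightarrow> real" where
  "G_mean \<Omega> R h = sqrt ((1 / h) * integral {R..R+h} (\<lambda>t. \<bar>lattice_error \<Omega> t\<bar>\<^sup>2))"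

definition support_fn :: "(real \<times> real) set \<Rightarrow> real \<times> real \<Rightarrow> real" where
  "support_fn \<Omega> \<xi> = (SUP x\<in>\<Omega>. x \<bullet> \<xi>)"

definition cap_set :: "(real \<times> real) set \<Rightarrow> real \<times> real \<Rightarrow> real \<Rightarrow> (real \<times> real) set" where
  "cap_set \<Omega> \<theta> \<delta> = {x \<in> frontier \<Omega>. x \<bullet> \<theta> = support_fn \<Omega> \<theta> - \<delta>}"

text \<open>diameter of the empty set is 0 in the library, matching the convention.\<close>
definition cap_diam :: "(real \<times> real) set \<Rightarrow> real \<times> real \<Rightarrow> real \<Rightarrow> real" where
  "cap_diam \<Omega> \<theta> \<delta> = diameter (cap_set \<Omega> \<theta> \<delta>)"

end

theory Submission
  imports Defs
begin

text \<open>
  It suffices to bound the integral of \<open>|E(t)|\<^sup>2\<close> over intervals of length at most 1 by a multiple of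
  \<open>R log R\<close>. The lattice point count is squeezed between mollified counts at scale \<open>1/R\<close>, whose
  error is \<open>t\<^sup>2\<close> times a sum over nonzero \<open>k\<close> in \<open>\<int>\<^sup>2\<close> of \<open>c\<^sub>k\<close> times the cosine transform at \<open>t k\<close>
  of the indicator of the domain. By slicing, the latter is the cosine transform of a concave
  function \<open>A\<close> on \<open>(-\<rho>*(-k), \<rho>*(k))\<close>, and the cap condition says that \<open>A\<close> vanishes like
  \<open>|k|^(-3/2)\<close> times the square root of the distance to the end points.

  Instead of integrating by parts, take a second difference of \<open>A\<close> with step \<open>1/(4R)\<close>, which only
  multiplies the transform by a factor bounded away from 0. By concavity it has mass
  \<open>O((R|k|)^(-3/2))\<close>, of which only \<open>O(R^(-2) |k|^(-3/2))\<close> lies at distance more than 1 from both end points. The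
  latter part is summed trivially over \<open>k\<close> and contributes \<open>O(R^(1/2))\<close> to \<open>E\<close>. The remaining frequencies lie
  within 1 of \<open>\<rho>*(k)\<close> or \<open>-\<rho>*(-k)\<close>; contributions from different unit intervals of frequencies are
  almost orthogonal over a unit interval of \<open>t\<close>. As \<open>O(m)\<close> lattice points satisfy
  \<open>m \<le> \<rho>*(k) < m + 1\<close>, the mean square is at most a multiple of \<open>R\<close> times the sum of \<open>1/m\<close> over \<open>m \<le> R\<close>.
\<close>

section \<open>Cosine transforms of concave profiles\<close>

text \<open>The two ends of the profile need orthogonality because absolute summation fails there: a
  shell of O(m) points with terms of size (R m)^(-3/2) contributes R^(-3/2) m^(-1/2), and summing
  over m up to R and multiplying by t^2 gives only E = O(R). The interior part has an extra factor
  R^(-1/2) and can afford this. Square summation over shells is what brings the ends down to R log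
  R. Integration by parts is obstructed by the boundary, which carries no smoothness: the profile is
  only concave with square root bounds at its ends. Differences see exactly these two properties.
  Poisson summation is avoided as well. The mollifier is periodic from the start and is replaced by
  a trigonometric polynomial, a Fejer mean, so every sum over k is finite and no convergence
  question arises. The degree N of that polynomial depends on the required accuracy without control;
  hence all estimates use the coefficients only through \<open>bump_decay\<close> and are uniform in
  N. Since the coefficients are even, cosines suffice and everything stays real.\<close>

definition cos_transform :: "(real \<Rightarrow> real) \<Rightarrow> real \<Rightarrow> real" where
  "cos_transform G t = (LINT s|lborel. G s * cos (2 * pi * t * s))"

abbreviation mass :: "(real \<Rightarrow> real) \<Rightarrow> real" where
  "mass G \<equiv> LINT s|lborel. \<bar>G s\<bar>"

lemma integrable_mult_cos:
  fixes G :: "real \<Rightarrow> real"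
  assumes "integrable lborel G"
  shows "integrable lborel (\<lambda>s. G s * cos (2 * pi * t * s))"
proof (rule Bochner_Integration.integrable_bound[OF assms])
  show "(\<lambda>s. G s * cos (2 * pi * t * s)) \<in> borel_measurable lborel"
    using assms by measurable
qed (auto simp: abs_mult mult_left_le)

lemma cos_transform_bound:
  assumes "integrable lborel G"
  shows "\<bar>cos_transform G t\<bar> \<le> mass G"
proof -
  have "\<bar>cos_transform G t\<bar> \<le> (LINT s|lborel. \<bar>G s * cos (2 * pi * t * s)\<bar>)"
    unfolding cos_transform_def by (rule integral_abs_bound)
  also have "\<dots> \<le> mass G"
  proof (rule integral_mono)
    show "integrable lborel (\<lambda>s. \<bar>G s * cos (2 * pi * t * s)\<bar>)"
      by (intro integrable_abs integrable_mult_cos assms)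
  qed (use assms in \<open>auto simp: abs_mult mult_left_le\<close>)
  finally show ?thesis .
qed

lemma continuous_cos_transform:
  assumes "integrable lborel G"
  shows "continuous_on UNIV (cos_transform G)"
  unfolding cos_transform_def
proof (rule continuous_at_imp_continuous_on, safe)
  fix t :: real
  show "isCont (\<lambda>t. LINT s|lborel. G s * cos (2 * pi * t * s)) t"
    unfolding continuous_at_sequentially comp_def
  proof safe
    fix X assume X: "X \<longlonglongrightarrow> t"
    show "(\<lambda>n. LINT s|lborel. G s * cos (2 * pi * X n * s)) \<longlonglongrightarrow> (LINT s|lborel. G s * cos (2 * pi * t * s))"
    proof (rule integral_dominated_convergence[where w = "\<lambda>s. \<bar>G s\<bar>"])
      show "integrable lborel (\<lambda>s. \<bar>G s\<bar>)" using assms by simp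
      show "AE s in lborel. (\<lambda>n. G s * cos (2 * pi * X n * s)) \<longlonglongrightarrow> G s * cos (2 * pi * t * s)"
        by (intro AE_I2 tendsto_intros X)
      show "AE s in lborel. norm (G s * cos (2 * pi * X n * s)) \<le> \<bar>G s\<bar>" for n
        by (auto simp: abs_mult mult_left_le)
    qed (use assms in measurable)
  qed
qed

lemma integrable_indicator_Icc: "integrable lborel (indicat_real {a..b::real})"
  by (intro integrable_real_indicator emeasure_bounded_finite) auto

lemma integrable_shift:
  fixes f :: "real \<Rightarrow> real"
  assumes "integrable lborel f"
  shows "integrable lborel (\<lambda>s. f (s + h))"
  using lborel_integrable_real_affine[OF assms, of 1 h] by (simp add: add.commute)

lemma integral_shift:
  fixes f :: "real \<Rightarrow> real"
  shows "(LINT s|lborel. f (s + h)) = (LINT s|lborel. f s)"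
  using lborel_integral_real_affine[of 1 f h] by (simp add: add.commute)

lemma sqrt_le_three_halves: "4/9 \<le> d \<Longrightarrow> sqrt d \<le> 3/2 * d" for d :: real
  using mult_right_mono[of "4/9" d d] by (intro real_le_lsqrt) (auto simp: power2_eq_square)

text \<open>\<open>f\<close> stands for the transform of a profile on (a, b). \<open>G1\<close> and
  \<open>G2\<close> are the pieces of its second difference near \<open>b\<close> and near
  \<open>a\<close>, \<open>G3\<close> is the rest. The bound for \<open>G3\<close> gains a factor
  sqrt h over the others, which is what makes it summable without cancellation.\<close>

definition end_split :: "(real \<Rightarrow> real) \<Rightarrow> real \<Rightarrow> real \<Rightarrow> real \<Rightarrow> real \<Rightarrow>
    (real \<Rightarrow> real) \<Rightarrow> (real \<Rightarrow> real) \<Rightarrow> (real \<Rightarrow> real) \<Rightarrow> bool" where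
  "end_split f a b K h G1 G2 G3 \<longleftrightarrow> integrable lborel G1 \<and> integrable lborel G2 \<and> integrable lborel G3 \<and>
    (\<forall>t. (2 - 2 * cos (2 * pi * t * h)) * f t = cos_transform G1 t + cos_transform G2 t + cos_transform G3 t) \<and>
    mass G1 \<le> 16 * K * (h * sqrt h) \<and> mass G2 \<le> 16 * K * (h * sqrt h) \<and> mass G3 \<le> 12 * K * h\<^sup>2 \<and>
    (\<forall>s. G1 s \<noteq> 0 \<longrightarrow> \<bar>s - b\<bar> \<le> 1) \<and> (\<forall>s. G2 s \<noteq> 0 \<longrightarrow> \<bar>s - a\<bar> \<le> 1)"

text \<open>Model for \<open>A s\<close> = (length of the slice of the domain by \<open>{x. x \<bullet> k = s}\<close>) / \<open>norm k\<close>; the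
  two square root bounds are the cap condition in the directions \<open>k\<close> and \<open>- k\<close>.\<close>

locale slice_profile =
  fixes A :: "real \<Rightarrow> real" and a b K :: real
  assumes measurable_A [measurable]: "A \<in> borel_measurable borel"
    and nonneg: "0 \<le> A s"
    and outside: "s \<le> a \<or> b \<le> s \<Longrightarrow> A s = 0"
    and concave: "concave_on {a<..<b} A"
    and upper_end: "a < s \<Longrightarrow> s < b \<Longrightarrow> A s \<le> K * sqrt (b - s)"
    and lower_end: "a < s \<Longrightarrow> s < b \<Longrightarrow> A s \<le> K * sqrt (s - a)"
    and K_nonneg: "0 \<le> K"
begin

lemma upper_end': "b - s \<le> d \<Longrightarrow> 0 \<le> d \<Longrightarrow> A s \<le> K * sqrt d"
proof (cases "a < s \<and> s < b")
  case True
  assume "b - s \<le> d"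
  then have "K * sqrt (b - s) \<le> K * sqrt d" using K_nonneg by (intro mult_left_mono) auto
  then show ?thesis using upper_end[of s] True by simp
qed (use outside[of s] K_nonneg in auto)

lemma lower_end': "s - a \<le> d \<Longrightarrow> 0 \<le> d \<Longrightarrow> A s \<le> K * sqrt d"
proof (cases "a < s \<and> s < b")
  case True
  assume "s - a \<le> d"
  then have "K * sqrt (s - a) \<le> K * sqrt d" using K_nonneg by (intro mult_left_mono) auto
  then show ?thesis using lower_end[of s] True by simp
qed (use outside[of s] K_nonneg in auto)

lemma integrable_A: "integrable lborel A"
proof (rule Bochner_Integration.integrable_bound)
  show "integrable lborel (\<lambda>s. indicat_real {a..b} s * (K * sqrt \<bar>b - a\<bar>))"
    by (intro integrable_mult_left integrable_indicator_Icc)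
  show "AE s in lborel. norm (A s) \<le> norm (indicat_real {a..b} s * (K * sqrt \<bar>b - a\<bar>))"
  proof (rule AE_I2)
    fix s
    show "norm (A s) \<le> norm (indicat_real {a..b} s * (K * sqrt \<bar>b - a\<bar>))"
      using upper_end'[of s "\<bar>b - a\<bar>"] nonneg[of s] outside[of s] K_nonneg
      by (cases "a < s \<and> s < b") (auto simp: indicator_def)
  qed
qed auto

definition second_diff :: "real \<Rightarrow> real \<Rightarrow> real" where
  "second_diff h s = 2 * A s - A (s + h) - A (s - h)"

lemma integrable_second_diff: "integrable lborel (second_diff h)"
  unfolding second_diff_def[abs_def]
  using integrable_A integrable_shift[of A h] integrable_shift[of A "-h"] by simp

text \<open>A translation turns into a phase shift of the cosine. As the step is symmetric, the sine
  terms of the two translates cancel and a real factor remains.\<close>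

lemma cos_transform_second_diff:
  "cos_transform (second_diff h) t = (2 - 2 * cos (2 * pi * t * h)) * cos_transform A t"
proof -
  let ?c = "\<lambda>s. cos (2 * pi * t * s)"
  have I: "integrable lborel (\<lambda>s. A s * cos (2 * pi * t * (s + d)))" for d
    by (rule Bochner_Integration.integrable_bound[OF integrable_A]) (auto simp: abs_mult mult_left_le)
  have J: "integrable lborel (\<lambda>s. A (s + d) * ?c s)" for d
    using integrable_mult_cos[OF integrable_shift[OF integrable_A, of d]] by simp
  have S: "(LINT s|lborel. A (s + d) * ?c s) = (LINT s|lborel. A s * cos (2 * pi * t * (s - d)))" for d
    using integral_shift[of "\<lambda>s. A s * cos (2 * pi * t * (s - d))" d] by simp
  have "cos_transform (second_diff h) t
      = (LINT s|lborel. 2 * (A s * ?c s) - A (s + h) * ?c s - A (s + (-h)) * ?c s)"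
    unfolding cos_transform_def second_diff_def by (simp add: algebra_simps)
  also have "\<dots> = 2 * (LINT s|lborel. A s * ?c s) - (LINT s|lborel. A (s + h) * ?c s) - (LINT s|lborel. A (s + (-h)) * ?c s)"
    using J[of 0] J[of h] J[of "-h"] by simp
  also have "\<dots> = 2 * (LINT s|lborel. A s * ?c s) - (LINT s|lborel. A s * cos (2 * pi * t * (s + -h)))
      - (LINT s|lborel. A s * cos (2 * pi * t * (s + h)))"
    unfolding S by simp
  also have "\<dots> = (LINT s|lborel. 2 * (A s * ?c s) - A s * cos (2 * pi * t * (s + -h)) - A s * cos (2 * pi * t * (s + h)))"
    using I[of 0] I[of h] I[of "-h"] by simp
  also have "\<dots> = (LINT s|lborel. (2 - 2 * cos (2 * pi * t * h)) * (A s * ?c s))"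
    by (intro Bochner_Integration.integral_cong)
      (auto simp: algebra_simps cos_add cos_diff)
  also have "\<dots> = (2 - 2 * cos (2 * pi * t * h)) * cos_transform A t"
    unfolding cos_transform_def by (rule integral_mult_right_zero)
  finally show ?thesis .
qed

lemma second_diff_nonneg:
  assumes "a < s - h" "s + h < b" "0 \<le> h"
  shows "0 \<le> second_diff h s"
proof -
  have "A ((1 - 1/2) *\<^sub>R (s - h) + (1/2) *\<^sub>R (s + h)) \<ge> (1 - 1/2) * A (s - h) + (1/2) * A (s + h)"
    using assms by (intro concave_onD[OF concave]) auto
  then show ?thesis by (simp add: second_diff_def field_simps)
qed

text \<open>The second difference has mean zero and is nonnegative away from the two end points,
  so its total mass is controlled by its values near the end points.\<close>

lemma second_diff_mass:
  assumes "0 < h"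
  shows "mass (second_diff h) \<le> 16 * K * (h * sqrt h)"
proof -
  define B where "B = (\<lambda>s. indicat_real {a-h..a+h} s + indicat_real {b-h..b+h} s)"
  have intB: "integrable lborel B" unfolding B_def by (intro Bochner_Integration.integrable_add integrable_indicator_Icc)
  have s2: "sqrt (2 * h) \<le> 2 * sqrt h"
    using assms by (intro real_le_lsqrt) auto
  \<comment> \<open>The absolute value exceeds the function by twice its negative part. The function
    is negative only within h of an end, where one of the two translates of \<open>A\<close>
    vanishes and the other is at most K sqrt (2h), so the negative part is at most 2 K sqrt
    h.\<close>
  have pt: "\<bar>second_diff h s\<bar> \<le> second_diff h s + 4 * K * sqrt h * B s" for s
  proof (cases "s \<in> {a-h..a+h} \<or> s \<in> {b-h..b+h}")
    case True
    then have B1: "B s \<ge> 1" by (auto simp: B_def)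
    have "second_diff h s \<ge> - (2 * (K * sqrt h))"
    proof (cases "s \<in> {b-h..b+h}")
      case True
      then have "A (s + h) = 0" using outside[of "s+h"] by auto
      moreover have "A (s - h) \<le> K * sqrt (2*h)" using True assms by (intro upper_end') auto
      moreover have "K * sqrt (2*h) \<le> K * (2 * sqrt h)" using s2 K_nonneg by (rule mult_left_mono)
      ultimately show ?thesis using nonneg[of s] unfolding second_diff_def by linarith
    next
      case False
      with True have s: "s \<in> {a-h..a+h}" by auto
      then have "A (s - h) = 0" using outside[of "s-h"] by auto
      moreover have "A (s + h) \<le> K * sqrt (2*h)" using s assms by (intro lower_end') auto
      moreover have "K * sqrt (2*h) \<le> K * (2 * sqrt h)" using s2 K_nonneg by (rule mult_left_mono)
      ultimately show ?thesis using nonneg[of s] unfolding second_diff_def by linarith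
    qed
    moreover have "4 * K * sqrt h * B s \<ge> 4 * (K * sqrt h)"
      using mult_left_mono[OF B1, of "4 * K * sqrt h"] K_nonneg assms by simp
    moreover have "0 \<le> K * sqrt h" using K_nonneg assms by simp
    ultimately show ?thesis by linarith
  next
    case False
    then have "B s = 0" by (simp add: B_def)
    moreover have "0 \<le> second_diff h s"
    proof (cases "a + h < s \<and> s < b - h")
      case True then show ?thesis using assms by (intro second_diff_nonneg) auto
    next
      case F: False
      show ?thesis
      proof (cases "a < b")
        case True
        with F False have "s < a - h \<or> s > b + h" by auto
        with F False assms True show ?thesis
          using outside[of s] outside[of "s+h"] outside[of "s-h"] unfolding second_diff_def by auto
      next
        case F2: False
        then have "A s = 0" for s using outside[of s] by linarith
        then show ?thesis by (simp add: second_diff_def)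
      qed
    qed
    ultimately show ?thesis by simp
  qed
  \<comment> \<open>At frequency 0 the factor 2 - 2 cos is 0.\<close>
  have zero: "(LINT s|lborel. second_diff h s) = 0"
    using cos_transform_second_diff[of h 0] by (simp add: cos_transform_def)
  have "mass (second_diff h) \<le> (LINT s|lborel. second_diff h s + 4 * K * sqrt h * B s)"
    using integrable_second_diff intB pt by (intro integral_mono) auto
  also have "\<dots> = 4 * K * sqrt h * (LINT s|lborel. B s)"
    using integrable_second_diff intB zero by simp
  also have "(LINT s|lborel. B s) = 4 * h"
    unfolding B_def using assms by (subst Bochner_Integration.integral_add) (auto intro: integrable_indicator_Icc)
  finally show ?thesis by (simp add: mult_ac)
qed

text \<open>\<open>x\<close> lies between \<open>y\<close> and the auxiliary point \<open>z\<close>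
  on the side of the end point. Concavity and A z >= 0 bound the slope from \<open>x\<close> to
  \<open>y\<close> by 2 A x / g <= 2 K / sqrt g, and sqrt g <= 3/2 g because g is at least 7/8. The
  two alternatives in the hypothesis are mirror images, one for each end of the profile.\<close>

lemma increment_le:
  assumes pts: "x \<in> {a<..<b}" "y \<in> {a<..<b}" "z \<in> {a<..<b}"
    and between: "x - z = g / 2 \<and> y - x = h \<or> z - x = g / 2 \<and> x - y = h"
    and g: "7/8 \<le> g" "A x \<le> K * sqrt g" and h: "0 < h"
  shows "A y - A x \<le> 3 * K * h"
proof -
  define u where "u = h / (h + g / 2)"
  have u: "0 \<le> u" "u \<le> 1" "u * (h + g / 2) = h" using g h by (auto simp: u_def)
  have "u * (y - z) = y - x"
  proof -
    have "y - z = h + g / 2 \<and> y - x = h \<or> y - z = - (h + g / 2) \<and> y - x = - h"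
      using between by linarith
    then show ?thesis using u(3) by (auto simp only: mult_minus_right)
  qed
  then have xe: "x = (1 - u) *\<^sub>R y + u *\<^sub>R z" by (simp add: algebra_simps)
  have "A x \<ge> (1 - u) * A y + u * A z"
    unfolding xe using u pts by (intro concave_onD[OF concave]) auto
  then have "(1 - u) * A y \<le> A x" using mult_nonneg_nonneg[OF u(1) nonneg[of z]] by linarith
  then have "(1 - u) * A y * (h + g / 2) \<le> A x * (h + g / 2)" using g h by (intro mult_right_mono) auto
  moreover have "(1 - u) * (h + g / 2) = g / 2" by (simp only: left_diff_distrib u(3)) simp
  then have "(1 - u) * A y * (h + g / 2) = g / 2 * A y" by (metis mult.assoc mult.commute)
  ultimately have 1: "(A y - A x) * g \<le> 2 * A x * h" by (simp add: algebra_simps)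
  have "K * sqrt g \<le> K * (3/2 * g)" using g by (intro mult_left_mono K_nonneg sqrt_le_three_halves) simp
  then have "2 * A x * h \<le> 2 * (K * (3/2 * g)) * h"
    using g h by (intro mult_right_mono mult_left_mono) auto
  then have "(A y - A x) * g \<le> 3 * K * h * g" using 1 by (simp add: algebra_simps)
  then show ?thesis using g by simp
qed

text \<open>Here the second difference is nonnegative and equals D s - D (s + h) for the backward
  difference D, so its integral telescopes to integrals of D over two intervals of length h. At
  distance about 1 from the ends the one-sided slope bounds give at most 3 K h for each integrand,
  hence 6 K h^2 in total; the constant 12 is generous.\<close>

lemma second_diff_interior_mass:
  assumes h: "0 < h" "h \<le> 1/8"
  shows "(LINT s|lborel. \<bar>indicat_real {a+1<..<b-1} s * second_diff h s\<bar>) \<le> 12 * K * h\<^sup>2"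
proof (cases "a + 1 < b - 1")
  case False
  then have "indicat_real {a+1<..<b-1} s = 0" for s by (auto simp: indicator_def)
  then show ?thesis using K_nonneg by simp
next
  case ab: True
  define p q where "p = a + 1" and "q = b - 1"
  define D where "D s = A s - A (s - h)" for s
  have pq: "p < q" using ab by (simp add: p_def q_def)
  have intD: "integrable lborel D"
    unfolding D_def[abs_def] using integrable_A integrable_shift[of A "-h"] by simp
  \<comment> \<open>A step of length at most 1/8 from a point at distance 1 from an end keeps
    distance 7/8.\<close>
  have slope: "A y - A x \<le> 3 * K * h" if "a + 7/8 \<le> x" "y < b" "y = x + h" for x y
    using that h by (intro increment_le[of x y "(a + x) / 2" "x - a"]) (auto intro: lower_end simp: field_simps)
  have slope': "A x - A y \<le> 3 * K * h" if "a < x" "y \<le> b - 7/8" "y = x + h" for x y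
    using that h by (intro increment_le[of y x "(b + y) / 2" "b - y"]) (auto intro: upper_end simp: field_simps)
  let ?I = "indicat_real {p<..<q}"
  have eq: "\<bar>?I s * second_diff h s\<bar> = ?I s * D s - ?I s * D (s + h)" for s
    using second_diff_nonneg[of s h] h
    by (auto simp: indicator_def D_def p_def q_def second_diff_def)
  have i1: "integrable lborel (\<lambda>s. ?I s * D s)"
    using intD integrable_real_mult_indicator[of "{p<..<q}" lborel D] by (simp add: mult.commute)
  have i2: "integrable lborel (\<lambda>s. ?I s * D (s + h))"
    using integrable_shift[OF intD, of h] integrable_real_mult_indicator[of "{p<..<q}" lborel "\<lambda>s. D (s+h)"] by (simp add: mult.commute)
  have i3: "integrable lborel (\<lambda>s. ?I (s - h) * D s)"
    using integrable_shift[OF i2, of "-h"] by simp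
  have "(LINT s|lborel. ?I s * D (s + h)) = (LINT s|lborel. ?I (s - h) * D s)"
    using integral_shift[of "\<lambda>s. ?I s * D (s + h)" "-h"] by simp
  then have "(LINT s|lborel. \<bar>?I s * second_diff h s\<bar>) = (LINT s|lborel. ?I s * D s - ?I (s - h) * D s)"
    unfolding eq using i1 i2 i3 by simp
  also have "\<dots> \<le> (LINT s|lborel. 3 * K * h * (indicat_real {p..p+h} s + indicat_real {q..q+h} s))"
  proof (rule integral_mono)
    fix s
    define J where "J = indicat_real {p..p+h} s + indicat_real {q..q+h} s"
    define X where "X = 3 * K * h"
    have X: "0 \<le> X" using K_nonneg h by (simp add: X_def)
    have J: "0 \<le> J" by (simp add: J_def)
    have J1: "X \<le> X * J" if "s \<in> {p..p+h} \<or> s \<in> {q..q+h}"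
    proof -
      have "1 \<le> J" using that by (auto simp: J_def indicator_def)
      then show ?thesis using mult_left_mono[of 1 J X] X by simp
    qed
    \<comment> \<open>The integrand survives only where the window and its translate by h differ:
      just right of \<open>p\<close>, where D is bounded above, and just right of \<open>q\<close>,
      where it is bounded below. A window shorter than h is covered too.\<close>
    consider "s \<in> {p<..<q}" "s - h \<notin> {p<..<q}" | "s \<notin> {p<..<q}" "s - h \<in> {p<..<q}"
      | "?I s = ?I (s - h)"
      by (cases "s \<in> {p<..<q}"; cases "s - h \<in> {p<..<q}") simp_all
    then have "?I s * D s - ?I (s - h) * D s \<le> X * J"
    proof cases
      case 1
      then have s: "s \<in> {p..p+h}" "s < b" using h by (auto simp: q_def)
      have "D s \<le> X" using slope[of "s - h" s] s h unfolding D_def p_def X_def by auto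
      then show ?thesis using 1 J1 s by simp
    next
      case 2
      then have s: "s \<in> {q..q+h}" using h by auto
      have "- D s \<le> X" using slope'[of "s - h" s] s h pq unfolding D_def q_def p_def X_def by auto
      then show ?thesis using 2 J1 s by simp
    next
      case 3
      then show ?thesis using X J by simp
    qed
    then show "?I s * D s - ?I (s - h) * D s
        \<le> 3 * K * h * (indicat_real {p..p+h} s + indicat_real {q..q+h} s)"
      unfolding X_def J_def .
  next
    show "integrable lborel (\<lambda>s. 3 * K * h * (indicat_real {p..p+h} s + indicat_real {q..q+h} s))"
      by (intro integrable_mult_right Bochner_Integration.integrable_add integrable_indicator_Icc)
  qed (intro Bochner_Integration.integrable_diff i1 i3)
  also have "\<dots> = 3 * K * h * (2 * h)"
  proof -
    have "(LINT s|lborel. indicat_real {p..p+h} s + indicat_real {q..q+h} s) = 2 * h"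
      using h by (subst Bochner_Integration.integral_add[OF integrable_indicator_Icc integrable_indicator_Icc]) simp
    then show ?thesis by (subst integral_mult_right_zero) simp
  qed
  also have "3 * K * h * (2 * h) \<le> 12 * K * h\<^sup>2"
  proof -
    have "0 \<le> K * h\<^sup>2" using K_nonneg by simp
    then show ?thesis by (simp add: power2_eq_square)
  qed
  finally show ?thesis unfolding p_def q_def .
qed

lemma end_split_exists:
  assumes h: "0 < h" "h \<le> 1/8"
  shows "\<exists>G1 G2 G3. end_split (cos_transform A) a b K h G1 G2 G3"
proof -
  define g where "g = second_diff h"
  \<comment> \<open>The second condition in \<open>S2\<close> removes the overlap with
    \<open>S1\<close>, so the sets partition the line even when b - a < 2.\<close>
  define S1 S2 S3 where "S1 = {b-1..}" and "S2 = {..a+1} \<inter> {..<b-1}" and "S3 = {a+1<..<b-1}"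
  have g: "integrable lborel g" unfolding g_def by (rule integrable_second_diff)
  have gi: "integrable lborel (\<lambda>s. indicat_real S s * g s)" if "S \<in> sets borel" for S
    using integrable_real_mult_indicator[of S lborel g] g that by (simp add: mult.commute)
  have S: "S1 \<in> sets borel" "S2 \<in> sets borel" "S3 \<in> sets borel" by (auto simp: S1_def S2_def S3_def)
  have sum: "g s = indicat_real S1 s * g s + indicat_real S2 s * g s + indicat_real S3 s * g s" for s
    by (auto simp: S1_def S2_def S3_def indicator_def)
  have mass: "(LINT s|lborel. \<bar>indicat_real S s * g s\<bar>) \<le> 16 * K * (h * sqrt h)" if "S \<in> sets borel" for S
  proof -
    have "(LINT s|lborel. \<bar>indicat_real S s * g s\<bar>) \<le> mass g"
      using gi[OF that] g by (intro integral_mono) (auto simp: indicator_def)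
    then show ?thesis using second_diff_mass[OF h(1)] unfolding g_def by linarith
  qed
  have zero: "g s = 0" if "s \<le> a - h \<or> b + h \<le> s" "a < b" for s
    using outside[of s] outside[of "s-h"] outside[of "s+h"] that h
    unfolding g_def second_diff_def by auto
  have zero': "g s = 0" if "\<not> a < b" for s
    using outside that unfolding g_def second_diff_def
    by (smt (verit))
  have "end_split (cos_transform A) a b K h (\<lambda>s. indicat_real S1 s * g s) (\<lambda>s. indicat_real S2 s * g s) (\<lambda>s. indicat_real S3 s * g s)"
    unfolding end_split_def
  proof (intro conjI allI impI)
    fix t
    let ?c = "\<lambda>s. cos (2 * pi * t * s)"
    have "(2 - 2 * cos (2 * pi * t * h)) * cos_transform A t = (LINT s|lborel. g s * ?c s)"
      using cos_transform_second_diff[of h t] by (simp add: g_def cos_transform_def)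
    also have "\<dots> = (LINT s|lborel. indicat_real S1 s * g s * ?c s + indicat_real S2 s * g s * ?c s + indicat_real S3 s * g s * ?c s)"
      by (subst sum) (simp add: algebra_simps)
    also have "\<dots> = cos_transform (\<lambda>s. indicat_real S1 s * g s) t + cos_transform (\<lambda>s. indicat_real S2 s * g s) t
        + cos_transform (\<lambda>s. indicat_real S3 s * g s) t"
      unfolding cos_transform_def
      using integrable_mult_cos[OF gi[OF S(1)], of t] integrable_mult_cos[OF gi[OF S(2)], of t] integrable_mult_cos[OF gi[OF S(3)], of t]
      by simp
    finally show "(2 - 2 * cos (2 * pi * t * h)) * cos_transform A t
       = cos_transform (\<lambda>s. indicat_real S1 s * g s) t + cos_transform (\<lambda>s. indicat_real S2 s * g s) t
        + cos_transform (\<lambda>s. indicat_real S3 s * g s) t" .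
  next
    fix s assume *: "indicat_real S1 s * g s \<noteq> 0"
    then have "g s \<noteq> 0" "b - 1 \<le> s" by (auto simp: S1_def indicator_def split: if_splits)
    with zero[of s] zero'[of s] h show "\<bar>s - b\<bar> \<le> 1" by fastforce
  next
    fix s assume *: "indicat_real S2 s * g s \<noteq> 0"
    then have "g s \<noteq> 0" "s \<le> a + 1" by (auto simp: S2_def indicator_def split: if_splits)
    with zero[of s] zero'[of s] h show "\<bar>s - a\<bar> \<le> 1" by fastforce
  next
    show "(LINT s|lborel. \<bar>indicat_real S3 s * g s\<bar>) \<le> 12 * K * h\<^sup>2"
      using second_diff_interior_mass[OF h] by (simp add: S3_def g_def)
  qed (use gi S mass in auto)
  then show ?thesis by blast
qed

end

section \<open>Almost orthogonality\<close>

lemma integrable_product_lborel: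
  fixes f g :: "real \<Rightarrow> real"
  assumes f: "integrable lborel f" and g: "integrable lborel g"
  shows "integrable (lborel \<Otimes>\<^sub>M lborel) (\<lambda>(x, y). f x * g y)"
proof (rule lborel_pair.Fubini_integrable)
  show "(\<lambda>(x, y). f x * g y) \<in> borel_measurable (lborel \<Otimes>\<^sub>M lborel)"
    using f g by measurable
  show "integrable lborel (\<lambda>x. LINT y|lborel. norm (case (x, y) of (x, y) \<Rightarrow> f x * g y))"
    using f g by (simp add: abs_mult)
  show "AE x in lborel. integrable lborel (\<lambda>y. case (x, y) of (x, y) \<Rightarrow> f x * g y)"
    using g by simp
qed

lemma integral_product_lborel:
  fixes f g :: "real \<Rightarrow> real"
  assumes "integrable lborel f" "integrable lborel g"
  shows "(LINT x|lborel. f (fst x) * g (snd x)) = (LINT x|lborel. f x) * (LINT x|lborel. g x)"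
    and "integrable lborel (\<lambda>x. f (fst x) * g (snd x))"
proof -
  have i: "integrable (lborel \<Otimes>\<^sub>M lborel) (\<lambda>(a, b). f a * g b)"
    by (rule integrable_product_lborel[OF assms])
  then show "integrable lborel (\<lambda>x. f (fst x) * g (snd x))"
    unfolding lborel_prod by (simp add: case_prod_unfold)
  have "(LINT x|(lborel \<Otimes>\<^sub>M lborel). (case x of (a, b) \<Rightarrow> f a * g b)) = (LINT a|lborel. LINT b|lborel. f a * g b)"
    by (rule lborel_pair.integral_fst[OF i, symmetric])
  then show "(LINT x|lborel. f (fst x) * g (snd x)) = (LINT x|lborel. f x) * (LINT x|lborel. g x)"
    unfolding lborel_prod by (simp add: case_prod_unfold)
qed

text \<open>By Fubini the pairing is the integral of \<open>G\<close> against the cosine transform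
  of \<open>f\<close> on the interval, so only frequencies in the support of \<open>G\<close>
  matter. Applied once in each variable, it reduces the product of two transforms to a product of
  two pure cosines.\<close>

lemma cos_transform_pairing_bound:
  fixes f G :: "real \<Rightarrow> real"
  assumes G: "integrable lborel G" and f: "continuous_on {c..d} f"
    and B: "\<And>u. G u \<noteq> 0 \<Longrightarrow> \<bar>integral {c..d} (\<lambda>t. f t * cos (2 * pi * t * u))\<bar> \<le> B"
  shows "\<bar>integral {c..d} (\<lambda>t. f t * cos_transform G t)\<bar> \<le> B * mass G"
proof -
  define F where "F t = indicat_real {c..d} t * f t" for t
  have cont: "integral {c..d} (\<lambda>t. f t * g t) = (LINT t|lborel. F t * g t)"
    if "continuous_on {c..d} g" for g
  proof -
    have "set_integrable lborel {c..d} (\<lambda>t. f t * g t)"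
      using f that by (intro borel_integrable_atLeastAtMost' continuous_on_mult)
    then show ?thesis
      using set_borel_integral_eq_integral(2)[of "{c..d}" "\<lambda>t. f t * g t"]
      by (simp add: set_lebesgue_integral_def F_def mult.assoc)
  qed
  have intF: "integrable lborel F"
    using borel_integrable_atLeastAtMost'[OF f] by (simp add: set_integrable_def F_def[abs_def])
  have int2: "integrable (lborel \<Otimes>\<^sub>M lborel) (\<lambda>(t, s). F t * (G s * cos (2 * pi * t * s)))"
  proof (rule Bochner_Integration.integrable_bound[OF integrable_product_lborel[OF intF G]])
    show "(\<lambda>(t, s). F t * (G s * cos (2 * pi * t * s))) \<in> borel_measurable (lborel \<Otimes>\<^sub>M lborel)"
      using intF G by measurable
    show "AE x in lborel \<Otimes>\<^sub>M lborel. norm (case x of (t, s) \<Rightarrow> F t * (G s * cos (2 * pi * t * s)))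
        \<le> norm (case x of (x, y) \<Rightarrow> F x * G y)"
      by (intro AE_I2) (auto simp: abs_mult intro!: mult_left_mono mult_left_le)
  qed
  have "integral {c..d} (\<lambda>t. f t * cos_transform G t) = (LINT t|lborel. F t * cos_transform G t)"
    using continuous_on_subset[OF continuous_cos_transform[OF G]] by (intro cont) auto
  also have "\<dots> = (LINT t|lborel. LINT s|lborel. F t * (G s * cos (2 * pi * t * s)))"
    by (simp add: cos_transform_def)
  also have "\<dots> = (LINT s|lborel. LINT t|lborel. F t * (G s * cos (2 * pi * t * s)))"
    by (rule lborel_pair.Fubini_integral[OF int2, symmetric])
  also have "\<dots> = (LINT s|lborel. G s * integral {c..d} (\<lambda>t. f t * cos (2 * pi * t * s)))"
  proof (rule Bochner_Integration.integral_cong[OF refl])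
    fix s
    have "(LINT t|lborel. F t * (G s * cos (2 * pi * t * s))) = (LINT t|lborel. G s * (F t * cos (2 * pi * t * s)))"
      by (simp add: mult_ac)
    also have "\<dots> = G s * (LINT t|lborel. F t * cos (2 * pi * t * s))"
      by (rule integral_mult_right_zero)
    also have "(LINT t|lborel. F t * cos (2 * pi * t * s)) = integral {c..d} (\<lambda>t. f t * cos (2 * pi * t * s))"
      by (rule cont[symmetric]) (intro continuous_intros)
    finally show "(LINT t|lborel. F t * (G s * cos (2 * pi * t * s))) = G s * integral {c..d} (\<lambda>t. f t * cos (2 * pi * t * s))" .
  qed
  finally have eq: "integral {c..d} (\<lambda>t. f t * cos_transform G t)
    = (LINT s|lborel. G s * integral {c..d} (\<lambda>t. f t * cos (2 * pi * t * s)))" .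
  have int3: "integrable lborel (\<lambda>s. LINT t|lborel. F t * (G s * cos (2 * pi * t * s)))"
    using lborel_pair.integrable_snd[OF int2] by simp
  have "\<bar>integral {c..d} (\<lambda>t. f t * cos_transform G t)\<bar>
      \<le> (LINT s|lborel. \<bar>G s * integral {c..d} (\<lambda>t. f t * cos (2 * pi * t * s))\<bar>)"
    unfolding eq by (rule integral_abs_bound)
  also have "\<dots> \<le> (LINT s|lborel. B * \<bar>G s\<bar>)"
  proof (rule integral_mono')
    show "integrable lborel (\<lambda>s. B * \<bar>G s\<bar>)" using G by simp
    fix s
    show le: "\<bar>G s * integral {c..d} (\<lambda>t. f t * cos (2 * pi * t * s))\<bar> \<le> B * \<bar>G s\<bar>"
      using B[of s] by (cases "G s = 0") (auto simp: abs_mult mult.commute intro: mult_left_mono)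
    show "0 \<le> B * \<bar>G s\<bar>" using le by (rule order_trans[rotated]) simp
  qed
  finally show ?thesis by simp
qed

section \<open>Frequency decay of the raised cosine window\<close>

lemma abs_integral_le:
  fixes f :: "real \<Rightarrow> real"
  assumes "continuous_on {a..b} f" "\<And>t. \<bar>f t\<bar> \<le> B" "a \<le> b"
  shows "\<bar>integral {a..b} f\<bar> \<le> B * (b - a)"
  using integral_bound[of a b f B] assms by simp

lemma abs_cos_mult_le: "\<bar>x\<bar> \<le> B \<Longrightarrow> \<bar>x * cos y\<bar> \<le> B" for x y :: real
  using mult_left_le[of "\<bar>cos y\<bar>" "\<bar>x\<bar>"] by (simp add: abs_mult)

text \<open>The window and its derivative vanish at c - 2 and c + 2, so integrating by parts twice
  leaves no boundary terms and gains w^2. The constant 18 is 8 from the trivial bound plus 10 >=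
  pi^2 from the twice integrated one.\<close>

lemma integral_raised_cosine_bound:
  fixes c w :: real
  shows "\<bar>integral {c-2..c+2} (\<lambda>t. (1 + cos (pi * (t - c) / 2)) * cos (w * t))\<bar> \<le> 18 / (1 + w\<^sup>2)"
proof -
  let ?e = "\<lambda>t. 1 + cos (pi * (t - c) / 2)"
  let ?X = "integral {c-2..c+2} (\<lambda>t. ?e t * cos (w * t))"
  let ?Y = "integral {c-2..c+2} (\<lambda>t. cos (pi * (t - c) / 2) * cos (w * t))"
  have ei: "(\<lambda>t. ?e t * cos (w * t)) integrable_on {c-2..c+2}"
    and yi: "(\<lambda>t. cos (pi * (t - c) / 2) * cos (w * t)) integrable_on {c-2..c+2}"
    by (intro integrable_continuous_real continuous_intros; simp)+
  have e2: "\<bar>?e t\<bar> \<le> 2" for t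
    using cos_ge_minus_one[of "pi * (t - c) / 2"] cos_le_one[of "pi * (t - c) / 2"] by linarith
  have b1: "\<bar>?X\<bar> \<le> 2 * (c + 2 - (c - 2))"
    by (intro abs_integral_le abs_cos_mult_le continuous_intros e2) auto
  have b2: "\<bar>?Y\<bar> \<le> 1 * (c + 2 - (c - 2))"
    by (intro abs_integral_le abs_cos_mult_le continuous_intros) auto
  have b3: "?X * w\<^sup>2 = (pi\<^sup>2 / 4) * ?Y"
  proof (cases "w = 0")
    \<comment> \<open>For w = 0 the identity says that the cosine integrates to 0 over its full
      period 4.\<close>
    case True
    have "((\<lambda>t. cos (pi * (t - c) / 2)) has_integral
        (2 / pi) * sin (pi * (c + 2 - c) / 2) - (2 / pi) * sin (pi * (c - 2 - c) / 2)) {c-2..c+2}"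
      by (intro fundamental_theorem_of_calculus)
        (auto intro!: derivative_eq_intros simp: has_real_derivative_iff_has_vector_derivative[symmetric])
    then have "?Y = 0" using True by (simp add: has_integral_integral integral_unique)
    then show ?thesis using True by simp
  next
    case w: False
    \<comment> \<open>The sum of the boundary terms of the two integrations by parts.\<close>
    define H where "H t = ?e t * sin (w * t) / w - (pi / 2) * sin (pi * (t - c) / 2) * cos (w * t) / w\<^sup>2" for t
    have "((\<lambda>t. ?e t * cos (w * t) - (pi\<^sup>2 / 4) / w\<^sup>2 * (cos (pi * (t - c) / 2) * cos (w * t)))
        has_integral (H (c + 2) - H (c - 2))) {c-2..c+2}"
    proof (rule fundamental_theorem_of_calculus)
      fix t
      have "(H has_real_derivative ?e t * cos (w * t) - (pi\<^sup>2 / 4) / w\<^sup>2 * (cos (pi * (t - c) / 2) * cos (w * t)))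
          (at t within {c-2..c+2})"
        unfolding H_def using w
        by (auto intro!: derivative_eq_intros simp: field_simps power2_eq_square)
      then show "(H has_vector_derivative ?e t * cos (w * t) - (pi\<^sup>2 / 4) / w\<^sup>2 * (cos (pi * (t - c) / 2) * cos (w * t)))
          (at t within {c-2..c+2})"
        by (simp add: has_real_derivative_iff_has_vector_derivative)
    qed simp
    moreover have "H (c + 2) = 0" "H (c - 2) = 0" by (auto simp: H_def)
    ultimately have "integral {c-2..c+2} (\<lambda>t. ?e t * cos (w * t) - (pi\<^sup>2 / 4) / w\<^sup>2 * (cos (pi * (t - c) / 2) * cos (w * t))) = 0"
      by (simp add: integral_unique)
    then have "?X - (pi\<^sup>2 / 4) / w\<^sup>2 * ?Y = 0"
      using integral_diff[OF ei integrable_on_mult_right[OF yi, of "pi\<^sup>2 / 4 / w\<^sup>2"]]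
      by (simp only: integral_mult_right)
    then show ?thesis using w by (simp add: field_simps)
  qed
  have "\<bar>?X\<bar> * w\<^sup>2 = \<bar>?X * w\<^sup>2\<bar>" by (simp add: abs_mult)
  also have "\<dots> = (pi\<^sup>2 / 4) * \<bar>?Y\<bar>" unfolding b3 by (simp add: abs_mult)
  also have "\<dots> \<le> (pi\<^sup>2 / 4) * 4" using b2 by (intro mult_left_mono) auto
  also have "pi\<^sup>2 \<le> (3.16)\<^sup>2" using pi_approx by (intro power_mono) auto
  finally have "\<bar>?X\<bar> * w\<^sup>2 \<le> 10" by (simp add: power2_eq_square)
  then have "\<bar>?X\<bar> * (1 + w\<^sup>2) \<le> 18" using b1 by (simp add: algebra_simps)
  then show ?thesis by (simp add: pos_le_divide_eq add_pos_nonneg)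
qed

text \<open>The product of cosines splits into the frequencies u - v and u + v, and both are at
  least the difference of |u| and |v| in size. Cosines do not see the sign of a frequency, hence the
  absolute values.\<close>

lemma integral_raised_cosine_product_bound:
  fixes c u v :: real
  shows "\<bar>integral {c-2..c+2} (\<lambda>t. (1 + cos (pi * (t - c) / 2)) * cos (2 * pi * t * u) * cos (2 * pi * t * v))\<bar>
    \<le> 18 / (1 + (\<bar>u\<bar> - \<bar>v\<bar>)\<^sup>2)"
proof -
  let ?e = "\<lambda>t. 1 + cos (pi * (t - c) / 2)"
  let ?J = "\<lambda>w. integral {c-2..c+2} (\<lambda>t. ?e t * cos (w * t))"
  have J: "\<bar>?J (2 * pi * w)\<bar> \<le> 18 / (1 + (\<bar>u\<bar> - \<bar>v\<bar>)\<^sup>2)" if "\<bar>\<bar>u\<bar> - \<bar>v\<bar>\<bar> \<le> \<bar>w\<bar>" for w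
  proof -
    have "\<bar>\<bar>u\<bar> - \<bar>v\<bar>\<bar> \<le> (2 * pi) * \<bar>w\<bar>"
      using that pi_ge_two mult_right_mono[of 1 "2 * pi" "\<bar>w\<bar>"] by linarith
    then have "(\<bar>u\<bar> - \<bar>v\<bar>)\<^sup>2 \<le> (2 * pi * w)\<^sup>2" by (intro abs_le_square_iff[THEN iffD1]) (simp add: abs_mult)
    then have "18 / (1 + (2 * pi * w)\<^sup>2) \<le> 18 / (1 + (\<bar>u\<bar> - \<bar>v\<bar>)\<^sup>2)"
      by (intro divide_left_mono) (auto intro!: mult_pos_pos add_pos_nonneg)
    then show ?thesis using integral_raised_cosine_bound[of c "2 * pi * w"] by linarith
  qed
  have i: "(\<lambda>t. ?e t * cos (w * t)) integrable_on {c-2..c+2}" for w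
    by (intro integrable_continuous_real continuous_intros) simp
  have "integral {c-2..c+2} (\<lambda>t. ?e t * cos (2 * pi * t * u) * cos (2 * pi * t * v))
     = integral {c-2..c+2} (\<lambda>t. (1/2) * (?e t * cos (2 * pi * (u - v) * t) + ?e t * cos (2 * pi * (u + v) * t)))"
  proof (intro arg_cong[where f = "integral {c-2..c+2}"] ext)
    fix t
    have "cos (2 * pi * t * u) * cos (2 * pi * t * v) = (cos (2 * pi * (u - v) * t) + cos (2 * pi * (u + v) * t)) / 2"
      by (simp add: cos_times_cos algebra_simps)
    then show "?e t * cos (2 * pi * t * u) * cos (2 * pi * t * v)
      = (1/2) * (?e t * cos (2 * pi * (u - v) * t) + ?e t * cos (2 * pi * (u + v) * t))"
      by (simp only: mult.assoc) (simp add: algebra_simps)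
  qed
  also have "\<dots> = (1/2) * (?J (2 * pi * (u - v)) + ?J (2 * pi * (u + v)))"
    using i by (simp only: integral_mult_right integral_add)
  moreover have "\<bar>?J (2 * pi * (u - v))\<bar> \<le> 18 / (1 + (\<bar>u\<bar> - \<bar>v\<bar>)\<^sup>2)"
    "\<bar>?J (2 * pi * (u + v))\<bar> \<le> 18 / (1 + (\<bar>u\<bar> - \<bar>v\<bar>)\<^sup>2)"
    by (rule J, linarith)+
  ultimately show ?thesis by (simp only: abs_le_iff) argo
qed

section \<open>Schur test for the kernel 1 / (1 + (m - n)^2)\<close>

lemma sum_inverse_square_le: "(\<Sum>j\<le>N. 1 / (1 + (real j)\<^sup>2)) \<le> 3 - 2 / (real N + 1)"
proof (induction N)
  case (Suc N)
  have "1 / (1 + (real N + 1)\<^sup>2) \<le> 2 / ((real N + 1) * (real N + 2))"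
    by (simp add: divide_le_eq pos_le_divide_eq add_pos_nonneg) (simp add: field_simps power2_eq_square)
  also have "\<dots> = 2 / (real N + 1) - 2 / (real N + 2)" by (simp add: field_simps)
  finally show ?case using Suc by (simp add: add.commute)
qed simp

lemma sum_inverse_square_dist_le:
  fixes m :: nat and S :: "nat set"
  assumes "finite S"
  shows "(\<Sum>n\<in>S. 1 / (1 + (real m - real n)\<^sup>2)) \<le> 6"
proof -
  obtain N where N: "S \<subseteq> {..N}" using assms finite_nat_iff_bounded_le by auto
  let ?f = "\<lambda>n. 1 / (1 + (real m - real n)\<^sup>2)"
  have b: "(\<Sum>j\<le>N. 1 / (1 + (real j)\<^sup>2)) \<le> 3" for N
    using sum_inverse_square_le[of N] by (smt (verit) divide_nonneg_nonneg of_nat_0_le_iff)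
  have "sum ?f S \<le> sum ?f ((\<lambda>j. m - j) ` {..m} \<union> (\<lambda>j. m + j) ` {..N})"
  proof (rule sum_mono2)
    show "S \<subseteq> (\<lambda>j. m - j) ` {..m} \<union> (\<lambda>j. m + j) ` {..N}"
    proof
      fix n assume "n \<in> S"
      then have "n = m - (m - n) \<and> m - n \<le> m \<or> n = m + (n - m) \<and> n - m \<le> N" using N by force
      then show "n \<in> (\<lambda>j. m - j) ` {..m} \<union> (\<lambda>j. m + j) ` {..N}" by blast
    qed
  qed auto
  also have "\<dots> \<le> sum ?f ((\<lambda>j. m - j) ` {..m}) + sum ?f ((\<lambda>j. m + j) ` {..N})"
    by (subst sum_Un) (auto intro!: sum_nonneg)
  also have "sum ?f ((\<lambda>j. m - j) ` {..m}) = (\<Sum>j\<le>m. 1 / (1 + (real j)\<^sup>2))"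
    by (subst sum.reindex) (auto simp: inj_on_def intro!: sum.cong)
  also have "sum ?f ((\<lambda>j. m + j) ` {..N}) = (\<Sum>j\<le>N. 1 / (1 + (real j)\<^sup>2))"
    by (subst sum.reindex) (auto simp: inj_on_def intro!: sum.cong)
  finally show ?thesis using b[of m] b[of N] by simp
qed

text \<open>Schur's test: the kernel is symmetric with row sums at most 6, and A m * A n is at most
  the mean of the two squares.\<close>

lemma schur_inverse_square:
  fixes A :: "nat \<Rightarrow> real"
  assumes "finite S"
  shows "(\<Sum>m\<in>S. \<Sum>n\<in>S. A m * A n / (1 + (real m - real n)\<^sup>2)) \<le> 6 * (\<Sum>m\<in>S. (A m)\<^sup>2)"
proof -
  let ?K = "\<lambda>m n. 1 / (1 + (real m - real n)\<^sup>2)"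
  have "(\<Sum>m\<in>S. \<Sum>n\<in>S. A m * A n / (1 + (real m - real n)\<^sup>2))
      \<le> (\<Sum>m\<in>S. \<Sum>n\<in>S. (A m)\<^sup>2 / 2 * ?K m n + (A n)\<^sup>2 / 2 * ?K n m)"
  proof (intro sum_mono)
    fix m n
    have k: "0 \<le> ?K m n" "?K n m = ?K m n" by (auto simp: power2_commute)
    have "A m * A n \<le> (A m)\<^sup>2 / 2 + (A n)\<^sup>2 / 2"
      using sum_squares_bound[of "A m" "A n"] by simp
    from mult_right_mono[OF this k(1)]
    show "A m * A n / (1 + (real m - real n)\<^sup>2) \<le> (A m)\<^sup>2 / 2 * ?K m n + (A n)\<^sup>2 / 2 * ?K n m"
      unfolding k(2) distrib_right by simp
  qed
  also have "\<dots> = (\<Sum>m\<in>S. \<Sum>n\<in>S. (A m)\<^sup>2 / 2 * ?K m n) + (\<Sum>m\<in>S. \<Sum>n\<in>S. (A n)\<^sup>2 / 2 * ?K n m)"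
    by (simp only: sum.distrib)
  also have "(\<Sum>m\<in>S. \<Sum>n\<in>S. (A n)\<^sup>2 / 2 * ?K n m) = (\<Sum>m\<in>S. \<Sum>n\<in>S. (A m)\<^sup>2 / 2 * ?K m n)"
    by (rule sum.swap)
  also have "(\<Sum>m\<in>S. \<Sum>n\<in>S. (A m)\<^sup>2 / 2 * ?K m n) \<le> (\<Sum>m\<in>S. (A m)\<^sup>2 / 2 * 6)"
    unfolding sum_distrib_left[symmetric]
    by (intro sum_mono mult_left_mono sum_inverse_square_dist_le assms) simp
  finally show ?thesis by (simp add: sum_distrib_left field_simps)
qed

text \<open>Passing from frequencies to integer labels changes distances by at most 4, and (x + 4)^2
  <= 2 x^2 + 32. This costs a factor 65, and 1170 = 18 * 65.\<close>

lemma inverse_square_dist_floor: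
  fixes u v :: real and m n :: nat
  assumes "\<bar>\<bar>u\<bar> - real m\<bar> \<le> 2" "\<bar>\<bar>v\<bar> - real n\<bar> \<le> 2"
  shows "18 / (1 + (\<bar>u\<bar> - \<bar>v\<bar>)\<^sup>2) \<le> 1170 / (1 + (real m - real n)\<^sup>2)"
proof -
  define x y where "x = \<bar>u\<bar> - \<bar>v\<bar>" and "y = real m - real n"
  have "\<bar>y\<bar> \<le> \<bar>x\<bar> + 4" using assms unfolding x_def y_def by linarith
  then have "y\<^sup>2 \<le> (\<bar>x\<bar> + 4)\<^sup>2" by (intro abs_le_square_iff[THEN iffD1]) simp
  also have "\<dots> \<le> 2 * x\<^sup>2 + 32" using sum_squares_bound[of "\<bar>x\<bar>" 4] by (simp add: power2_eq_square algebra_simps)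
  finally have "1 + y\<^sup>2 \<le> 65 * (1 + x\<^sup>2)" using zero_le_power2[of x] by argo
  then have "18 * (1 + y\<^sup>2) \<le> 1170 * (1 + x\<^sup>2)" by simp
  then show ?thesis
    unfolding x_def[symmetric] y_def[symmetric]
    by (simp add: divide_le_eq pos_le_divide_eq add_pos_nonneg)
qed

text \<open>Integrated against the window, transforms whose frequencies lie near the integers p and
  q interact by at most 1 / (1 + (p - q)^2), so after grouping by integer part the Schur test leaves
  only the diagonal; 7020 = 6 * 1170. The support condition is on |s| because the lower ends of the
  profiles sit at negative frequencies.\<close>

lemma cos_transform_almost_orthogonal:
  fixes G :: "'k \<Rightarrow> real \<Rightarrow> real" and r a :: "'k \<Rightarrow> real"
  assumes fin: "finite I"
    and G: "\<And>k. k \<in> I \<Longrightarrow> integrable lborel (G k)"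
    and mass: "\<And>k. k \<in> I \<Longrightarrow> mass (G k) \<le> a k"
    and supp: "\<And>k s. k \<in> I \<Longrightarrow> G k s \<noteq> 0 \<Longrightarrow> \<bar>\<bar>s\<bar> - r k\<bar> \<le> 1"
    and r: "\<And>k. k \<in> I \<Longrightarrow> 0 \<le> r k"
  defines "m \<equiv> \<lambda>k. nat \<lfloor>r k\<rfloor>"
  shows "integral {c-1..c+1} (\<lambda>t. (\<Sum>k\<in>I. cos_transform (G k) t)\<^sup>2)
    \<le> 7020 * (\<Sum>n\<in>m ` I. (\<Sum>k | k \<in> I \<and> m k = n. a k)\<^sup>2)"
proof -
  let ?A = "\<lambda>p. \<Sum>k | k \<in> I \<and> m k = p. a k"
  let ?e = "\<lambda>t. 1 + cos (pi * (t - c) / 2)"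
  let ?c = "\<lambda>k. cos_transform (G k)"
  have cc: "continuous_on S (?c k)" if "k \<in> I" for k S
    using continuous_on_subset[OF continuous_cos_transform[OF G[OF that]]] by auto
  have a: "0 \<le> a k" if "k \<in> I" for k
    using mass[OF that] by (rule order_trans[rotated]) simp
  have near: "\<bar>\<bar>s\<bar> - real (m k)\<bar> \<le> 2" if "k \<in> I" "G k s \<noteq> 0" for k s
  proof -
    have "real (m k) = of_int \<lfloor>r k\<rfloor>" using r[OF that(1)] unfolding m_def by simp
    then have "\<bar>r k - real (m k)\<bar> \<le> 1" by linarith
    then show ?thesis using supp[OF that] by linarith
  qed
  have pair: "\<bar>integral {c-2..c+2} (\<lambda>t. ?e t * ?c k t * ?c l t)\<bar> \<le> 1170 / (1 + (real (m k) - real (m l))\<^sup>2) * a l * a k"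
    if k: "k \<in> I" and l: "l \<in> I" for k l
  proof -
    let ?B = "1170 / (1 + (real (m k) - real (m l))\<^sup>2)"
    have B0: "0 \<le> ?B" by (intro divide_nonneg_nonneg) auto
    have one: "\<bar>integral {c-2..c+2} (\<lambda>t. ?e t * cos (2 * pi * t * u) * ?c l t)\<bar> \<le> ?B * a l" if u: "G k u \<noteq> 0" for u
    proof -
      have "\<bar>integral {c-2..c+2} (\<lambda>t. ?e t * cos (2 * pi * t * u) * ?c l t)\<bar> \<le> ?B * mass (G l)"
      proof (rule cos_transform_pairing_bound[OF G[OF l]])
        show "continuous_on {c-2..c+2} (\<lambda>t. ?e t * cos (2 * pi * t * u))"
          by (intro continuous_intros) simp
        fix v assume v: "G l v \<noteq> 0"
        show "\<bar>integral {c-2..c+2} (\<lambda>t. ?e t * cos (2 * pi * t * u) * cos (2 * pi * t * v))\<bar> \<le> ?B"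
          using integral_raised_cosine_product_bound[of c u v]
            inverse_square_dist_floor[OF near[OF k u] near[OF l v]] by linarith
      qed
      also have "\<dots> \<le> ?B * a l" using B0 mass[OF l] by (rule mult_left_mono[rotated])
      finally show ?thesis .
    qed
    have "\<bar>integral {c-2..c+2} (\<lambda>t. ?e t * ?c l t * ?c k t)\<bar> \<le> (?B * a l) * mass (G k)"
    proof (rule cos_transform_pairing_bound[OF G[OF k]])
      show "continuous_on {c-2..c+2} (\<lambda>t. ?e t * ?c l t)"
        by (intro continuous_intros cc l) simp
      fix u assume u: "G k u \<noteq> 0"
      have eq: "(\<lambda>t. ?e t * ?c l t * cos (2 * pi * t * u)) = (\<lambda>t. ?e t * cos (2 * pi * t * u) * ?c l t)"
        by (simp only: mult_ac)
      show "\<bar>integral {c-2..c+2} (\<lambda>t. ?e t * ?c l t * cos (2 * pi * t * u))\<bar> \<le> ?B * a l"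
        unfolding eq by (rule one[OF u])
    qed
    also have "\<dots> \<le> (?B * a l) * a k"
      using B0 a[OF l] mass[OF k] by (intro mult_left_mono mult_nonneg_nonneg)
    finally show ?thesis by (simp only: mult_ac)
  qed
  let ?U = "\<lambda>t. \<Sum>k\<in>I. ?c k t"
  \<comment> \<open>The window is at least 1 on the middle half of its interval and nonnegative on
    all of it, so inserting it and then enlarging the interval only increases the integral.\<close>
  have "integral {c-1..c+1} (\<lambda>t. (?U t)\<^sup>2) \<le> integral {c-1..c+1} (\<lambda>t. ?e t * (?U t)\<^sup>2)"
  proof (rule integral_le)
    show "(\<lambda>t. (?U t)\<^sup>2) integrable_on {c-1..c+1}" "(\<lambda>t. ?e t * (?U t)\<^sup>2) integrable_on {c-1..c+1}"
      by (intro integrable_continuous_real continuous_intros cc; simp)+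
    fix t assume "t \<in> {c-1..c+1}"
    then have "0 \<le> cos (pi * (t - c) / 2)"
      using mult_left_mono[of "t - c" 1 pi] mult_left_mono[of "-1" "t - c" pi]
      by (intro cos_ge_zero) auto
    then have "1 * (?U t)\<^sup>2 \<le> ?e t * (?U t)\<^sup>2" by (intro mult_right_mono) auto
    then show "(?U t)\<^sup>2 \<le> ?e t * (?U t)\<^sup>2" by simp
  qed
  also have "\<dots> \<le> integral {c-2..c+2} (\<lambda>t. ?e t * (?U t)\<^sup>2)"
  proof (rule integral_subset_le)
    show "(\<lambda>t. ?e t * (?U t)\<^sup>2) integrable_on {c-1..c+1}" "(\<lambda>t. ?e t * (?U t)\<^sup>2) integrable_on {c-2..c+2}"
      by (intro integrable_continuous_real continuous_intros cc; simp)+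
    show "\<forall>t\<in>{c-2..c+2}. 0 \<le> ?e t * (?U t)\<^sup>2"
    proof (intro ballI mult_nonneg_nonneg)
      fix t
      show "0 \<le> ?e t" using cos_ge_minus_one[of "pi * (t - c) / 2"] by linarith
    qed simp
  qed auto
  also have "\<dots> = (\<Sum>k\<in>I. \<Sum>l\<in>I. integral {c-2..c+2} (\<lambda>t. ?e t * ?c k t * ?c l t))"
  proof -
    have "(\<lambda>t. ?e t * (?U t)\<^sup>2) = (\<lambda>t. \<Sum>k\<in>I. \<Sum>l\<in>I. ?e t * ?c k t * ?c l t)"
      by (simp only: power2_eq_square sum_product) (simp only: sum_distrib_left mult.assoc)
    moreover have i: "(\<lambda>t. ?e t * ?c k t * ?c l t) integrable_on {c-2..c+2}" if "k \<in> I" "l \<in> I" for k l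
      by (intro integrable_continuous_real continuous_intros cc that; simp)
    ultimately show ?thesis
      using fin by (simp add: integral_sum integrable_sum)
  qed
  also have "\<dots> \<le> (\<Sum>k\<in>I. \<Sum>l\<in>I. 1170 / (1 + (real (m k) - real (m l))\<^sup>2) * a l * a k)"
    by (intro sum_mono) (use pair in \<open>auto intro: order_trans[OF abs_ge_self]\<close>)
  also have "\<dots> = 1170 * (\<Sum>p\<in>m ` I. \<Sum>q\<in>m ` I. ?A p * ?A q
      / (1 + (real p - real q)\<^sup>2))"
  proof -
    let ?K = "\<lambda>p q. 1170 / (1 + (real p - real q)\<^sup>2)"
    have "(\<Sum>l\<in>I. ?K (m k) (m l) * a l * a k) = (\<Sum>q\<in>m ` I. ?K (m k) q * ?A q * a k)" for k
      by (subst sum.image_gen[OF fin, of _ m]) (auto simp: sum_distrib_left sum_distrib_right intro!: sum.cong)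
    then have "(\<Sum>k\<in>I. \<Sum>l\<in>I. ?K (m k) (m l) * a l * a k)
        = (\<Sum>k\<in>I. \<Sum>q\<in>m ` I. ?K (m k) q * ?A q * a k)" by simp
    also have "\<dots> = (\<Sum>p\<in>m ` I. \<Sum>k | k \<in> I \<and> m k = p. \<Sum>q\<in>m ` I. ?K (m k) q * ?A q * a k)"
      by (rule sum.image_gen[OF fin])
    also have "\<dots> = (\<Sum>p\<in>m ` I. \<Sum>q\<in>m ` I. \<Sum>k | k \<in> I \<and> m k = p. ?K p q * ?A q * a k)"
      by (intro sum.cong refl, subst sum.swap) (auto intro!: sum.cong)
    also have "\<dots> = 1170 * (\<Sum>p\<in>m ` I. \<Sum>q\<in>m ` I. ?A p * ?A q
      / (1 + (real p - real q)\<^sup>2))"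
      unfolding sum_distrib_left[symmetric]
      by (simp add: sum_distrib_left[of 1170] mult_ac)
    finally show ?thesis .
  qed
  also have "\<dots> \<le> 1170 * (6 * (\<Sum>n\<in>m ` I. (?A n)\<^sup>2))"
    using fin by (intro mult_left_mono schur_inverse_square) auto
  finally show ?thesis by simp
qed

section \<open>A periodic kernel and its Fejer means\<close>

text \<open>This is 1/N times the squared modulus of the sum of exp (2 pi i j y) over j < N,
  expanded into a double sum so that Fourier coefficients can be read off by counting pairs.\<close>

definition fejer :: "nat \<Rightarrow> real \<Rightarrow> real" where
  "fejer N y = (\<Sum>i<N. \<Sum>j<N. cos (2 * pi * of_int (int i - int j) * y)) / real N"

lemma fejer_eq: "fejer N y = ((\<Sum>i<N. cos (2 * pi * real i * y))\<^sup>2 + (\<Sum>i<N. sin (2 * pi * real i * y))\<^sup>2) / real N"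
  unfolding fejer_def power2_eq_square sum_product sum.distrib[symmetric]
  by (intro arg_cong2[where f = "(/)"] sum.cong refl) (simp add: cos_diff[symmetric] algebra_simps)

lemma fejer_nonneg: "0 \<le> fejer N y"
  unfolding fejer_eq by simp

text \<open>Geometric sum: with z = exp (2 pi i y), |z - 1| |S| = |z^N - 1| <= 2, and |z - 1| = 2
  |sin (pi y)|.\<close>

lemma fejer_sin_bound: "fejer N y * (sin (pi * y))\<^sup>2 \<le> 1 / real N"
proof -
  define z where "z = cis (2 * pi * y)"
  define S where "S = (\<Sum>i<N. z ^ i)"
  have zi: "z ^ i = cis (2 * pi * real i * y)" for i
    unfolding z_def Complex.DeMoivre by (simp only: mult_ac)
  have Re: "Re S = (\<Sum>i<N. cos (2 * pi * real i * y))" and Im: "Im S = (\<Sum>i<N. sin (2 * pi * real i * y))"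
    unfolding S_def zi Re_sum Im_sum cis.sel by (rule refl)+
  have cm: "(cmod (cis x - 1))\<^sup>2 = 4 * (sin (x / 2))\<^sup>2" for x
  proof -
    have "(cmod (cis x - 1))\<^sup>2 = (cos x - 1)\<^sup>2 + (sin x)\<^sup>2" by (simp add: cmod_power2)
    also have "\<dots> = 2 - 2 * cos x" using sin_cos_squared_add[of x] by (simp add: power2_eq_square algebra_simps)
    also have "\<dots> = 4 * (sin (x / 2))\<^sup>2" using cos_double_sin[of "x/2"] by simp
    finally show ?thesis .
  qed
  have "(z - 1) * S = z ^ N - 1" unfolding S_def by (simp add: power_diff_1_eq)
  then have "(cmod (z - 1))\<^sup>2 * (cmod S)\<^sup>2 = (cmod (z ^ N - 1))\<^sup>2"
    by (simp add: norm_mult[symmetric] power_mult_distrib[symmetric])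
  also have "z ^ N = cis (2 * pi * (real N * y))" unfolding z_def by (simp add: Complex.DeMoivre mult_ac)
  also have "(cmod (cis (2 * pi * (real N * y)) - 1))\<^sup>2 \<le> 4"
    unfolding cm using abs_sin_le_one by (simp add: abs_square_le_1)
  finally have "(4 * (sin (pi * y))\<^sup>2) * (cmod S)\<^sup>2 \<le> 4"
    unfolding z_def cm by (simp add: mult_ac)
  then have "(sin (pi * y))\<^sup>2 * (cmod S)\<^sup>2 \<le> 1" by simp
  then have "(sin (pi * y))\<^sup>2 * ((\<Sum>i<N. cos (2 * pi * real i * y))\<^sup>2 + (\<Sum>i<N. sin (2 * pi * real i * y))\<^sup>2) \<le> 1"
    by (simp add: cmod_power2 Re Im)
  then show ?thesis unfolding fejer_eq by (simp add: divide_right_mono mult.commute)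
qed

lemma integral_cos_period:
  fixes k :: int and x :: real
  shows "((\<lambda>z. cos (2 * pi * of_int k * (x - z))) has_integral (if k = 0 then 1 else 0)) {-(1/2)..1/2}"
proof (cases "k = 0")
  case True
  then show ?thesis using has_integral_const_real[of "1::real" "-(1/2)" "1/2"] by simp
next
  case False
  let ?F = "\<lambda>z. - sin (2 * pi * of_int k * (x - z)) / (2 * pi * of_int k)"
  have "((\<lambda>z. cos (2 * pi * of_int k * (x - z))) has_integral ?F (1/2) - ?F (-(1/2))) {-(1/2)..1/2}"
    using False by (intro fundamental_theorem_of_calculus)
      (auto intro!: derivative_eq_intros simp: has_real_derivative_iff_has_vector_derivative[symmetric])
  moreover have "sin (2 * pi * of_int k * (x - -(1/2))) = sin (2 * pi * of_int k * (x - 1/2))"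
  proof -
    have "2 * pi * of_int k * (x - -(1/2)) = 2 * pi * of_int k * (x - 1/2) + 2 * pi * of_int k" by (simp add: algebra_simps)
    then show ?thesis
      by (simp only: sin_add cos_int_2pin sin_int_2pin)
  qed
  ultimately show ?thesis using False by simp
qed

lemma continuous_fejer: "continuous_on S (\<lambda>z. fejer N (x - z))"
  unfolding fejer_def by (cases "N = 0") (auto intro!: continuous_intros)

lemma integral_fejer:
  assumes "N > 0"
  shows "integral {-(1/2)..1/2} (\<lambda>z. fejer N (x - z)) = 1"
proof -
  have "((\<lambda>z. (\<Sum>i<N. \<Sum>j<N. cos (2 * pi * of_int (int i - int j) * (x - z))) / real N) has_integral
      (\<Sum>i<N. \<Sum>j<N. if int i - int j = 0 then 1 else 0) / real N) {-(1/2)..1/2}"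
    by (intro has_integral_divide has_integral_sum integral_cos_period) auto
  also have "(\<Sum>i<N. \<Sum>j<N. if int i - int j = 0 then 1 else 0) = real N"
    by (simp add: sum.delta)
  finally show ?thesis using assms unfolding fejer_def[symmetric] by (simp add: integral_unique)
qed

text \<open>For N > 0 this is the triangular weight max 0 (1 - |k| / N), kept as a count of pairs:
  injections and swaps of pairs then give its bounds and its symmetry.\<close>

definition fejer_weight :: "nat \<Rightarrow> int \<Rightarrow> real" where
  "fejer_weight N k = real (card {(i, j) \<in> {..<N} \<times> {..<N}. int i - int j = k}) / real N"

lemma fejer_weight_bounds: "0 \<le> fejer_weight N k" "fejer_weight N k \<le> 1"
proof -
  have "card {(i, j) \<in> {..<N} \<times> {..<N}. int i - int j = k} \<le> card {..<N}"
    by (rule card_inj_on_le[where f = snd]) (auto simp: inj_on_def)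
  then show "fejer_weight N k \<le> 1" by (cases "N = 0") (auto simp: fejer_weight_def)
qed (simp add: fejer_weight_def)

lemma fejer_weight_0: "N > 0 \<Longrightarrow> fejer_weight N 0 = 1"
proof -
  assume "N > 0"
  have "{(i, j) \<in> {..<N} \<times> {..<N}. int i - int j = 0} = (\<lambda>i. (i, i)) ` {..<N}" by auto
  then have "card {(i, j) \<in> {..<N} \<times> {..<N}. int i - int j = 0} = N" by (simp add: card_image inj_on_def)
  with \<open>N > 0\<close> show ?thesis by (simp add: fejer_weight_def)
qed

lemma fejer_weight_minus: "fejer_weight N (- k) = fejer_weight N k"
proof -
  have "{(i, j) \<in> {..<N} \<times> {..<N}. int i - int j = - k} = prod.swap ` {(i, j) \<in> {..<N} \<times> {..<N}. int i - int j = k}"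
    by (auto simp: image_iff)
  then show ?thesis by (simp add: fejer_weight_def card_image)
qed

lemma fejer_weight_sum:
  fixes f :: "int \<Rightarrow> real"
  shows "(\<Sum>i<N. \<Sum>j<N. f (int i - int j)) / real N = (\<Sum>k\<in>{-int N..int N}. fejer_weight N k * f k)"
proof -
  let ?P = "{..<N} \<times> {..<N}"
  have "(\<Sum>i<N. \<Sum>j<N. f (int i - int j)) = (\<Sum>p\<in>?P. f (int (fst p) - int (snd p)))"
    by (simp add: sum.cartesian_product case_prod_beta)
  also have "\<dots> = (\<Sum>k\<in>{-int N..int N}. \<Sum>p\<in>{p \<in> ?P. int (fst p) - int (snd p) = k}. f (int (fst p) - int (snd p)))"
    by (rule sum.group[symmetric]) auto
  also have "\<dots> = (\<Sum>k\<in>{-int N..int N}. real (card {p \<in> ?P. int (fst p) - int (snd p) = k}) * f k)"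
    by (intro sum.cong refl) simp
  finally show ?thesis
    by (simp add: fejer_weight_def sum_divide_distrib case_prod_unfold mem_Times_iff conj_assoc)
qed

text \<open>A smoothing kernel supported near the integers that is 1-periodic by construction and whose
  increments are bounded by \<open>sin (pi * (x - z))\<close>, exactly what the Fejer kernel absorbs.\<close>

definition bump :: "real \<Rightarrow> real \<Rightarrow> real" where
  "bump e x = max 0 (cos (2 * pi * x) - cos (2 * pi * e))"

lemma bump_nonneg: "0 \<le> bump e x" by (simp add: bump_def)

lemma continuous_bump [continuous_intros]:
  fixes f :: "'a :: t2_space \<Rightarrow> real"
  shows "continuous_on S f \<Longrightarrow> continuous_on S (\<lambda>x. bump e (f x))"
  unfolding bump_def by (auto intro!: continuous_intros)

lemma bump_le: "bump e x \<le> 2"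
  using cos_le_one[of "2 * pi * x"] cos_ge_minus_one[of "2 * pi * e"] by (simp add: bump_def del: cos_le_one cos_ge_minus_one)

lemma bump_minus: "bump e (- x) = bump e x" by (simp add: bump_def)

lemma bump_add_int: "bump e (x + of_int n) = bump e x"
proof -
  have "cos (2 * pi * (x + of_int n)) = cos (2 * pi * x)"
    using cos_add[of "2 * pi * x" "2 * pi * of_int n"] by (simp add: distrib_left cos_int_2pin sin_int_2pin)
  then show ?thesis by (simp add: bump_def)
qed

lemma bump_eq: "\<bar>x\<bar> \<le> e \<Longrightarrow> e \<le> 1/2 \<Longrightarrow> bump e x = cos (2 * pi * x) - cos (2 * pi * e)"
proof -
  assume *: "\<bar>x\<bar> \<le> e" "e \<le> 1/2"
  then have "cos (2 * pi * e) \<le> cos (2 * pi * \<bar>x\<bar>)" by (intro cos_monotone_0_pi_le) auto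
  then show ?thesis by (simp add: bump_def abs_if split: if_splits)
qed

lemma bump_eq_0: "e \<le> \<bar>x\<bar> \<Longrightarrow> \<bar>x\<bar> \<le> 1/2 \<Longrightarrow> 0 \<le> e \<Longrightarrow> bump e x = 0"
proof -
  assume *: "e \<le> \<bar>x\<bar>" "\<bar>x\<bar> \<le> 1/2" "0 \<le> e"
  then have "cos (2 * pi * \<bar>x\<bar>) \<le> cos (2 * pi * e)" by (intro cos_monotone_0_pi_le) auto
  then show ?thesis by (simp add: bump_def abs_if split: if_splits)
qed

lemma bump_nonzero_near_int:
  assumes "bump e x \<noteq> 0" "0 \<le> e"
  shows "\<bar>x - of_int (round x)\<bar> < e"
proof (rule ccontr)
  assume *: "\<not> ?thesis"
  have "\<bar>x - of_int (round x)\<bar> \<le> 1/2"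
    using of_int_round_abs_le[of x] by (simp add: abs_minus_commute)
  then have "bump e (x - of_int (round x)) = 0" using * assms by (intro bump_eq_0) auto
  then show False using assms bump_add_int[of e "x - of_int (round x)" "round x"] by simp
qed

lemma bump_lipschitz: "\<bar>bump e z - bump e x\<bar> \<le> 2 * \<bar>sin (pi * (x - z))\<bar>"
proof -
  have "\<bar>bump e z - bump e x\<bar> \<le> \<bar>cos (2 * pi * z) - cos (2 * pi * x)\<bar>" unfolding bump_def by linarith
  also have "\<dots> = 2 * \<bar>sin (pi * (z + x))\<bar> * \<bar>sin (pi * (x - z))\<bar>"
  proof -
    have "(2 * pi * z + 2 * pi * x) / 2 = pi * (z + x)" "(2 * pi * x - 2 * pi * z) / 2 = pi * (x - z)"
      by (simp_all add: field_simps)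
    then show ?thesis by (simp add: cos_diff_cos abs_mult)
  qed
  also have "\<dots> \<le> 2 * 1 * \<bar>sin (pi * (x - z))\<bar>" by (intro mult_right_mono mult_left_mono) auto
  finally show ?thesis by simp
qed

section \<open>Fourier coefficients and Fejer means of the bump\<close>

definition bump_coeff :: "real \<Rightarrow> int \<Rightarrow> real" where
  "bump_coeff e k = integral {-(1/2)..1/2} (\<lambda>z. bump e z * cos (2 * pi * of_int k * z))"

lemma bump_coeff_minus: "bump_coeff e (- k) = bump_coeff e k"
  by (simp add: bump_coeff_def)

text \<open>The bump is even, so its sine coefficients vanish.\<close>

lemma integral_bump_translate:
  "integral {-(1/2)..1/2} (\<lambda>z. bump e z * cos (2 * pi * of_int k * (x - z))) = bump_coeff e k * cos (2 * pi * of_int k * x)"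
proof -
  let ?s = "\<lambda>z. bump e z * sin (2 * pi * of_int k * z)"
  have "integral {-(1/2)..1/2} ?s = integral {-(1/2)..1/2} (\<lambda>z. ?s (- z))"
    using Henstock_Kurzweil_Integration.integral_reflect_real[of "1/2" "-(1/2)" ?s] by simp
  also have "\<dots> = - integral {-(1/2)..1/2} ?s" by (simp add: bump_minus)
  finally have s0: "integral {-(1/2)..1/2} ?s = 0" by simp
  have i: "(\<lambda>z. bump e z * cos (2 * pi * of_int k * z)) integrable_on {-(1/2)..1/2}"
    "?s integrable_on {-(1/2)..1/2}"
    by (intro integrable_continuous_real continuous_intros)+
  have "(\<lambda>z. bump e z * cos (2 * pi * of_int k * (x - z))) = (\<lambda>z. bump e z * cos (2 * pi * of_int k * z) * cos (2 * pi * of_int k * x)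
       + ?s z * sin (2 * pi * of_int k * x))"
    by (simp add: right_diff_distrib cos_diff algebra_simps)
  then have "integral {-(1/2)..1/2} (\<lambda>z. bump e z * cos (2 * pi * of_int k * (x - z)))
     = bump_coeff e k * cos (2 * pi * of_int k * x) + integral {-(1/2)..1/2} ?s * sin (2 * pi * of_int k * x)"
    using i by (simp add: integral_add integrable_on_mult_left bump_coeff_def)
  then show ?thesis using s0 by simp
qed

definition bump_mean :: "real \<Rightarrow> nat \<Rightarrow> real \<Rightarrow> real" where
  "bump_mean e N x = integral {-(1/2)..1/2} (\<lambda>z. bump e z * fejer N (x - z))"

lemma fejer_mean_bump:
  "bump_mean e N x
     = (\<Sum>k\<in>{-int N..int N}. fejer_weight N k * bump_coeff e k * cos (2 * pi * of_int k * x))"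
proof -
  have "(\<lambda>z. bump e z * fejer N (x - z))
     = (\<lambda>z. (\<Sum>k\<in>{-int N..int N}. fejer_weight N k * (bump e z * cos (2 * pi * of_int k * (x - z)))))"
    unfolding fejer_def fejer_weight_sum[of "\<lambda>k. cos (2 * pi * of_int k * (x - z))" for z, unfolded]
    by (simp add: sum_distrib_left mult_ac)
  then have "bump_mean e N x
     = (\<Sum>k\<in>{-int N..int N}. integral {-(1/2)..1/2} (\<lambda>z. fejer_weight N k * (bump e z * cos (2 * pi * of_int k * (x - z)))))"
    unfolding bump_mean_def by (simp only:, intro integral_sum) (auto intro!: integrable_continuous_real continuous_intros)
  then show ?thesis
    by (simp only: Henstock_Kurzweil_Integration.integral_mult_right integral_bump_translate) (simp only: mult.assoc)
qed

text \<open>For s = |sin (pi (x - z))| the free parameter d splits the Lipschitz bound as s <= d +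
  s^2 / d. The first term meets the unit mass of the Fejer kernel, the second its pointwise bound 1
  / (N s^2).\<close>

lemma fejer_mean_bump_error:
  assumes "N > 0" "d > 0"
  shows "\<bar>bump_mean e N x - bump e x\<bar> \<le> 2 * (d + 1 / (d * real N))"
proof -
  have c: "(\<lambda>z. bump e z * fejer N (x - z)) integrable_on {-(1/2)..1/2}"
    "(\<lambda>z. bump e x * fejer N (x - z)) integrable_on {-(1/2)..1/2}"
    "(\<lambda>z. (bump e z - bump e x) * fejer N (x - z)) integrable_on {-(1/2)..1/2}"
    "(\<lambda>z. fejer N (x - z)) integrable_on {-(1/2)..1/2}"
    by (intro integrable_continuous_real continuous_intros continuous_fejer)+
  have "bump_mean e N x - bump e x
     = integral {-(1/2)..1/2} (\<lambda>z. bump e z * fejer N (x - z)) - integral {-(1/2)..1/2} (\<lambda>z. bump e x * fejer N (x - z))"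
    using integral_fejer[OF assms(1)] by (simp add: bump_mean_def)
  also have "\<dots> = integral {-(1/2)..1/2} (\<lambda>z. (bump e z - bump e x) * fejer N (x - z))"
    unfolding left_diff_distrib by (rule Henstock_Kurzweil_Integration.integral_diff[OF c(1,2), symmetric])
  finally have "\<bar>bump_mean e N x - bump e x\<bar>
     = norm (integral {-(1/2)..1/2} (\<lambda>z. (bump e z - bump e x) * fejer N (x - z)))" by simp
  also have "\<dots> \<le> integral {-(1/2)..1/2} (\<lambda>z. 2 * d * fejer N (x - z) + 2 / (d * real N))"
  proof (rule integral_norm_bound_integral)
    fix z
    define s where "s = \<bar>sin (pi * (x - z))\<bar>"
    have "s \<le> d + s\<^sup>2 / d"
    proof -
      have "s * d \<le> d\<^sup>2 + s\<^sup>2" using sum_squares_bound[of s d] zero_le_power2[of s] zero_le_power2[of d]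
        by linarith
      then show ?thesis using assms(2) by (simp add: field_simps power2_eq_square)
    qed
    then have "norm ((bump e z - bump e x) * fejer N (x - z)) \<le> 2 * (d + s\<^sup>2 / d) * fejer N (x - z)"
      using bump_lipschitz[of e z x] fejer_nonneg[of N "x - z"]
      by (auto simp: abs_mult s_def intro!: mult_right_mono)
    also have "\<dots> = 2 * d * fejer N (x - z) + 2 / d * (fejer N (x - z) * (sin (pi * (x - z)))\<^sup>2)"
      by (simp add: s_def algebra_simps)
    also have "\<dots> \<le> 2 * d * fejer N (x - z) + 2 / d * (1 / real N)"
      using fejer_sin_bound[of N "x - z"] assms by (intro add_left_mono mult_left_mono) auto
    finally show "norm ((bump e z - bump e x) * fejer N (x - z)) \<le> 2 * d * fejer N (x - z) + 2 / (d * real N)"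
      by simp
  qed (intro c integrable_continuous_real continuous_intros continuous_fejer)+
  also have "\<dots> = 2 * d * integral {-(1/2)..1/2} (\<lambda>z. fejer N (x - z)) + integral {-(1/2)..1/2} (\<lambda>z::real. 2 / (d * real N))"
    using c(4) by (subst integral_add) (auto intro: integrable_on_mult_right)
  also have "\<dots> = 2 * (d + 1 / (d * real N))"
    using integral_fejer[OF assms(1)] by simp
  finally show ?thesis .
qed

lemma bump_coeff_restrict:
  assumes "0 < e" "e \<le> 1/4"
  shows "bump_coeff e k = integral {-e..e} (\<lambda>z. (cos (2 * pi * z) - cos (2 * pi * e)) * cos (2 * pi * of_int k * z))"
proof -
  have "integral {-e..e} (\<lambda>z. (cos (2 * pi * z) - cos (2 * pi * e)) * cos (2 * pi * of_int k * z))
     = integral {-e..e} (\<lambda>z. bump e z * cos (2 * pi * of_int k * z))"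
    using assms by (intro integral_cong) (auto simp: bump_eq)
  also have "\<dots> = integral {-(1/2)..1/2} (\<lambda>z. if z \<in> {-e..e} then bump e z * cos (2 * pi * of_int k * z) else 0)"
  proof -
    have "{-e..e} \<inter> {-(1/2)..1/2} = {-e..e}" using assms by auto
    then show ?thesis by (simp only: Henstock_Kurzweil_Integration.integral_restrict_Int)
  qed
  also have "\<dots> = bump_coeff e k" unfolding bump_coeff_def
    using assms by (intro integral_cong) (auto intro!: bump_eq_0)
  finally show ?thesis by simp
qed

text \<open>The bump is 2 sin (pi (e + z)) sin (pi (e - z)) on [-e, e], and Jordan's inequality sin
  (pi y) >= 2 y on [0, 1/2], from concavity of sine, bounds it below by 8 (e^2 - z^2), with integral
  32/3 e^3. The condition e <= 1/4 keeps both arguments in range.\<close>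

lemma bump_coeff_0_ge:
  assumes "0 < e" "e \<le> 1/4"
  shows "10 * e ^ 3 \<le> bump_coeff e 0"
proof -
  have "((\<lambda>z. 8 * (e\<^sup>2 - z\<^sup>2)) has_integral 8 * (e\<^sup>2 * e - e ^ 3 / 3) - 8 * (e\<^sup>2 * (- e) - (- e) ^ 3 / 3)) {-e..e}"
    using assms by (intro fundamental_theorem_of_calculus)
      (auto intro!: derivative_eq_intros simp: has_real_derivative_iff_has_vector_derivative[symmetric])
  then have "32 / 3 * e ^ 3 = integral {-e..e} (\<lambda>z. 8 * (e\<^sup>2 - z\<^sup>2))"
    by (simp add: integral_unique power3_eq_cube power2_eq_square)
  also have "\<dots> \<le> integral {-e..e} (\<lambda>z. cos (2 * pi * z) - cos (2 * pi * e))"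
  proof (rule integral_le)
    fix z assume z: "z \<in> {-e..e}"
    have sn: "2 * y \<le> sin (pi * y)" if "0 \<le> y" "y \<le> 1/2" for y
    proof -
      have "concave_on {0..pi/2} sin"
        by (rule f''_le0_imp_concave[where f' = cos and f'' = "\<lambda>x. - sin x"])
          (auto intro!: derivative_eq_intros sin_ge_zero)
      from concave_onD[OF this, of "2 * y" 0 "pi/2"] that show ?thesis by (simp add: mult.commute)
    qed
    have le: "0 \<le> sin (pi * y)" if "0 \<le> y" "y \<le> 1/2" for y
      using sn[OF that] that by linarith
    have "8 * (e\<^sup>2 - z\<^sup>2) = 2 * ((2 * (e + z)) * (2 * (e - z)))" by (simp add: power2_eq_square algebra_simps)
    also have "\<dots> \<le> 2 * (sin (pi * (e + z)) * sin (pi * (e - z)))"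
      using z assms by (intro mult_left_mono mult_mono sn le) auto
    also have "\<dots> = cos (2 * pi * z) - cos (2 * pi * e)"
    proof -
      have "(2 * pi * z + 2 * pi * e) / 2 = pi * (e + z)" "(2 * pi * e - 2 * pi * z) / 2 = pi * (e - z)"
        by (simp_all add: field_simps)
      then show ?thesis by (simp add: cos_diff_cos)
    qed
    finally show "8 * (e\<^sup>2 - z\<^sup>2) \<le> cos (2 * pi * z) - cos (2 * pi * e)" .
  qed (intro integrable_continuous_real continuous_intros)+
  also have "\<dots> = bump_coeff e 0" using bump_coeff_restrict[OF assms, of 0] by simp
  finally show ?thesis using assms zero_le_power[of e 3] by linarith
qed

lemma bump_coeff_abs_le: "\<bar>bump_coeff e k\<bar> \<le> bump_coeff e 0"
proof -
  have "norm (bump_coeff e k) \<le> integral {-(1/2)..1/2} (bump e)"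
    unfolding bump_coeff_def
  proof (rule integral_norm_bound_integral)
    show "norm (bump e z * cos (2 * pi * of_int k * z)) \<le> bump e z" for z
      using bump_nonneg[of e z] by (simp add: abs_mult mult_left_le)
  qed (auto intro!: integrable_continuous_real continuous_intros)
  then show ?thesis by (simp add: bump_coeff_def)
qed

text \<open>Two integrations by parts over [-e, e]. The bump vanishes at the ends but its derivative
  does not, which leaves a boundary term of size e / k^2; the remaining integral is of the same size
  because the interval has length 2e. Division by the total mass, of order e^3, gives the scale
  invariant 1 / (e k)^2.\<close>

lemma bump_coeff_decay:
  assumes e: "0 < e" "e \<le> 1/4" and k: "k \<noteq> 0"
  shows "\<bar>bump_coeff e k\<bar> \<le> 4 * e / (of_int k)\<^sup>2"
proof -
  define w where "w = 2 * pi * real_of_int k"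
  have w: "w \<noteq> 0" using k by (simp add: w_def)
  let ?f = "\<lambda>z. cos (2 * pi * z) - cos (2 * pi * e)"
  \<comment> \<open>Again the boundary terms of the two integrations by parts, now not vanishing at
    the ends.\<close>
  define H where "H z = ?f z * sin (w * z) / w - 2 * pi * sin (2 * pi * z) * cos (w * z) / w\<^sup>2" for z
  let ?Y = "integral {-e..e} (\<lambda>z. cos (2 * pi * z) * cos (w * z))"
  have "((\<lambda>z. ?f z * cos (w * z) - (2 * pi)\<^sup>2 / w\<^sup>2 * (cos (2 * pi * z) * cos (w * z))) has_integral H e - H (-e)) {-e..e}"
  proof (rule fundamental_theorem_of_calculus)
    fix z
    have "(H has_real_derivative ?f z * cos (w * z) - (2 * pi)\<^sup>2 / w\<^sup>2 * (cos (2 * pi * z) * cos (w * z))) (at z within {-e..e})"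
      unfolding H_def using w by (auto intro!: derivative_eq_intros simp: field_simps power2_eq_square)
    then show "(H has_vector_derivative ?f z * cos (w * z) - (2 * pi)\<^sup>2 / w\<^sup>2 * (cos (2 * pi * z) * cos (w * z))) (at z within {-e..e})"
      by (simp add: has_real_derivative_iff_has_vector_derivative)
  qed (use e in simp)
  moreover have "H e - H (-e) = - (4 * pi * sin (2 * pi * e) * cos (w * e) / w\<^sup>2)" by (simp add: H_def)
  moreover have i: "(\<lambda>z. ?f z * cos (w * z)) integrable_on {-e..e}" "(\<lambda>z. cos (2 * pi * z) * cos (w * z)) integrable_on {-e..e}"
    by (intro integrable_continuous_real continuous_intros)+
  ultimately have "integral {-e..e} (\<lambda>z. ?f z * cos (w * z)) - (2 * pi)\<^sup>2 / w\<^sup>2 * ?Y = - (4 * pi * sin (2 * pi * e) * cos (w * e) / w\<^sup>2)"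
    using integral_diff[OF i(1) integrable_on_mult_right[OF i(2), of "(2 * pi)\<^sup>2 / w\<^sup>2"]]
    by (simp only: integral_mult_right integral_unique)
  then have eq: "bump_coeff e k = ((2 * pi)\<^sup>2 * ?Y - 4 * pi * sin (2 * pi * e) * cos (w * e)) / w\<^sup>2"
    using bump_coeff_restrict[OF e, of k] by (simp add: w_def diff_divide_distrib mult_ac)
  have "\<bar>?Y\<bar> \<le> 1 * (e - - e)"
    using e by (intro abs_integral_le abs_cos_mult_le continuous_intros) auto
  then have Y: "\<bar>?Y\<bar> \<le> 2 * e" by simp
  have "\<bar>sin (2 * pi * e) * cos (w * e)\<bar> \<le> (2 * pi * e) * 1"
    unfolding abs_mult using e abs_sin_x_le_abs_x[of "2 * pi * e"] by (intro mult_mono) auto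
  then have "4 * pi * \<bar>sin (2 * pi * e) * cos (w * e)\<bar> \<le> 4 * pi * (2 * pi * e)" by (intro mult_left_mono) auto
  moreover have "(2 * pi)\<^sup>2 * \<bar>?Y\<bar> \<le> (2 * pi)\<^sup>2 * (2 * e)" using Y by (intro mult_left_mono) auto
  moreover have "\<bar>(2 * pi)\<^sup>2 * ?Y - 4 * pi * sin (2 * pi * e) * cos (w * e)\<bar>
      \<le> (2 * pi)\<^sup>2 * \<bar>?Y\<bar> + 4 * pi * \<bar>sin (2 * pi * e) * cos (w * e)\<bar>"
    by (rule order_trans[OF abs_triangle_ineq4]) (simp add: abs_mult mult.assoc)
  moreover have "(2 * pi)\<^sup>2 * (2 * e) + 4 * pi * (2 * pi * e) = (2 * pi)\<^sup>2 * (4 * e)"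
    by (simp add: power2_eq_square)
  ultimately have "\<bar>(2 * pi)\<^sup>2 * ?Y - 4 * pi * sin (2 * pi * e) * cos (w * e)\<bar> \<le> (2 * pi)\<^sup>2 * (4 * e)"
    by argo
  then have "\<bar>bump_coeff e k\<bar> \<le> (2 * pi)\<^sup>2 * (4 * e) / w\<^sup>2"
    unfolding eq abs_divide by (simp add: divide_right_mono)
  also have "\<dots> = 4 * e / (of_int k)\<^sup>2" by (simp add: w_def power_mult_distrib)
  finally show ?thesis .
qed

section \<open>Slices of the domain\<close>

lemma open_bounded_convex_real_interval:
  fixes S :: "real set"
  assumes "open S" "bounded S" "convex S" "S \<noteq> {}"
  obtains a b where "a < b" "S = {a<..<b}"
proof -
  have bdd: "bdd_above S" "bdd_below S" using assms bounded_imp_bdd_above bounded_imp_bdd_below by auto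
  have S: "S = {Inf S<..<Sup S}"
  proof (intro equalityI subsetI)
    fix x assume x: "x \<in> S"
    then obtain e where e: "e > 0" "ball x e \<subseteq> S" using assms open_contains_ball by metis
    have "x - e/2 \<in> ball x e" "x + e/2 \<in> ball x e" using e by (auto simp: dist_real_def)
    with e have "x - e/2 \<in> S" "x + e/2 \<in> S" by auto
    then have "Inf S \<le> x - e/2" "x + e/2 \<le> Sup S" using bdd by (auto intro: cInf_lower cSup_upper)
    then show "x \<in> {Inf S<..<Sup S}" using e by auto
  next
    fix x assume "x \<in> {Inf S<..<Sup S}"
    then obtain y z where yz: "y \<in> S" "y < x" "z \<in> S" "x < z"
      using cInf_lessD[of S x] less_cSupD[of S x] assms by auto
    then show "x \<in> S"
      using assms(3) unfolding is_interval_convex_1[symmetric] by (meson is_interval_1 less_imp_le)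
  qed
  moreover have "Inf S < Sup S" using S assms(4) by (metis greaterThanLessThan_empty_iff not_le)
  ultimately show thesis using that by blast
qed

lemma integrable_bounded_support:
  fixes f :: "'a::euclidean_space \<Rightarrow> real"
  assumes "f \<in> borel_measurable borel" "bounded S" "\<And>x. x \<notin> S \<Longrightarrow> f x = 0" "\<And>x. \<bar>f x\<bar> \<le> B"
  shows "integrable lborel f"
proof -
  obtain a where a: "S \<subseteq> cbox (-a) a" using bounded_subset_cbox_symmetric[OF assms(2)] by blast
  show ?thesis
  proof (rule Bochner_Integration.integrable_bound)
    show "integrable lborel (\<lambda>x. B * indicat_real (cbox (-a) a) x)"
      by (intro integrable_mult_right integrable_real_indicator emeasure_bounded_finite) auto
    show "AE x in lborel. norm (f x) \<le> norm (B * indicat_real (cbox (-a) a) x)"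
    proof (rule AE_I2)
      fix x
      show "norm (f x) \<le> norm (B * indicat_real (cbox (-a) a) x)"
        using assms(3)[of x] assms(4)[of x] a by (cases "x \<in> S") auto
    qed
  qed (use assms in simp)
qed

text \<open>For fixed y substitute s = a x + b y in the inner integral, with Jacobian 1 / |a|, then
  exchange the order of integration. Boundedness of \<open>S\<close> is what makes both integrands
  integrable.\<close>

lemma shear_integral:
  fixes S :: "(real \<times> real) set" and f :: "real \<Rightarrow> real"
  assumes S: "S \<in> sets borel" "bounded S" and f: "f \<in> borel_measurable borel" "\<And>s. \<bar>f s\<bar> \<le> B"
    and a: "a \<noteq> 0"
  shows "(LINT x|lborel. indicator S x * f (a * fst x + b * snd x))
    = (LINT s|lborel. (1 / \<bar>a\<bar> * (LINT y|lborel. indicator S ((s - b * y) / a, y))) * f s)"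
proof -
  note [measurable] = S(1) f(1)
  obtain D where D: "\<And>x. x \<in> S \<Longrightarrow> norm x \<le> D" using S(2) bounded_iff by metis
  have int1: "integrable lborel (\<lambda>x. indicator S x * f (a * fst x + b * snd x))"
  proof (rule integrable_bounded_support[where S = S and B = B])
    have [measurable]: "(\<lambda>x::real \<times> real. a * fst x + b * snd x) \<in> borel_measurable borel"
      by (intro borel_measurable_continuous_onI continuous_intros)
    show "(\<lambda>x. indicator S x * f (a * fst x + b * snd x)) \<in> borel_measurable borel" by measurable
  qed (use S f in \<open>auto simp: indicator_def intro: order_trans[OF abs_ge_zero f(2)]\<close>)
  have int1': "integrable (lborel \<Otimes>\<^sub>M lborel) (\<lambda>(x, y). indicator S (x, y) * f (a * x + b * y))"
    using int1 unfolding lborel_prod by (simp add: case_prod_unfold)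
  have int2: "integrable lborel (\<lambda>x. indicator S ((fst x - b * snd x) / a, snd x) * f (fst x))"
  \<comment> \<open>This rectangle contains the image of \<open>S\<close> under the shear.\<close>
  proof (rule integrable_bounded_support[where S = "{-(\<bar>a\<bar> * D + \<bar>b\<bar> * D)..\<bar>a\<bar> * D + \<bar>b\<bar> * D} \<times> {-D..D}" and B = B])
    fix x :: "real \<times> real"
    assume x: "x \<notin> {-(\<bar>a\<bar> * D + \<bar>b\<bar> * D)..\<bar>a\<bar> * D + \<bar>b\<bar> * D} \<times> {-D..D}"
    have "((fst x - b * snd x) / a, snd x) \<notin> S"
    proof
      assume *: "((fst x - b * snd x) / a, snd x) \<in> S"
      have 1: "\<bar>(fst x - b * snd x) / a\<bar> \<le> D" and 2: "\<bar>snd x\<bar> \<le> D"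
        using D[OF *] norm_fst_le[of "(fst x - b * snd x) / a" "snd x"] norm_snd_le[of "snd x" "(fst x - b * snd x) / a"] by auto
      have "fst x = a * ((fst x - b * snd x) / a) + b * snd x" using a by simp
      then have "\<bar>fst x\<bar> \<le> \<bar>a\<bar> * \<bar>(fst x - b * snd x) / a\<bar> + \<bar>b\<bar> * \<bar>snd x\<bar>"
        by (metis abs_mult abs_triangle_ineq)
      also have "\<dots> \<le> \<bar>a\<bar> * D + \<bar>b\<bar> * D" using 1 2 by (intro add_mono mult_left_mono) auto
      finally show False using x 2 by (cases x) auto
    qed
    then show "indicator S ((fst x - b * snd x) / a, snd x) * f (fst x) = 0" by simp
  next
    have [measurable]: "(\<lambda>x::real \<times> real. ((fst x - b * snd x) / a, snd x)) \<in> borel_measurable borel"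
      "(fst :: real \<times> real \<Rightarrow> real) \<in> borel_measurable borel"
      using a by (intro borel_measurable_continuous_onI continuous_intros; simp)+
    show "(\<lambda>x. indicator S ((fst x - b * snd x) / a, snd x) * f (fst x)) \<in> borel_measurable borel" by measurable
  qed (use f in \<open>auto simp: indicator_def bounded_Times intro: order_trans[OF abs_ge_zero f(2)]\<close>)
  have int2': "integrable (lborel \<Otimes>\<^sub>M lborel) (\<lambda>(s, y). indicator S ((s - b * y) / a, y) * f s)"
    using int2 unfolding lborel_prod by (simp add: case_prod_unfold)
  have "(LINT x|lborel. indicator S x * f (a * fst x + b * snd x))
     = (LINT x|(lborel \<Otimes>\<^sub>M lborel). (case x of (x, y) \<Rightarrow> indicator S (x, y) * f (a * x + b * y)))"
    unfolding lborel_prod by (simp add: case_prod_unfold)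
  also have "\<dots> = (LINT y|lborel. LINT x|lborel. indicator S (x, y) * f (a * x + b * y))"
    by (rule lborel_pair.integral_snd[OF int1', symmetric])
  also have "\<dots> = (LINT y|lborel. 1 / \<bar>a\<bar> * (LINT s|lborel. indicator S ((s - b * y) / a, y) * f s))"
  proof (rule Bochner_Integration.integral_cong[OF refl])
    fix y
    have "- b * y / a + 1 / a * s = (s - b * y) / a" for s using a by (simp add: field_simps)
    moreover have "a * ((s - b * y) / a) + b * y = s" for s using a by simp
    ultimately show "(LINT x|lborel. indicator S (x, y) * f (a * x + b * y))
      = 1 / \<bar>a\<bar> * (LINT s|lborel. indicator S ((s - b * y) / a, y) * f s)"
      using lborel_integral_real_affine[of "1 / a" "\<lambda>x. indicator S (x, y) * f (a * x + b * y)" "- b * y / a"] a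
      by simp
  qed
  also have "\<dots> = 1 / \<bar>a\<bar> * (LINT y|lborel. LINT s|lborel. indicator S ((s - b * y) / a, y) * f s)"
    by (rule integral_mult_right_zero)
  also have "(LINT y|lborel. LINT s|lborel. indicator S ((s - b * y) / a, y) * f s)
     = (LINT s|lborel. LINT y|lborel. indicator S ((s - b * y) / a, y) * f s)"
    by (rule lborel_pair.Fubini_integral[OF int2'])
  also have "1 / \<bar>a\<bar> * \<dots> = (LINT s|lborel. 1 / \<bar>a\<bar> * (LINT y|lborel. indicator S ((s - b * y) / a, y) * f s))"
    by (rule integral_mult_right_zero[symmetric])
  finally show ?thesis by (simp add: mult.assoc)
qed

section \<open>Support function, caps and slices\<close>

locale cap_domain =
  fixes \<Omega> :: "(real \<times> real) set" and M :: real
  assumes open_dom: "open \<Omega>" and bounded_dom: "bounded \<Omega>" and convex_dom: "convex \<Omega>" and zero_dom: "0 \<in> \<Omega>"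
    and cap: "\<And>\<theta> \<delta>. norm \<theta> = 1 \<Longrightarrow> 0 < \<delta> \<Longrightarrow> cap_diam \<Omega> \<theta> \<delta> \<le> M * sqrt \<delta>"
    and M_nonneg: "0 \<le> M"
begin

abbreviation "\<rho> \<equiv> support_fn \<Omega>"

lemma inner_le_norm:
  obtains D where "0 < D" "\<And>x \<xi>. x \<in> \<Omega> \<Longrightarrow> x \<bullet> \<xi> \<le> D * norm \<xi>"
proof -
  obtain D where D: "0 < D" "\<And>x. x \<in> \<Omega> \<Longrightarrow> norm x \<le> D" using bounded_dom bounded_pos by metis
  have "x \<bullet> \<xi> \<le> D * norm \<xi>" if "x \<in> \<Omega>" for x \<xi>
    using norm_cauchy_schwarz[of x \<xi>] mult_right_mono[OF D(2)[OF that], of "norm \<xi>"] by simp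
  then show thesis by (rule that[OF D(1)])
qed

lemma bdd_above_inner: "bdd_above ((\<lambda>x. x \<bullet> \<xi>) ` \<Omega>)"
proof (rule inner_le_norm)
  fix D assume "\<And>x \<xi>. x \<in> \<Omega> \<Longrightarrow> x \<bullet> \<xi> \<le> D * norm \<xi>"
  then show ?thesis by (rule bdd_aboveI2)
qed

lemma inner_le_support: "x \<in> \<Omega> \<Longrightarrow> x \<bullet> \<xi> \<le> \<rho> \<xi>"
  unfolding support_fn_def by (rule cSUP_upper[OF _ bdd_above_inner])

lemma support_leI: "(\<And>x. x \<in> \<Omega> \<Longrightarrow> x \<bullet> \<xi> \<le> B) \<Longrightarrow> \<rho> \<xi> \<le> B"
  unfolding support_fn_def using zero_dom by (intro cSUP_least) auto

lemma inner_less_support: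
  assumes "x \<in> \<Omega>" "\<xi> \<noteq> 0"
  shows "x \<bullet> \<xi> < \<rho> \<xi>"
proof -
  obtain e where e: "e > 0" "ball x e \<subseteq> \<Omega>" using assms open_dom open_contains_ball by metis
  define y where "y = x + (e / (2 * norm \<xi>)) *\<^sub>R \<xi>"
  have "dist x y < e" using e assms by (simp add: y_def dist_norm)
  then have "y \<in> \<Omega>" using e by auto
  moreover have "x \<bullet> \<xi> < y \<bullet> \<xi>" using e assms by (simp add: y_def inner_add_left)
  ultimately show ?thesis using inner_le_support[of y \<xi>] by simp
qed

lemma support_nonneg: "0 \<le> \<rho> \<xi>"
  using inner_le_support[OF zero_dom, of \<xi>] by simp

lemma support_add: "\<rho> (\<xi> + \<eta>) \<le> \<rho> \<xi> + \<rho> \<eta>"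
  by (rule support_leI) (auto simp: inner_add_right intro!: add_mono inner_le_support)

lemma support_scale: assumes "0 < c" shows "\<rho> (c *\<^sub>R \<xi>) = c * \<rho> \<xi>"
proof (rule antisym)
  show "\<rho> (c *\<^sub>R \<xi>) \<le> c * \<rho> \<xi>"
    using assms by (intro support_leI) (auto intro: inner_le_support)
  have "\<rho> \<xi> \<le> \<rho> (c *\<^sub>R \<xi>) / c"
  proof (rule support_leI)
    fix x assume "x \<in> \<Omega>"
    from inner_le_support[OF this, of "c *\<^sub>R \<xi>"] assms show "x \<bullet> \<xi> \<le> \<rho> (c *\<^sub>R \<xi>) / c"
      by (simp add: field_simps)
  qed
  then show "c * \<rho> \<xi> \<le> \<rho> (c *\<^sub>R \<xi>)" using assms by (simp add: field_simps)
qed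

text \<open>Both points lie in the cap of direction k / |k| and depth (\<rho> k - s) / |k|. The
  power |k|^(-3/2) is made of the explicit division by |k| and the square root of the depth.\<close>

lemma chord_le_cap:
  assumes x: "x \<in> frontier \<Omega>" and y: "y \<in> frontier \<Omega>" and k: "k \<noteq> 0"
    and xk: "x \<bullet> k = s" and yk: "y \<bullet> k = s" and s: "s < \<rho> k"
  shows "norm (x - y) / norm k \<le> M / (norm k * sqrt (norm k)) * sqrt (\<rho> k - s)"
proof -
  define \<theta> where "\<theta> = (1 / norm k) *\<^sub>R k"
  define \<delta> where "\<delta> = (\<rho> k - s) / norm k"
  have nk: "norm k > 0" using k by simp
  have \<theta>: "norm \<theta> = 1" using k by (simp add: \<theta>_def)
  have \<delta>: "0 < \<delta>" using s nk by (simp add: \<delta>_def)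
  have r: "\<rho> \<theta> = \<rho> k / norm k" unfolding \<theta>_def using nk by (subst support_scale) auto
  have "x \<in> cap_set \<Omega> \<theta> \<delta>" "y \<in> cap_set \<Omega> \<theta> \<delta>"
    using x y xk yk nk unfolding cap_set_def r by (auto simp: \<theta>_def \<delta>_def field_simps)
  moreover have "bounded (cap_set \<Omega> \<theta> \<delta>)"
    using bounded_subset[OF bounded_closure[OF bounded_dom]] by (auto simp: cap_set_def frontier_def)
  ultimately have "dist x y \<le> cap_diam \<Omega> \<theta> \<delta>"
    unfolding cap_diam_def by (intro diameter_bounded_bound)
  also have "\<dots> \<le> M * sqrt \<delta>" by (rule cap[OF \<theta> \<delta>])
  finally have "norm (x - y) / norm k \<le> M * sqrt \<delta> / norm k"
    using nk by (simp add: dist_norm divide_right_mono)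
  then show ?thesis by (simp add: \<delta>_def real_sqrt_divide field_simps)
qed

text \<open>The line x \<bullet> k = s is parametrised by s p + y q, so norm q converts Lebesgue
  measure in y to length, and 1 / norm k accounts for s being x \<bullet> k instead of arc length.
  Slices are open intervals whose ends lie on the frontier, which makes them chords of caps;
  concavity is Brunn-Minkowski in its elementary one-dimensional form. Leaving p and q free allows
  both coordinates to serve as parameter.\<close>

lemma slice_profile_lines:
  fixes k p q :: "real \<times> real"
  assumes k: "k \<noteq> 0" and p: "p \<bullet> k = 1" and q: "q \<bullet> k = 0" "q \<noteq> 0"
    and span: "\<And>x. \<exists>y. x = (x \<bullet> k) *\<^sub>R p + y *\<^sub>R q"
  shows "slice_profile (\<lambda>s. norm q / norm k * (LINT y|lborel. indicator \<Omega> (s *\<^sub>R p + y *\<^sub>R q)))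
    (- \<rho> (- k)) (\<rho> k) (M / (norm k * sqrt (norm k)))"
proof -
  let ?l = "\<lambda>s y. s *\<^sub>R p + y *\<^sub>R q"
  define Y where "Y s = {y. ?l s y \<in> \<Omega>}" for s
  define L where "L s = (LINT y|lborel. indicat_real \<Omega> (?l s y))" for s
  define c where "c = norm q / norm k"
  have c: "0 < c" using k q by (simp add: c_def)
  have \<Omega>m [measurable]: "\<Omega> \<in> sets borel" using open_dom by simp
  have Lm: "L \<in> borel_measurable borel"
    unfolding L_def by measurable
  have L_eq: "L s = measure lborel (Y s)" for s
  proof -
    have "L s = (LINT y|lborel. indicat_real (Y s) y)"
      unfolding L_def by (intro Bochner_Integration.integral_cong) (auto simp: Y_def indicator_def)
    then show ?thesis by simp
  qed
  have cont: "continuous_on A (\<lambda>y. ?l s y)" for A s by (intro continuous_intros)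
  have Yo: "open (Y s)" for s
    using open_vimage[OF open_dom cont] by (simp add: Y_def vimage_def)
  have Yc: "convex (Y s)" for s
  proof (rule convexI)
    fix x y u v :: real
    assume xy: "x \<in> Y s" "y \<in> Y s" and uv: "0 \<le> u" "0 \<le> v" "u + v = 1"
    have "u *\<^sub>R (?l s x) + v *\<^sub>R (?l s y) \<in> \<Omega>"
      using xy by (intro convexD[OF convex_dom _ _ uv]) (auto simp: Y_def)
    also have "u *\<^sub>R (?l s x) + v *\<^sub>R (?l s y) = (u + v) *\<^sub>R s *\<^sub>R p + (u * x + v * y) *\<^sub>R q"
      by (simp add: algebra_simps)
    finally show "u *\<^sub>R x + v *\<^sub>R y \<in> Y s" using uv by (simp add: Y_def)
  qed
  obtain D where D: "\<And>x. x \<in> \<Omega> \<Longrightarrow> norm x \<le> D" using bounded_dom bounded_iff by metis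
  have Yb: "bounded (Y s)" for s
  proof (rule boundedI)
    fix y assume "y \<in> Y s"
    then have "norm (?l s y) \<le> D" by (simp add: Y_def D)
    then have "norm (y *\<^sub>R q) \<le> D + norm (s *\<^sub>R p)"
      using norm_triangle_ineq4[of "?l s y" "s *\<^sub>R p"] by simp
    then show "norm y \<le> (D + norm (s *\<^sub>R p)) / norm q" using q by (simp add: field_simps)
  qed
  have Yk: "(?l s y) \<bullet> k = s" for s y using p q by (simp add: inner_add_left)
  have ivl: "\<exists>a b. a < b \<and> Y s = {a<..<b}" if "Y s \<noteq> {}" for s
    using open_bounded_convex_real_interval[OF Yo Yb Yc that] by metis
  have front: "?l s a \<in> frontier \<Omega> \<and> ?l s b \<in> frontier \<Omega>"
    if "a < b" "Y s = {a<..<b}" for a b s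
  proof -
    have "(\<lambda>y. ?l s y) ` closure (Y s) \<subseteq> closure \<Omega>"
      using closure_subset[of \<Omega>] by (intro image_closure_subset cont) (auto simp: Y_def)
    moreover have "a \<in> closure (Y s)" "b \<in> closure (Y s)" using that by auto
    ultimately have "?l s a \<in> closure \<Omega>" "?l s b \<in> closure \<Omega>"
      by blast+
    moreover have "a \<notin> Y s" "b \<notin> Y s" using that by auto
    ultimately show ?thesis using open_dom by (auto simp: frontier_def interior_open Y_def)
  qed
  have nonempty: "Y s \<noteq> {}" if s: "- \<rho> (- k) < s" "s < \<rho> k" for s
  proof -
    obtain x1 where x1: "x1 \<in> \<Omega>" "s < x1 \<bullet> k" using support_leI[of k s] s by (meson not_le)
    obtain x2 where x2: "x2 \<in> \<Omega>" "x2 \<bullet> k < s" using support_leI[of "-k" "-s"] s by (force simp: not_le)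
    define u where "u = (s - x2 \<bullet> k) / (x1 \<bullet> k - x2 \<bullet> k)"
    have u: "0 \<le> u" "u \<le> 1" using x1 x2 by (auto simp: u_def field_simps)
    have us: "u * (x1 \<bullet> k - x2 \<bullet> k) = s - x2 \<bullet> k" using x1 x2 by (simp add: u_def)
    define x where "x = (1 - u) *\<^sub>R x2 + u *\<^sub>R x1"
    have "x \<in> \<Omega>" unfolding x_def using u x1 x2 by (intro convexD[OF convex_dom]) auto
    moreover have "x \<bullet> k = s" using us by (simp add: x_def inner_add_left algebra_simps)
    moreover obtain y where "x = (x \<bullet> k) *\<^sub>R p + y *\<^sub>R q" using span by blast
    ultimately have "y \<in> Y s" by (simp add: Y_def)
    then show ?thesis by blast
  qed
  have empty: "Y s = {}" if "s \<le> - \<rho> (- k) \<or> \<rho> k \<le> s" for s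
  proof (rule ccontr)
    assume "Y s \<noteq> {}"
    then obtain y where y: "?l s y \<in> \<Omega>" by (auto simp: Y_def)
    show False
      using inner_less_support[OF y k] inner_less_support[OF y, of "-k"] k Yk[of s y] that by simp
  qed
  show ?thesis
    unfolding L_def[symmetric] c_def[symmetric]
  proof
    show "(\<lambda>s. c * L s) \<in> borel_measurable borel" using Lm by measurable
    show "0 \<le> c * L s" for s using c by (simp add: L_eq)
    show "c * L s = 0" if "s \<le> - \<rho> (- k) \<or> \<rho> k \<le> s" for s
      using empty[OF that] by (simp add: L_eq)
    show "0 \<le> M / (norm k * sqrt (norm k))" using M_nonneg by simp
  next
    fix s assume s: "- \<rho> (- k) < s" "s < \<rho> k"
    obtain a b where ab: "a < b" "Y s = {a<..<b}" using ivl[OF nonempty[OF s]] by auto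
    have d: "norm ((?l s b) - (?l s a)) = norm q * (b - a)"
    proof -
      have "(?l s b) - (?l s a) = (b - a) *\<^sub>R q" by (simp add: algebra_simps)
      then show ?thesis using ab by simp
    qed
    have cL: "c * L s = norm q * (b - a) / norm k" using ab by (simp add: c_def L_eq)
    show "c * L s \<le> M / (norm k * sqrt (norm k)) * sqrt (\<rho> k - s)"
      using chord_le_cap[of "?l s b" "?l s a" k s] front[OF ab] Yk k s
      unfolding d cL by simp
    \<comment> \<open>The lower end of the profile is the upper end for direction -k.\<close>
    show "c * L s \<le> M / (norm k * sqrt (norm k)) * sqrt (s - - \<rho> (- k))"
      using chord_le_cap[of "?l s b" "?l s a" "-k" "-s"] front[OF ab] Yk k s
      unfolding d cL by (simp add: add.commute[of s "\<rho> (- k)"])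
  next
    show "concave_on {- \<rho> (- k)<..<\<rho> k} (\<lambda>s. c * L s)"
      unfolding concave_on_iff
    proof (intro conjI ballI allI impI)
      fix s1 s2 u v :: real
      assume s1: "s1 \<in> {- \<rho> (- k)<..<\<rho> k}" and s2: "s2 \<in> {- \<rho> (- k)<..<\<rho> k}" and uv: "0 \<le> u" "0 \<le> v" "u + v = 1"
      define s where "s = u * s1 + v * s2"
      have s: "s \<in> {- \<rho> (- k)<..<\<rho> k}"
        using convexD[OF convex_real_interval(8) s1 s2 uv] by (simp add: s_def)
      obtain a1 b1 where 1: "a1 < b1" "Y s1 = {a1<..<b1}" using ivl[OF nonempty, of s1] s1 by auto
      obtain a2 b2 where 2: "a2 < b2" "Y s2 = {a2<..<b2}" using ivl[OF nonempty, of s2] s2 by auto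
      obtain a b where ab: "a < b" "Y s = {a<..<b}" using ivl[OF nonempty, of s] s by auto
      have comb: "u * y1 + v * y2 \<in> Y s" if "y1 \<in> Y s1" "y2 \<in> Y s2" for y1 y2
      proof -
        have "u *\<^sub>R (?l s1 y1) + v *\<^sub>R (?l s2 y2) \<in> \<Omega>"
          using that by (intro convexD[OF convex_dom _ _ uv]) (auto simp: Y_def)
        also have "u *\<^sub>R (?l s1 y1) + v *\<^sub>R (?l s2 y2) = s *\<^sub>R p + (u * y1 + v * y2) *\<^sub>R q"
          by (simp add: s_def algebra_simps)
        finally show ?thesis by (simp add: Y_def)
      qed
      \<comment> \<open>The end points do not belong to the open slices, so the combination is
        formed at distance t inside them, and t tends to 0 afterwards.\<close>
      define \<tau> where "\<tau> = min (b1 - a1) (b2 - a2)"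
      have \<tau>: "0 < \<tau>" "\<tau> \<le> b1 - a1" "\<tau> \<le> b2 - a2" using 1 2 by (auto simp: \<tau>_def)
      have up: "u * b1 + v * b2 - t \<le> b" and lo: "a \<le> u * a1 + v * a2 + t" if t: "0 < t" "t < \<tau>" for t
      proof -
        have e: "u * t + v * t = t" using uv(3) by (metis distrib_right mult_1)
        have "u * (b1 - t) + v * (b2 - t) \<in> Y s" using t \<tau> 1 2 by (intro comb) auto
        then show "u * b1 + v * b2 - t \<le> b" using e ab by (simp add: algebra_simps)
        have "u * (a1 + t) + v * (a2 + t) \<in> Y s" using t \<tau> 1 2 by (intro comb) auto
        then show "a \<le> u * a1 + v * a2 + t" using e ab by (simp add: algebra_simps)
      qed
      have "u * (b1 - a1) + v * (b2 - a2) \<le> b - a"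
      proof (rule field_le_epsilon)
        fix e :: real assume "e > 0"
        define t where "t = min (e / 2) (\<tau> / 2)"
        have "0 < t" "t < \<tau>" "t \<le> e / 2" using \<tau> \<open>e > 0\<close> by (auto simp: t_def)
        with up[of t] lo[of t] show "u * (b1 - a1) + v * (b2 - a2) \<le> b - a + e"
          by (simp add: algebra_simps)
      qed
      then have "c * (u * (b1 - a1) + v * (b2 - a2)) \<le> c * (b - a)" using c by (intro mult_left_mono) auto
      moreover have "L s1 = b1 - a1" "L s2 = b2 - a2" "L s = b - a" using 1 2 ab by (auto simp: L_eq)
      ultimately have "c * (u * L s1 + v * L s2) \<le> c * L s" by simp
      then show "c * L (u *\<^sub>R s1 + v *\<^sub>R s2) \<ge> u * (c * L s1) + v * (c * L s2)"
        by (simp add: s_def distrib_left mult.left_commute)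
    qed simp
  qed
qed

text \<open>The shear divides by the first coordinate of k. When that is 0 the coordinates are
  swapped and the shear degenerates to a rescaling.\<close>

lemma cos_integral_eq_profile:
  assumes k: "k \<noteq> 0"
  obtains A where "slice_profile A (- \<rho> (- k)) (\<rho> k) (M / (norm k * sqrt (norm k)))"
    "\<And>t. (LINT x|lborel. indicator \<Omega> x * cos (2 * pi * t * (x \<bullet> k))) = cos_transform A t"
proof (cases "fst k = 0")
  case False
  define p q where "p = (1 / fst k, 0 :: real)" and "q = (- snd k / fst k, 1 :: real)"
  have nq: "norm q / norm k = 1 / \<bar>fst k\<bar>"
  proof -
    have "k = fst k *\<^sub>R (1, snd k / fst k)" using False by (simp add: prod_eq_iff)
    then have "norm k = \<bar>fst k\<bar> * norm (1 :: real, snd k / fst k)" by (metis norm_scaleR real_norm_def)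
    also have "norm (1 :: real, snd k / fst k) = norm q" by (simp add: q_def norm_Pair add.commute)
    moreover have "q \<noteq> 0" by (simp add: q_def zero_prod_def)
    ultimately show ?thesis using k False by simp
  qed
  define A where "A s = norm q / norm k * (LINT y|lborel. indicator \<Omega> (s *\<^sub>R p + y *\<^sub>R q))" for s
  show thesis
  proof (rule that)
    show "slice_profile A (- \<rho> (- k)) (\<rho> k) (M / (norm k * sqrt (norm k)))"
      unfolding A_def
    proof (rule slice_profile_lines[OF k])
      show "p \<bullet> k = 1" "q \<bullet> k = 0" "q \<noteq> 0" using False by (auto simp: p_def q_def inner_prod_def zero_prod_def)
      show "\<exists>y. x = (x \<bullet> k) *\<^sub>R p + y *\<^sub>R q" for x
        using False by (intro exI[of _ "snd x"]) (simp add: p_def q_def prod_eq_iff inner_prod_def field_simps)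
    qed
    fix t
    have "(s - snd k * y) / fst k = s / fst k - snd k * y / fst k" for s y by (simp add: diff_divide_distrib)
    then show "(LINT x|lborel. indicator \<Omega> x * cos (2 * pi * t * (x \<bullet> k))) = cos_transform A t"
      unfolding cos_transform_def A_def nq
      using shear_integral[of \<Omega> "\<lambda>s. cos (2 * pi * t * s)" 1 "fst k" "snd k"] False open_dom bounded_dom
      by (simp add: p_def q_def inner_prod_def mult.commute)
  qed
next
  case True
  then have k2: "snd k \<noteq> 0" using k by (simp add: prod_eq_iff)
  define p q where "p = (0 :: real, 1 / snd k)" and "q = (1 :: real, 0 :: real)"
  have nq: "norm q / norm k = 1 / \<bar>snd k\<bar>"
  proof -
    have "norm k = \<bar>snd k\<bar>" using True by (cases k) (simp add: norm_Pair)
    then show ?thesis by (simp add: q_def norm_Pair)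
  qed
  define A where "A s = norm q / norm k * (LINT y|lborel. indicator \<Omega> (s *\<^sub>R p + y *\<^sub>R q))" for s
  show thesis
  proof (rule that)
    show "slice_profile A (- \<rho> (- k)) (\<rho> k) (M / (norm k * sqrt (norm k)))"
      unfolding A_def
    proof (rule slice_profile_lines[OF k])
      show "p \<bullet> k = 1" "q \<bullet> k = 0" "q \<noteq> 0" using True k2 by (auto simp: p_def q_def inner_prod_def zero_prod_def)
      show "\<exists>y. x = (x \<bullet> k) *\<^sub>R p + y *\<^sub>R q" for x
        using True k2 by (intro exI[of _ "fst x"]) (simp add: p_def q_def prod_eq_iff inner_prod_def field_simps)
    qed
    fix t
    let ?S = "prod.swap -` \<Omega>"
    have S: "open ?S" "bounded ?S"
    proof -
      show "open ?S" using open_dom by (intro open_vimage) (auto simp: prod.swap_def intro!: continuous_intros)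
      obtain D where D: "\<And>x. x \<in> \<Omega> \<Longrightarrow> norm x \<le> D" using bounded_dom bounded_iff by metis
      show "bounded ?S"
      proof (rule boundedI)
        fix x assume "x \<in> ?S"
        then have "norm (prod.swap x) \<le> D" by (intro D) simp
        then show "norm x \<le> D" by (cases x) (simp add: norm_Pair add.commute)
      qed
    qed
    have [measurable]: "\<Omega> \<in> sets borel" using open_dom by simp
    have int: "integrable (lborel \<Otimes>\<^sub>M lborel) (\<lambda>(x, y). indicat_real \<Omega> (x, y) * cos (2 * pi * t * (snd k * y)))"
    proof -
      have "integrable lborel (\<lambda>x. indicat_real \<Omega> x * cos (2 * pi * t * (snd k * snd x)))"
      proof (rule integrable_bounded_support[where S = \<Omega> and B = 1])
        have [measurable]: "(\<lambda>x::real \<times> real. cos (2 * pi * t * (snd k * snd x))) \<in> borel_measurable borel"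
          by (intro borel_measurable_continuous_onI continuous_intros)
        show "(\<lambda>x. indicat_real \<Omega> x * cos (2 * pi * t * (snd k * snd x))) \<in> borel_measurable borel" by measurable
      qed (use bounded_dom in \<open>auto simp: indicator_def\<close>)
      then show ?thesis unfolding lborel_prod by (simp add: case_prod_unfold)
    qed
    have "(LINT x|lborel. indicator \<Omega> x * cos (2 * pi * t * (x \<bullet> k)))
        = (LINT x|(lborel \<Otimes>\<^sub>M lborel). (case x of (x, y) \<Rightarrow> indicat_real \<Omega> (x, y) * cos (2 * pi * t * (snd k * y))))"
      unfolding lborel_prod using True by (simp add: case_prod_unfold inner_prod_def mult.commute)
    also have "\<dots> = (LINT x|(lborel \<Otimes>\<^sub>M lborel). (case x of (x, y) \<Rightarrow> indicat_real \<Omega> (y, x) * cos (2 * pi * t * (snd k * x))))"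
      using lborel_pair.integral_product_swap[of "\<lambda>(x, y). indicat_real \<Omega> (x, y) * cos (2 * pi * t * (snd k * y))"] int
      by (simp add: case_prod_unfold borel_measurable_integrable)
    also have "\<dots> = (LINT x|lborel. indicator ?S x * cos (2 * pi * t * (snd k * fst x + 0 * snd x)))"
      unfolding lborel_prod by (intro Bochner_Integration.integral_cong) (auto simp: indicator_def)
    also have "\<dots> = (LINT s|lborel. (1 / \<bar>snd k\<bar> * (LINT y|lborel. indicator ?S ((s - 0 * y) / snd k, y))) * cos (2 * pi * t * s))"
      using S k2 by (intro shear_integral[where B = 1]) auto
    also have "\<dots> = cos_transform A t"
      unfolding cos_transform_def A_def nq by (simp add: p_def q_def indicator_def)
    finally show "(LINT x|lborel. indicator \<Omega> x * cos (2 * pi * t * (x \<bullet> k))) = cos_transform A t" .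
  qed
qed

end

section \<open>Mollified lattice point counts\<close>

text \<open>All that the mean square estimate knows about the mollifier at scale e; in particular it
  is uniform in the degree of the trigonometric polynomial.\<close>

definition bump_decay :: "real \<Rightarrow> (int \<Rightarrow> real) \<Rightarrow> bool" where
  "bump_decay e c \<longleftrightarrow> (\<forall>k. \<bar>c k\<bar> \<le> 1) \<and> (\<forall>k. k \<noteq> 0 \<longrightarrow> \<bar>c k\<bar> \<le> 1 / (e * of_int k)\<^sup>2)"

lemma trig_polynomial_approx_bump:
  assumes e: "0 < e" "e \<le> 1/4" and \<eta>: "0 < \<eta>"
  obtains N :: nat and c :: "int \<Rightarrow> real" where
    "\<And>k. c (- k) = c k" "c 0 = 1" "bump_decay e c"
    "\<And>x. \<bar>(\<Sum>k\<in>{-int N..int N}. c k * cos (2 * pi * of_int k * x)) - bump e x / bump_coeff e 0\<bar> \<le> \<eta>"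
proof -
  define Z where "Z = bump_coeff e 0"
  have Z: "10 * e ^ 3 \<le> Z" unfolding Z_def by (rule bump_coeff_0_ge[OF e])
  have Z0: "0 < Z" using Z e zero_less_power[of e 3] by linarith
  \<comment> \<open>With N >= 1 / d^2 both error terms of the Fejer mean are at most d, and 4 d / Z
    = \<eta>.\<close>
  define d where "d = \<eta> * Z / 4"
  have d: "0 < d" using \<eta> Z0 by (simp add: d_def)
  obtain N0 :: nat where N0: "1 / d\<^sup>2 < real N0" using reals_Archimedean2 by blast
  define N where "N = Suc N0"
  have N: "N > 0" "1 / d\<^sup>2 \<le> real N" using N0 by (auto simp: N_def)
  have dN: "1 / (d * real N) \<le> d"
    using N d by (simp add: field_simps power2_eq_square)
  define c where "c k = fejer_weight N k * bump_coeff e k / Z" for k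
  show thesis
  proof (rule that[of c N])
    show "c (- k) = c k" for k by (simp add: c_def fejer_weight_minus bump_coeff_minus)
    show "c 0 = 1" using Z0 N by (simp add: c_def fejer_weight_0 Z_def)
    have w: "\<bar>c k\<bar> \<le> \<bar>bump_coeff e k\<bar> / Z" for k
      using fejer_weight_bounds[of N k] Z0
      by (simp add: c_def abs_mult divide_right_mono mult_left_le_one_le)
    have "\<bar>c k\<bar> \<le> 1" for k
    proof -
      have "\<bar>bump_coeff e k\<bar> / Z \<le> 1" using bump_coeff_abs_le[of e k] Z0 by (simp add: Z_def)
      then show ?thesis using w[of k] by linarith
    qed
    moreover have "\<bar>c k\<bar> \<le> 1 / (e * of_int k)\<^sup>2" if "k \<noteq> 0" for k
    proof -
      have "\<bar>c k\<bar> \<le> (4 * e / (of_int k)\<^sup>2) / Z"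
        using w[of k] bump_coeff_decay[OF e that] Z0 by (meson divide_right_mono less_imp_le order_trans)
      also have "\<dots> \<le> (4 * e / (of_int k)\<^sup>2) / (10 * e ^ 3)"
        using Z e by (intro divide_left_mono mult_pos_pos) (auto simp: Z0)
      also have "\<dots> = (4/10) * (1 / (e * of_int k)\<^sup>2)"
        using e that by (simp add: field_simps power2_eq_square power3_eq_cube)
      also have "\<dots> \<le> 1 * (1 / (e * of_int k)\<^sup>2)" by (intro mult_right_mono) auto
      also have "\<dots> = 1 / (e * of_int k)\<^sup>2" by simp
      finally show ?thesis .
    qed
    ultimately show "bump_decay e c" by (simp add: bump_decay_def)
    fix x
    have "(\<Sum>k\<in>{-int N..int N}. c k * cos (2 * pi * of_int k * x))
       = (\<Sum>k\<in>{-int N..int N}. fejer_weight N k * bump_coeff e k * cos (2 * pi * of_int k * x)) / Z"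
      by (simp add: c_def sum_divide_distrib)
    then have "(\<Sum>k\<in>{-int N..int N}. c k * cos (2 * pi * of_int k * x)) - bump e x / Z
      = (bump_mean e N x - bump e x) / Z"
      by (simp add: fejer_mean_bump diff_divide_distrib)
    then have "\<bar>(\<Sum>k\<in>{-int N..int N}. c k * cos (2 * pi * of_int k * x)) - bump e x / Z\<bar>
      = \<bar>bump_mean e N x - bump e x\<bar> / Z"
      using Z0 by (simp add: abs_divide)
    also have "\<dots> \<le> (2 * (d + 1 / (d * real N))) / Z"
      using fejer_mean_bump_error[OF N(1) d] Z0 by (intro divide_right_mono) auto
    also have "\<dots> \<le> (2 * (d + d)) / Z" using dN Z0 by (intro divide_right_mono mult_left_mono) auto
    also have "\<dots> = \<eta>" using Z0 by (simp add: d_def)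
    finally show "\<bar>(\<Sum>k\<in>{-int N..int N}. c k * cos (2 * pi * of_int k * x)) - bump e x / bump_coeff e 0\<bar> \<le> \<eta>"
      by (simp add: Z_def)
  qed
qed

text \<open>A mollifier already periodised over the lattice: for small e it is carried by the
  squares around the lattice points and has mass 1 on each. No sum over translates has to be
  formed.\<close>

definition bump2 :: "real \<Rightarrow> real \<times> real \<Rightarrow> real" where
  "bump2 e x = (bump e (fst x) / bump_coeff e 0) * (bump e (snd x) / bump_coeff e 0)"

lemma bump2_nonneg: "0 < e \<Longrightarrow> e \<le> 1/4 \<Longrightarrow> 0 \<le> bump2 e x"
  using bump_coeff_abs_le[of e 0] by (auto simp: bump2_def bump_nonneg intro!: mult_nonneg_nonneg divide_nonneg_nonneg)

lemma bump2_measurable [measurable]: "bump2 e \<in> borel_measurable borel"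
  unfolding bump2_def[abs_def] divide_inverse
  by (intro borel_measurable_continuous_onI continuous_intros)

definition square :: "real \<Rightarrow> real \<times> real \<Rightarrow> (real \<times> real) set" where
  "square e n = {fst n - e..fst n + e} \<times> {snd n - e..snd n + e}"

lemma square_measurable [measurable]: "square e n \<in> sets borel"
  unfolding square_def by (intro borel_closed closed_Times) auto

lemma integral_bump_int:
  assumes e: "0 < e" "e \<le> 1/4" and n: "n \<in> \<int>"
  shows "(LINT a|lborel. indicat_real {n-e..n+e} a * bump e a) = bump_coeff e 0"
    and "integrable lborel (\<lambda>a. indicat_real {n-e..n+e} a * bump e a)"
proof -
  obtain m where m: "n = of_int m" using n by (auto elim: Ints_cases)
  have si: "set_integrable lborel {n-e..n+e} (bump e)" for n
    by (intro borel_integrable_atLeastAtMost' continuous_intros)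
  then show "integrable lborel (\<lambda>a. indicat_real {n-e..n+e} a * bump e a)"
    by (simp add: set_integrable_def)
  have "(LINT a|lborel. indicat_real {n-e..n+e} a * bump e a)
     = (LINT a|lborel. indicat_real {n-e..n+e} (n + 1 * a) * bump e (n + 1 * a))"
    by (subst lborel_integral_real_affine[where c = 1 and t = n]) auto
  also have "\<dots> = (LINT a|lborel. indicat_real {-e..e} a * bump e a)"
    by (intro Bochner_Integration.integral_cong) (auto simp: indicator_def m add.commute[of "of_int m"] bump_add_int)
  also have "\<dots> = integral {-e..e} (bump e)"
    using set_borel_integral_eq_integral(2)[OF si[of 0]] by (simp add: set_lebesgue_integral_def)
  also have "\<dots> = bump_coeff e 0"
    using bump_coeff_restrict[OF e, of 0] e by (auto simp: bump_eq intro!: integral_cong)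
  finally show "(LINT a|lborel. indicat_real {n-e..n+e} a * bump e a) = bump_coeff e 0" .
qed

lemma integral_bump2_square:
  assumes e: "0 < e" "e \<le> 1/4" and n: "n \<in> lattice_Z2"
  shows "(LINT x|lborel. indicat_real (square e n) x * bump2 e x) = 1"
    and "integrable lborel (\<lambda>x. indicat_real (square e n) x * bump2 e x)"
proof -
  define Z where "Z = bump_coeff e 0"
  have Z: "Z \<noteq> 0" using bump_coeff_0_ge[OF e] e zero_less_power[of e 3] unfolding Z_def by linarith
  define f where "f m a = indicat_real {m-e..m+e} a * bump e a" for m a
  have n': "fst n \<in> \<int>" "snd n \<in> \<int>" using n by (auto simp: lattice_Z2_def)
  have f: "integrable lborel (f (fst n))" "integrable lborel (f (snd n))"
    "(LINT a|lborel. f (fst n) a) = Z" "(LINT a|lborel. f (snd n) a) = Z"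
    using integral_bump_int[OF e n'(1)] integral_bump_int[OF e n'(2)] by (simp_all add: f_def[abs_def] Z_def)
  have eq: "indicat_real (square e n) x * bump2 e x = f (fst n) (fst x) * f (snd n) (snd x) * (1 / Z\<^sup>2)" for x
    by (cases x) (auto simp: square_def indicator_def bump2_def f_def Z_def power2_eq_square)
  note prod = integral_product_lborel[OF f(1,2)]
  show "integrable lborel (\<lambda>x. indicat_real (square e n) x * bump2 e x)"
    unfolding eq using prod(2) by (rule integrable_mult_left)
  show "(LINT x|lborel. indicat_real (square e n) x * bump2 e x) = 1"
    unfolding eq using Z prod(1) f(3,4) by (subst integral_mult_left_zero) (simp add: power2_eq_square)
qed

lemma finite_bounded_lattice:
  assumes "bounded S"
  shows "finite (S \<inter> lattice_Z2)"
proof -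
  obtain D where D: "\<And>x. x \<in> S \<Longrightarrow> norm x \<le> D" using assms bounded_iff by metis
  define c where "c = \<lceil>D\<rceil>"
  have "S \<inter> lattice_Z2 \<subseteq> (\<lambda>(i, j). (of_int i, of_int j)) ` ({-c..c} \<times> {-c..c})"
  proof
    fix x assume x: "x \<in> S \<inter> lattice_Z2"
    then obtain i j where ij: "x = (of_int i, of_int j)"
      by (cases x) (auto simp: lattice_Z2_def elim!: Ints_cases)
    have "\<bar>real_of_int i\<bar> \<le> D" "\<bar>real_of_int j\<bar> \<le> D"
      using D[of x] x norm_fst_le[of "real_of_int i" "real_of_int j"] norm_snd_le[of "real_of_int j" "real_of_int i"] by (auto simp: ij)
    then have "i \<in> {-c..c}" "j \<in> {-c..c}" unfolding c_def atLeastAtMost_iff by linarith+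
    then show "x \<in> (\<lambda>(i, j). (of_int i, of_int j)) ` ({-c..c} \<times> {-c..c})" by (auto simp: ij image_iff)
  qed
  then show ?thesis by (rule finite_subset) simp
qed

lemma lattice_square_unique:
  assumes "n \<in> lattice_Z2" "m \<in> lattice_Z2" "x \<in> square e n" "x \<in> square e m" "e \<le> 1/4"
  shows "n = m"
proof -
  have *: "a = b" if "a \<in> \<int>" "b \<in> \<int>" "\<bar>a - b\<bar> \<le> 1/2" for a b :: real
  proof -
    obtain i j where "a = of_int i" "b = of_int j" using \<open>a \<in> \<int>\<close> \<open>b \<in> \<int>\<close> by (auto elim!: Ints_cases)
    moreover have "\<bar>i - j\<bar> < 1" using that(3) calculation by linarith
    ultimately show ?thesis by simp
  qed
  have "\<bar>fst n - fst m\<bar> \<le> 1/2" "\<bar>snd n - snd m\<bar> \<le> 1/2"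
    using assms(3-5) unfolding square_def mem_Times_iff atLeastAtMost_iff by linarith+
  then show ?thesis using assms(1,2) *[of "fst n" "fst m"] *[of "snd n" "snd m"]
    by (simp add: lattice_Z2_def prod_eq_iff)
qed

section \<open>Comparison of sharp and mollified counts\<close>

context cap_domain
begin

definition dil :: "real \<Rightarrow> (real \<times> real) set" where "dil t = (\<lambda>x. t *\<^sub>R x) ` \<Omega>"

lemma lattice_count_dil: "lattice_count \<Omega> t = card (dil t \<inter> lattice_Z2)"
  by (simp add: lattice_count_def dil_def)

lemma bounded_dil: "bounded (dil t)" unfolding dil_def using bounded_dom by (rule bounded_scaling)

lemma open_dil: "t \<noteq> 0 \<Longrightarrow> open (dil t)"
  unfolding dil_def by (rule open_scaling) (use open_dom in auto)

lemma dil_measurable: "0 < t \<Longrightarrow> dil t \<in> sets borel" using open_dil[of t] by simp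

text \<open>Convexity gives t \<Omega> + d \<Omega> inside (t + d) \<Omega>, and the ball of radius
  r0 d lies in d \<Omega>. This absorbs the diameter of the squares into a change of the dilation
  parameter.\<close>

lemma dil_add:
  assumes x: "x \<in> dil t" and y: "norm y \<le> r0 * d" and r0: "cball 0 r0 \<subseteq> \<Omega>" and td: "0 < t" "0 < d"
  shows "x + y \<in> dil (t + d)"
proof -
  obtain w where w: "w \<in> \<Omega>" "x = t *\<^sub>R w" using x by (auto simp: dil_def)
  define v where "v = (1 / d) *\<^sub>R y"
  have v: "v \<in> \<Omega>" using r0 y td by (auto simp: v_def field_simps)
  have "(t / (t + d)) *\<^sub>R w + (d / (t + d)) *\<^sub>R v \<in> \<Omega>"
    using td by (intro convexD[OF convex_dom w(1) v]) (auto simp: add_divide_distrib[symmetric])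
  moreover have "x + y = (t + d) *\<^sub>R ((t / (t + d)) *\<^sub>R w + (d / (t + d)) *\<^sub>R v)"
    using td w by (simp add: scaleR_add_right v_def)
  ultimately show ?thesis unfolding dil_def by blast
qed

definition smoothed_count :: "real \<Rightarrow> real \<Rightarrow> real" where
  "smoothed_count e t = (LINT x|lborel. indicat_real (dil t) x * bump2 e x)"

lemma bump2_le:
  assumes e: "0 < e" "e \<le> 1/4"
  shows "\<bar>bump2 e x\<bar> \<le> (2 / bump_coeff e 0)\<^sup>2"
proof -
  have Z: "0 \<le> bump_coeff e 0" using bump_coeff_abs_le[of e 0] by linarith
  then show ?thesis
    unfolding bump2_def abs_mult power2_eq_square
    by (intro mult_mono) (auto simp: bump_nonneg bump_le intro!: divide_right_mono)
qed

lemma integrable_smoothed: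
  assumes e: "0 < e" "e \<le> 1/4" and t: "0 < t"
  shows "integrable lborel (\<lambda>x. indicat_real (dil t) x * bump2 e x)"
proof (rule integrable_bounded_support[where S = "dil t" and B = "(2 / bump_coeff e 0)\<^sup>2"])
  note [measurable] = dil_measurable[OF t]
  show "(\<lambda>x. indicat_real (dil t) x * bump2 e x) \<in> borel_measurable borel" by measurable
qed (use bounded_dil bump2_le[OF e] in \<open>auto simp: indicator_def\<close>)

lemma norm_square_diff: "x \<in> square e n \<Longrightarrow> norm (x - n) \<le> 2 * e"
proof -
  assume "x \<in> square e n"
  then have "\<bar>fst x - fst n\<bar> \<le> e" "\<bar>snd x - snd n\<bar> \<le> e" by (cases x; auto simp: square_def)+
  moreover have "norm (x - n) \<le> norm (fst (x - n)) + norm (snd (x - n))"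
    using norm_Pair_le[of "fst (x - n)" "snd (x - n)"] unfolding prod.collapse .
  ultimately show ?thesis by simp
qed

text \<open>Each lattice point of t \<Omega> owns a square of unit mass; these squares are disjoint
  and stay inside (t + d) \<Omega>.\<close>

lemma lattice_count_le_smoothed:
  assumes e: "0 < e" "e \<le> 1/4" and td: "0 < t" "0 < d" and r0: "cball 0 r0 \<subseteq> \<Omega>" "2 * e \<le> r0 * d"
  shows "real (lattice_count \<Omega> t) \<le> smoothed_count e (t + d)"
proof -
  let ?f = "\<lambda>n x. indicat_real (square e n) x * bump2 e x"
  define L where "L = dil t \<inter> lattice_Z2"
  have fin: "finite L" unfolding L_def by (rule finite_bounded_lattice[OF bounded_dil])
  have "real (lattice_count \<Omega> t) = (\<Sum>n\<in>L. (LINT x|lborel. ?f n x))"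
    using integral_bump2_square(1)[OF e] by (simp add: lattice_count_dil L_def)
  also have "\<dots> = (LINT x|lborel. (\<Sum>n\<in>L. ?f n x))"
    using integral_bump2_square(2)[OF e] by (intro Bochner_Integration.integral_sum[symmetric]) (auto simp: L_def)
  also have "\<dots> \<le> smoothed_count e (t + d)"
    unfolding smoothed_count_def
  proof (rule integral_mono)
    show "integrable lborel (\<lambda>x. \<Sum>n\<in>L. ?f n x)"
      using integral_bump2_square(2)[OF e] by (intro Bochner_Integration.integrable_sum) (auto simp: L_def)
    show "integrable lborel (\<lambda>x. indicat_real (dil (t + d)) x * bump2 e x)"
      using td by (intro integrable_smoothed e) auto
    fix x
    have "(\<Sum>n\<in>L. indicat_real (square e n) x) \<le> indicat_real (dil (t + d)) x"
    proof (cases "\<exists>n\<in>L. x \<in> square e n")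
      case True
      then obtain n where n: "n \<in> L" "x \<in> square e n" by auto
      have "(\<Sum>m\<in>L. indicat_real (square e m) x) = (\<Sum>m\<in>L. if m = n then 1 else 0)"
      proof (rule sum.cong[OF refl])
        fix m assume "m \<in> L"
        then have "x \<in> square e m \<longleftrightarrow> m = n"
          using lattice_square_unique[of m n x e] n e(2) unfolding L_def by blast
        then show "indicat_real (square e m) x = (if m = n then 1 else 0)" using n(2) by auto
      qed
      also have "\<dots> = 1" using n fin by simp
      also have "x \<in> dil (t + d)"
        using dil_add[of n t "x - n" r0 d] n td r0 norm_square_diff[OF n(2)] by (auto simp: L_def)
      then have "1 = indicat_real (dil (t + d)) x" by simp
      finally show ?thesis by simp
    next
      case False
      then have "(\<Sum>n\<in>L. indicat_real (square e n) x) = 0" by (intro sum.neutral) auto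
      then show ?thesis by simp
    qed
    then show "(\<Sum>n\<in>L. ?f n x) \<le> indicat_real (dil (t + d)) x * bump2 e x"
      unfolding sum_distrib_right[symmetric] using bump2_nonneg[OF e] by (rule mult_right_mono)
  qed
  finally show ?thesis .
qed

text \<open>Conversely, a point of t \<Omega> where the mollifier is nonzero lies in the square of
  the nearest lattice point, and that lattice point belongs to (t + d) \<Omega>.\<close>

lemma smoothed_le_lattice_count:
  assumes e: "0 < e" "e \<le> 1/4" and td: "0 < t" "0 < d" and r0: "cball 0 r0 \<subseteq> \<Omega>" "2 * e \<le> r0 * d"
  shows "smoothed_count e t \<le> real (lattice_count \<Omega> (t + d))"
proof -
  let ?f = "\<lambda>n x. indicat_real (square e n) x * bump2 e x"
  define L where "L = dil (t + d) \<inter> lattice_Z2"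
  have fin: "finite L" unfolding L_def by (rule finite_bounded_lattice[OF bounded_dil])
  have "smoothed_count e t \<le> (LINT x|lborel. (\<Sum>n\<in>L. ?f n x))"
    unfolding smoothed_count_def
  proof (rule integral_mono)
    show "integrable lborel (\<lambda>x. \<Sum>n\<in>L. ?f n x)"
      using integral_bump2_square(2)[OF e] by (intro Bochner_Integration.integrable_sum) (auto simp: L_def)
    show "integrable lborel (\<lambda>x. indicat_real (dil t) x * bump2 e x)"
      by (intro integrable_smoothed e td)
    fix x
    show "indicat_real (dil t) x * bump2 e x \<le> (\<Sum>n\<in>L. ?f n x)"
    proof (cases "x \<in> dil t \<and> bump2 e x \<noteq> 0")
      case True
      define n where "n = (real_of_int (round (fst x)), real_of_int (round (snd x)))"
      have "\<bar>fst x - fst n\<bar> < e" "\<bar>snd x - snd n\<bar> < e"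
        using True bump_nonzero_near_int[of e "fst x"] bump_nonzero_near_int[of e "snd x"] e
        by (auto simp: bump2_def n_def)
      then have xn: "x \<in> square e n" by (cases x) (auto simp: square_def abs_le_iff abs_less_iff)
      have "x + (n - x) \<in> dil (t + d)"
        using True td r0 norm_square_diff[OF xn] by (intro dil_add[of x t]) (auto simp: norm_minus_commute)
      then have n: "n \<in> L" by (simp add: L_def lattice_Z2_def n_def)
      have "indicat_real (dil t) x * bump2 e x = ?f n x" using True xn by simp
      also have "\<dots> \<le> (\<Sum>n\<in>L. ?f n x)"
        using n fin bump2_nonneg[OF e, of x] by (intro member_le_sum) auto
      finally show ?thesis .
    next
      case False
      then have "indicat_real (dil t) x * bump2 e x = 0" by auto
      also have "0 \<le> (\<Sum>n\<in>L. ?f n x)"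
        using bump2_nonneg[OF e, of x] by (intro sum_nonneg) auto
      finally show ?thesis .
    qed
  qed
  also have "\<dots> = (\<Sum>n\<in>L. (LINT x|lborel. ?f n x))"
    using integral_bump2_square(2)[OF e] by (intro Bochner_Integration.integral_sum) (auto simp: L_def)
  also have "\<dots> = real (lattice_count \<Omega> (t + d))"
    using integral_bump2_square(1)[OF e] by (simp add: lattice_count_dil L_def)
  finally show ?thesis .
qed

end

section \<open>Fourier expansion of the mollified count\<close>

lemma lborel_integral_scale:
  fixes f :: "real \<times> real \<Rightarrow> real"
  assumes [measurable]: "f \<in> borel_measurable borel" and c: "c \<noteq> 0"
  shows "(LINT x|lborel. f x) = c\<^sup>2 * (LINT x|lborel. f (c *\<^sub>R x))"
  by (subst lborel_affine[OF c, of 0]) (simp add: integral_density integral_distr power2_eq_square)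

definition ivec :: "int \<times> int \<Rightarrow> real \<times> real" where
  "ivec k = (of_int (fst k), of_int (snd k))"

definition ibox :: "nat \<Rightarrow> (int \<times> int) set" where
  "ibox N = {-int N..int N} \<times> {-int N..int N}"

text \<open>Expanding the cosine of the sum produces an additional product of two sine sums, which
  vanish because the coefficients are even.\<close>

lemma trig_polynomial_product:
  fixes c :: "int \<Rightarrow> real"
  assumes even: "\<And>k. c (- k) = c k"
  shows "(\<Sum>k\<in>{-int N..int N}. c k * cos (2 * pi * of_int k * x)) * (\<Sum>k\<in>{-int N..int N}. c k * cos (2 * pi * of_int k * y))
    = (\<Sum>k\<in>ibox N. c (fst k) * c (snd k) * cos (2 * pi * (of_int (fst k) * x + of_int (snd k) * y)))"
proof -
  let ?S = "{-int N..int N}"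
  have odd: "(\<Sum>k\<in>?S. c k * sin (2 * pi * of_int k * z)) = 0" for z
  proof -
    have "(\<Sum>k\<in>?S. c k * sin (2 * pi * of_int k * z)) = (\<Sum>k\<in>?S. c (- k) * sin (2 * pi * of_int (- k) * z))"
      by (rule sum.reindex_bij_witness[of _ uminus uminus]) auto
    also have "\<dots> = - (\<Sum>k\<in>?S. c k * sin (2 * pi * of_int k * z))"
      by (simp add: even sum_negf)
    finally show ?thesis by simp
  qed
  have "(\<Sum>k\<in>ibox N. c (fst k) * c (snd k) * cos (2 * pi * (of_int (fst k) * x + of_int (snd k) * y)))
    = (\<Sum>i\<in>?S. \<Sum>j\<in>?S. c i * c j * cos (2 * pi * (of_int i * x + of_int j * y)))"
    unfolding ibox_def by (simp add: sum.cartesian_product case_prod_unfold)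
  also have "\<dots> = (\<Sum>i\<in>?S. \<Sum>j\<in>?S. (c i * cos (2 * pi * of_int i * x)) * (c j * cos (2 * pi * of_int j * y))
      - (c i * sin (2 * pi * of_int i * x)) * (c j * sin (2 * pi * of_int j * y)))"
    by (intro sum.cong refl) (simp add: distrib_left cos_add algebra_simps)
  also have "\<dots> = (\<Sum>k\<in>?S. c k * cos (2 * pi * of_int k * x)) * (\<Sum>k\<in>?S. c k * cos (2 * pi * of_int k * y))
      - (\<Sum>k\<in>?S. c k * sin (2 * pi * of_int k * x)) * (\<Sum>k\<in>?S. c k * sin (2 * pi * of_int k * y))"
    by (simp only: sum_subtractf sum_product)
  finally show ?thesis using odd by simp
qed

context cap_domain
begin

definition dom_cos :: "int \<times> int \<Rightarrow> real \<Rightarrow> real" where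
  "dom_cos k t = (LINT x|lborel. indicat_real \<Omega> x * cos (2 * pi * t * (x \<bullet> ivec k)))"

definition trig_error :: "nat \<Rightarrow> (int \<Rightarrow> real) \<Rightarrow> real \<Rightarrow> real" where
  "trig_error N c t = t\<^sup>2 * (\<Sum>k\<in>ibox N - {0}. c (fst k) * c (snd k) * dom_cos k t)"

lemma dom_borel [measurable]: "\<Omega> \<in> sets borel" using open_dom by simp

lemma indicator_dil: "t \<noteq> 0 \<Longrightarrow> indicat_real (dil t) (t *\<^sub>R x) = indicat_real \<Omega> x"
  by (simp add: dil_def image_iff indicator_def)

lemma integral_dil:
  assumes "0 < t" and [measurable]: "f \<in> borel_measurable borel"
  shows "(LINT x|lborel. indicat_real (dil t) x * f x) = t\<^sup>2 * (LINT x|lborel. indicat_real \<Omega> x * f (t *\<^sub>R x))"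
proof -
  note [measurable] = dil_measurable[OF assms(1)]
  show ?thesis
    using assms(1) by (subst lborel_integral_scale[where c = t]) (auto simp: indicator_dil)
qed

text \<open>The mollifier is replaced by the product of two trigonometric polynomials with uniform
  error so small that, multiplied by the area of the largest dilate, it stays below 1.\<close>

lemma smoothed_count_expansion:
  assumes e: "0 < e" "e \<le> 1/4" and T: "0 < T"
  obtains N :: nat and c :: "int \<Rightarrow> real" where
    "c 0 = 1" "bump_decay e c"
    "\<And>t. 0 < t \<Longrightarrow> t \<le> T \<Longrightarrow>
      \<bar>smoothed_count e t - t\<^sup>2 * (\<Sum>k\<in>ibox N. c (fst k) * c (snd k) * dom_cos k t)\<bar> \<le> 1"
proof -
  define B where "B = 2 / bump_coeff e 0"
  define a where "a = (LINT x|lborel. indicat_real \<Omega> x)"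
  have B: "0 \<le> B" using bump_coeff_abs_le[of e 0] by (simp add: B_def)
  have a: "0 \<le> a" by (simp add: a_def)
  \<comment> \<open>The product differs from \<open>bump2\<close> by at most \<eta> (2 B + 1), where
    \<eta> <= 1 is used to bound the polynomial by B + 1; the other factor dominates the area of t
    \<Omega> for t <= T.\<close>
  define \<eta> where "\<eta> = min 1 (1 / ((2 * B + 1) * (T\<^sup>2 * a + 1)))"
  have pos: "0 < (2 * B + 1) * (T\<^sup>2 * a + 1)" using B a by (intro mult_pos_pos add_nonneg_pos) auto
  have \<eta>: "0 < \<eta>" "\<eta> \<le> 1" using pos by (auto simp: \<eta>_def)
  have "\<eta> \<le> 1 / ((2 * B + 1) * (T\<^sup>2 * a + 1))" by (simp add: \<eta>_def)
  then have \<eta>': "\<eta> * ((2 * B + 1) * (T\<^sup>2 * a + 1)) \<le> 1" using pos by (simp add: pos_le_divide_eq)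
  obtain N :: nat and c :: "int \<Rightarrow> real" where c: "\<And>k. c (- k) = c k" "c 0 = 1" "bump_decay e c"
    and approx: "\<And>x. \<bar>(\<Sum>k\<in>{-int N..int N}. c k * cos (2 * pi * of_int k * x)) - bump e x / bump_coeff e 0\<bar> \<le> \<eta>"
    apply (rule trig_polynomial_approx_bump[OF e \<eta>(1)])
    subgoal premises p for N c by (rule p(1)[OF p(2-5)])
    done
  define P where "P x = (\<Sum>k\<in>{-int N..int N}. c k * cos (2 * pi * of_int k * x))" for x
  define Q where "Q x = P (fst x) * P (snd x)" for x :: "real \<times> real"
  have Qm [measurable]: "Q \<in> borel_measurable borel"
    unfolding Q_def P_def by (intro borel_measurable_continuous_onI continuous_intros)
  have Qb: "\<bar>bump2 e x - Q x\<bar> \<le> \<eta> * (2 * B + 1)" for x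
  proof -
    define u v where "u = bump e (fst x) / bump_coeff e 0" and "v = bump e (snd x) / bump_coeff e 0"
    have uv: "\<bar>u\<bar> \<le> B" "\<bar>v\<bar> \<le> B"
      unfolding u_def v_def B_def using bump_coeff_abs_le[of e 0] bump_nonneg bump_le
      by (auto intro!: divide_right_mono)
    have du: "\<bar>P (fst x) - u\<bar> \<le> \<eta>" "\<bar>P (snd x) - v\<bar> \<le> \<eta>" using approx by (auto simp: P_def u_def v_def)
    have "bump2 e x - Q x = - ((P (fst x) - u) * P (snd x) + u * (P (snd x) - v))"
      by (simp add: bump2_def Q_def u_def v_def algebra_simps)
    then have "\<bar>bump2 e x - Q x\<bar> \<le> \<bar>P (fst x) - u\<bar> * \<bar>P (snd x)\<bar> + \<bar>u\<bar> * \<bar>P (snd x) - v\<bar>"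
      by (metis abs_minus_cancel abs_mult abs_triangle_ineq)
    also have "\<dots> \<le> \<eta> * (B + 1) + B * \<eta>"
    proof (intro add_mono mult_mono)
      show "\<bar>P (snd x)\<bar> \<le> B + 1" using du(2) uv(2) \<eta> by linarith
    qed (use du uv \<eta> B in auto)
    finally show ?thesis by (simp add: algebra_simps)
  qed
  show thesis
  proof (rule that[of c N])
    fix t assume t: "0 < t" "t \<le> T"
    note [measurable] = dil_measurable[OF t(1)]
    have i1: "integrable lborel (\<lambda>x. indicat_real (dil t) x * bump2 e x)" by (rule integrable_smoothed[OF e t(1)])
    have i0: "integrable lborel (\<lambda>x. indicat_real (dil t) x)"
      using bounded_dil[of t] by (intro integrable_bounded_support[where S = "dil t" and B = 1]) auto
    have id: "integrable lborel (\<lambda>x. indicat_real (dil t) x * (bump2 e x - Q x))"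
    proof (rule integrable_bounded_support[where S = "dil t" and B = "\<eta> * (2 * B + 1)"])
      show "(\<lambda>x. indicat_real (dil t) x * (bump2 e x - Q x)) \<in> borel_measurable borel" by measurable
      show "\<bar>indicat_real (dil t) x * (bump2 e x - Q x)\<bar> \<le> \<eta> * (2 * B + 1)" for x
        using Qb[of x] B \<eta> by (cases "x \<in> dil t") auto
    qed (use bounded_dil in auto)
    have i2: "integrable lborel (\<lambda>x. indicat_real (dil t) x * Q x)"
      using Bochner_Integration.integrable_diff[OF i1 id] by (simp add: algebra_simps)
    have "\<bar>smoothed_count e t - (LINT x|lborel. indicat_real (dil t) x * Q x)\<bar>
      = \<bar>LINT x|lborel. indicat_real (dil t) x * (bump2 e x - Q x)\<bar>"
      unfolding smoothed_count_def using i1 i2 by (simp add: right_diff_distrib)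
    also have "\<dots> \<le> (LINT x|lborel. \<bar>indicat_real (dil t) x * (bump2 e x - Q x)\<bar>)"
      by (rule integral_abs_bound)
    also have "\<dots> \<le> (LINT x|lborel. indicat_real (dil t) x * (\<eta> * (2 * B + 1)))"
    proof (rule integral_mono)
      show "integrable lborel (\<lambda>x. \<bar>indicat_real (dil t) x * (bump2 e x - Q x)\<bar>)"
        by (rule integrable_abs[OF id])
      show "integrable lborel (\<lambda>x. indicat_real (dil t) x * (\<eta> * (2 * B + 1)))"
        using i0 by (rule integrable_mult_left)
      show "\<bar>indicat_real (dil t) x * (bump2 e x - Q x)\<bar> \<le> indicat_real (dil t) x * (\<eta> * (2 * B + 1))" for x
        using Qb[of x] by (cases "x \<in> dil t") auto
    qed
    also have "\<dots> = t\<^sup>2 * a * (\<eta> * (2 * B + 1))"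
      using integral_dil[OF t(1), of "\<lambda>_. \<eta> * (2 * B + 1)"] by (simp add: a_def)
    also have "\<dots> \<le> (T\<^sup>2 * a + 1) * (\<eta> * (2 * B + 1))"
    proof (rule mult_right_mono)
      have "t\<^sup>2 \<le> T\<^sup>2" using t by (intro power_mono) auto
      then have "t\<^sup>2 * a \<le> T\<^sup>2 * a" using a by (rule mult_right_mono)
      then show "t\<^sup>2 * a \<le> T\<^sup>2 * a + 1" by simp
    qed (use \<eta> B in auto)
    also have "\<dots> \<le> 1" using \<eta>' by (simp add: mult_ac)
    finally have 1: "\<bar>smoothed_count e t - (LINT x|lborel. indicat_real (dil t) x * Q x)\<bar> \<le> 1" .
    have ic: "integrable lborel (\<lambda>x. indicat_real \<Omega> x * cos (2 * pi * t * (x \<bullet> ivec k)))" for k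
    proof (rule integrable_bounded_support[where S = \<Omega> and B = 1])
      have [measurable]: "(\<lambda>x. cos (2 * pi * t * (x \<bullet> ivec k))) \<in> borel_measurable borel"
        by (intro borel_measurable_continuous_onI continuous_intros)
      show "(\<lambda>x. indicat_real \<Omega> x * cos (2 * pi * t * (x \<bullet> ivec k))) \<in> borel_measurable borel" by measurable
    qed (use bounded_dom in \<open>auto simp: indicator_def\<close>)
    have "(LINT x|lborel. indicat_real (dil t) x * Q x) = t\<^sup>2 * (LINT x|lborel. indicat_real \<Omega> x * Q (t *\<^sub>R x))"
      by (rule integral_dil[OF t(1) Qm])
    also have "(LINT x|lborel. indicat_real \<Omega> x * Q (t *\<^sub>R x))
      = (LINT x|lborel. (\<Sum>k\<in>ibox N. c (fst k) * c (snd k) * (indicat_real \<Omega> x * cos (2 * pi * t * (x \<bullet> ivec k)))))"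
    proof (rule Bochner_Integration.integral_cong[OF refl])
      fix x :: "real \<times> real"
      have "2 * pi * (of_int (fst k) * (t * fst x) + of_int (snd k) * (t * snd x)) = 2 * pi * t * (x \<bullet> ivec k)" for k
        by (simp add: ivec_def inner_prod_def algebra_simps)
      then have "(\<Sum>k\<in>ibox N. c (fst k) * c (snd k) * cos (2 * pi * (of_int (fst k) * (t * fst x) + of_int (snd k) * (t * snd x))))
        = (\<Sum>k\<in>ibox N. c (fst k) * c (snd k) * cos (2 * pi * t * (x \<bullet> ivec k)))"
        by (simp only:)
      then have "Q (t *\<^sub>R x) = (\<Sum>k\<in>ibox N. c (fst k) * c (snd k) * cos (2 * pi * t * (x \<bullet> ivec k)))"
        unfolding Q_def P_def trig_polynomial_product[of c, OF c(1)] fst_scaleR snd_scaleR real_scaleR_def .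
      then show "indicat_real \<Omega> x * Q (t *\<^sub>R x) = (\<Sum>k\<in>ibox N. c (fst k) * c (snd k) * (indicat_real \<Omega> x * cos (2 * pi * t * (x \<bullet> ivec k))))"
        by (simp add: sum_distrib_left mult_ac)
    qed
    also have "\<dots> = (\<Sum>k\<in>ibox N. c (fst k) * c (snd k) * dom_cos k t)"
      using ic by (simp add: dom_cos_def Bochner_Integration.integral_sum)
    finally show "\<bar>smoothed_count e t - t\<^sup>2 * (\<Sum>k\<in>ibox N. c (fst k) * c (snd k) * dom_cos k t)\<bar> \<le> 1"
      using 1 by simp
  qed (use c in auto)
qed

section \<open>Lattice points in shells of the support function\<close>

lemma support_le_norm:
  obtains D where "0 < D" "\<And>x. \<rho> x \<le> D * norm x"
  by (rule inner_le_norm) (blast intro: support_leI)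

lemma inscribed_ball:
  obtains r where "0 < r" "cball 0 r \<subseteq> \<Omega>" "\<And>x. r * norm x \<le> \<rho> x"
proof -
  obtain r where r: "0 < r" "cball 0 r \<subseteq> \<Omega>" using open_dom zero_dom open_contains_cball by metis
  show thesis
  proof (rule that[OF r])
    fix x
    show "r * norm x \<le> \<rho> x"
    proof (cases "x = 0")
      case True then show ?thesis by (simp add: support_nonneg)
    next
      case False
      have "(r / norm x) *\<^sub>R x \<in> \<Omega>" using r False by (intro subsetD[OF r(2)]) simp
      from inner_le_support[OF this, of x] show ?thesis
        using False by (simp add: power2_norm_eq_inner[symmetric] power2_eq_square)
    qed
  qed
qed

text \<open>Area comparison: the unit squares with lower left corner at the lattice points are
  disjoint, and since the support function is D-Lipschitz they lie in the shell m - 2D <= \<rho> < m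
  + 1 + 2D. By homogeneity the area of {\<rho> < s} is proportional to s^2, so the shell of bounded
  width has area O(m + 1).\<close>

lemma lattice_annulus_count:
  obtains C where "0 < C" "\<And>S m. finite S \<Longrightarrow> (\<And>k. k \<in> S \<Longrightarrow> nat \<lfloor>\<rho> (ivec k)\<rfloor> = m) \<Longrightarrow> real (card S) \<le> C * (real m + 1)"
proof -
  obtain D where D: "0 < D" "\<And>x. \<rho> x \<le> D * norm x" by (rule support_le_norm) blast
  obtain r where r: "0 < r" "cball 0 r \<subseteq> \<Omega>" "\<And>x. r * norm x \<le> \<rho> x" by (rule inscribed_ball) blast
  have lip: "\<bar>\<rho> x - \<rho> y\<bar> \<le> D * norm (x - y)" for x y
    using support_add[of y "x - y"] support_add[of x "y - x"] D(2)[of "x - y"] D(2)[of "y - x"]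
    by (simp add: norm_minus_commute abs_le_iff)
  have "continuous_on UNIV \<rho>"
  proof (rule continuous_onI)
    fix x :: "real \<times> real" and e :: real assume e: "0 < e"
    have "dist (\<rho> y) (\<rho> x) \<le> e" if "dist y x < e / D" for y
    proof -
      have "D * norm (y - x) \<le> e" using that D(1) by (simp add: dist_norm field_simps)
      then show ?thesis using lip[of y x] by (simp add: dist_real_def)
    qed
    then show "\<exists>d>0. \<forall>x'\<in>UNIV. dist x' x < d \<longrightarrow> dist (\<rho> x') (\<rho> x) \<le> e"
      using e D(1) by (intro exI[of _ "e / D"]) auto
  qed
  then have \<rho>m [measurable]: "\<rho> \<in> borel_measurable borel" by (rule borel_measurable_continuous_onI)
  define V where "V s = {x. \<rho> x < s}" for s
  have Vm [measurable]: "V s \<in> sets borel" for s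
    unfolding V_def by measurable
  have Vb: "bounded (V s)" for s
  proof (rule boundedI)
    fix x assume "x \<in> V s"
    then show "norm x \<le> s / r" using r(3)[of x] r(1) by (simp add: V_def field_simps)
  qed
  have Vi: "integrable lborel (indicat_real (V s))" for s
    using Vb[of s] by (intro integrable_bounded_support[where S = "V s" and B = 1]) auto
  define w where "w = (LINT x|lborel. indicat_real (V 1) x)"
  have w: "0 \<le> w" by (simp add: w_def)
  have Vs: "(LINT x|lborel. indicat_real (V s) x) = (max s 0)\<^sup>2 * w" for s
  proof (cases "0 < s")
    case True
    have "indicat_real (V s) (s *\<^sub>R x) = indicat_real (V 1) x" for x
      using True by (simp add: V_def support_scale indicator_def)
    then show ?thesis using True lborel_integral_scale[of "indicat_real (V s)" s] by (simp add: w_def)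
  next
    case False
    then have "V s = {}" using support_nonneg by (auto simp: V_def not_less intro: order_trans)
    then show ?thesis using False by simp
  qed
  \<comment> \<open>A bound 1 + 4D for the width of the shell, (2 + 2D)(m + 1) for the sum of its
    two radii, and the area w of the unit sublevel set; the final 1 ensures positivity.\<close>
  define C where "C = (1 + 4 * D) * (2 + 2 * D) * w + 1"
  show thesis
  proof (rule that[of C])
    show "0 < C" using D w by (auto simp: C_def intro!: add_nonneg_pos mult_nonneg_nonneg)
    fix S m assume fin: "finite S" and S: "\<And>k. k \<in> S \<Longrightarrow> nat \<lfloor>\<rho> (ivec k)\<rfloor> = m"
    define f where "f i x = indicat_real {of_int i..<of_int i + 1} x" for i :: int and x :: real
    define g where "g k x = f (fst k) (fst x) * f (snd k) (snd x)" for k x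
    have fi: "integrable lborel (f i)" "(LINT x|lborel. f i x) = 1" for i
      unfolding f_def[abs_def] by (auto intro!: integrable_real_indicator emeasure_bounded_finite)
    have gi: "integrable lborel (g k)" "(LINT x|lborel. g k x) = 1" for k
      unfolding g_def[abs_def] using integral_product_lborel[OF fi(1) fi(1)] fi(2) by auto
    let ?hi = "real m + 1 + 2 * D" and ?lo = "real m - 2 * D"
    have "real (card S) = (\<Sum>k\<in>S. (LINT x|lborel. g k x))" by (simp add: gi)
    also have "\<dots> = (LINT x|lborel. (\<Sum>k\<in>S. g k x))"
      using gi by (intro Bochner_Integration.integral_sum[symmetric])
    also have "\<dots> \<le> (LINT x|lborel. indicat_real (V ?hi) x - indicat_real (V ?lo) x)"
    proof (rule integral_mono)
      show "integrable lborel (\<lambda>x. \<Sum>k\<in>S. g k x)" using gi by (intro Bochner_Integration.integrable_sum)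
      show "integrable lborel (\<lambda>x. indicat_real (V ?hi) x - indicat_real (V ?lo) x)"
        by (intro Bochner_Integration.integrable_diff Vi)
      fix x :: "real \<times> real"
      have sub: "V ?lo \<subseteq> V ?hi" using D(1) by (auto simp: V_def)
      define n where "n = (\<lfloor>fst x\<rfloor>, \<lfloor>snd x\<rfloor>)"
      have g0: "g k x = (if k = n then 1 else 0)" for k
      proof -
        have "f i y = (if i = \<lfloor>y\<rfloor> then 1 else 0)" for i y
          unfolding f_def indicator_def by (auto simp: floor_eq_iff[symmetric] eq_commute) 
        then show ?thesis by (auto simp: g_def n_def prod_eq_iff)
      qed
      have "(\<Sum>k\<in>S. g k x) = (if n \<in> S then 1 else 0)" using fin by (simp add: g0)
      also have "\<dots> \<le> indicat_real (V ?hi) x - indicat_real (V ?lo) x"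
      proof (cases "n \<in> S")
        case True
        have "norm (x - ivec n) \<le> 2"
        proof -
          have "norm (x - ivec n) \<le> norm (fst (x - ivec n)) + norm (snd (x - ivec n))"
            using norm_Pair_le[of "fst (x - ivec n)" "snd (x - ivec n)"] unfolding prod.collapse .
          moreover have "norm (fst (x - ivec n)) \<le> 1" "norm (snd (x - ivec n)) \<le> 1"
            by (auto simp: ivec_def n_def; linarith)+
          ultimately show ?thesis by linarith
        qed
        then have "D * norm (x - ivec n) \<le> D * 2" using D(1) by (intro mult_left_mono) auto
        then have 1: "\<bar>\<rho> x - \<rho> (ivec n)\<bar> \<le> 2 * D" using lip[of x "ivec n"] by linarith
        have "real m = of_int \<lfloor>\<rho> (ivec n)\<rfloor>" using S[OF True] support_nonneg[of "ivec n"] by auto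
        then have "real m \<le> \<rho> (ivec n)" "\<rho> (ivec n) < real m + 1" by linarith+
        with 1 have "x \<in> V ?hi" "x \<notin> V ?lo" unfolding V_def by auto
        then show ?thesis using True by simp
      next
        case False
        then show ?thesis using sub by (auto simp: indicator_def)
      qed
      finally show "(\<Sum>k\<in>S. g k x) \<le> indicat_real (V ?hi) x - indicat_real (V ?lo) x" .
    qed
    also have "\<dots> = (?hi\<^sup>2 - (max ?lo 0)\<^sup>2) * w"
    proof -
      have "(LINT x|lborel. indicat_real (V ?hi) x - indicat_real (V ?lo) x)
        = (LINT x|lborel. indicat_real (V ?hi) x) - (LINT x|lborel. indicat_real (V ?lo) x)"
        by (rule Bochner_Integration.integral_diff[OF Vi Vi])
      moreover have "max ?hi 0 = ?hi" using D(1) by simp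
      ultimately show ?thesis by (simp only: Vs left_diff_distrib)
    qed
    also have "\<dots> \<le> ((1 + 4 * D) * (2 + 2 * D) * (real m + 1)) * w"
    proof (rule mult_right_mono[OF _ w])
      have "?hi\<^sup>2 - (max ?lo 0)\<^sup>2 = (?hi - max ?lo 0) * (?hi + max ?lo 0)"
        by (simp add: power2_eq_square algebra_simps)
      also have "\<dots> \<le> (1 + 4 * D) * ((2 + 2 * D) * (real m + 1))"
      proof (rule mult_mono)
        show "?hi - max ?lo 0 \<le> 1 + 4 * D" by linarith
        have "0 \<le> D * real m" using D(1) by simp
        moreover have "(2 + 2 * D) * (real m + 1) = 2 * real m + 2 + 2 * D + 2 * (D * real m)"
          by (simp add: algebra_simps)
        ultimately show "?hi + max ?lo 0 \<le> (2 + 2 * D) * (real m + 1)" using D(1) by linarith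
        show "0 \<le> 1 + 4 * D" using D(1) by simp
        show "0 \<le> ?hi + max ?lo 0" using D(1) by simp
      qed
      finally show "?hi\<^sup>2 - (max ?lo 0)\<^sup>2 \<le> (1 + 4 * D) * (2 + 2 * D) * (real m + 1)" by (simp only: mult.assoc)
    qed
    also have "\<dots> \<le> C * (real m + 1)" unfolding C_def by (simp add: algebra_simps)
    finally show "real (card S) \<le> C * (real m + 1)" .
  qed
qed

end

section \<open>Sums over lattice points\<close>

text \<open>Up to a constant, the size of the Fourier coefficients of the kernel at scale \<open>1 / R\<close>.\<close>

definition cutoff :: "real \<Rightarrow> real \<Rightarrow> real" where
  "cutoff R n = min 1 (R\<^sup>2 / n\<^sup>2)"

text \<open>Models the mollifier coefficient times |k|^(-3/2) for a lattice vector in shell m. The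
  shift by 1 keeps the shell m = 0 harmless.\<close>

definition weight :: "real \<Rightarrow> nat \<Rightarrow> real" where
  "weight R m = cutoff R (real m + 1) / ((real m + 1) * sqrt (real m + 1))"

lemma cutoff_bounds: "0 \<le> cutoff R n" "cutoff R n \<le> 1"
  by (auto simp: cutoff_def)

lemma sum_inverse_sqrt_le: "(\<Sum>m<N. 1 / sqrt (real m + 1)) \<le> 2 * sqrt (real N)"
proof (induction N)
  case (Suc N)
  define a b where "a = sqrt (real N)" and "b = sqrt (real N + 1)"
  have ab: "0 < b" "a \<le> b" "b\<^sup>2 - a\<^sup>2 = 1" by (auto simp: a_def b_def)
  have "1 = (b - a) * (b + a)" using ab(3) by (simp add: power2_eq_square algebra_simps)
  also have "\<dots> \<le> (b - a) * (2 * b)" using ab by (intro mult_left_mono) auto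
  finally have "1 / b \<le> 2 * b - 2 * a" using ab by (simp add: field_simps)
  then show ?case using Suc by (simp add: a_def b_def add.commute)
qed simp

lemma sum_inverse_le_ln: "(\<Sum>m<Suc N. 1 / (real m + 1)) \<le> 1 + ln (real N + 1)"
proof (induction N)
  case (Suc N)
  have "ln ((real N + 1) / (real N + 2)) \<le> (real N + 1) / (real N + 2) - 1"
    by (intro ln_le_minus_one) auto
  also have "\<dots> = - (1 / (real N + 2))" by (simp add: field_simps)
  finally have "1 / (real N + 2) \<le> ln (real N + 2) - ln (real N + 1)" by (simp add: ln_div)
  then show ?case using Suc by (simp add: add.commute)
qed simp

lemma sum_inverse_squares_tail: "0 < N \<Longrightarrow> (\<Sum>m\<in>{N..<X}. 1 / (real m + 1)\<^sup>2) \<le> 1 / real N"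
proof -
  assume N: "0 < N"
  have "(\<Sum>m\<in>{N..<X}. 1 / (real m + 1)\<^sup>2) \<le> 1 / real N - (if N \<le> X then 1 / real X else 1 / real N)"
  proof (induction X)
    case (Suc X)
    show ?case
    proof (cases "N \<le> X")
      case True
      then have X: "0 < X" using N by simp
      have "1 / (real X + 1)\<^sup>2 \<le> 1 / (real X * (real X + 1))"
        using X by (intro divide_left_mono) (auto simp: power2_eq_square)
      also have "\<dots> = 1 / real X - 1 / real (Suc X)" using X by (simp add: field_simps)
      finally show ?thesis using Suc True by simp
    next
      case False
      then show ?thesis using N by (cases "N = Suc X") auto
    qed
  qed (use N in auto)
  also have "\<dots> \<le> 1 / real N" by simp
  finally show ?thesis .
qed

lemma ln_ge_three_fifths: "2 \<le> R \<Longrightarrow> 3/5 \<le> ln R" for R :: real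
  using ln2_ge_two_thirds ln_mono[of 2 R] by linarith

text \<open>Split at m = floor R: below, the cutoff is at most 1 and the sums are those of m^(-1/2)
  and 1/m; above, the factor R^2 / m^2 makes the tails comparable to the boundary term. The first
  sum serves absolute summation over shells, the second square summation.\<close>

lemma cutoff_sums:
  assumes R: "2 \<le> R"
  shows "(\<Sum>m<X. cutoff R (real m + 1) / sqrt (real m + 1)) \<le> 4 * sqrt R"
    and "(\<Sum>m<X. (cutoff R (real m + 1))\<^sup>2 / (real m + 1)) \<le> 6 * ln R"
proof -
  define N where "N = nat \<lfloor>R\<rfloor>"
  have N: "real N \<le> R" "R < real N + 1" "0 < N" using R by (auto simp: N_def; linarith)+
  have NR: "R / real N \<le> 2" using N by (simp add: field_simps)
  have split: "(\<Sum>m<X. f m) \<le> (\<Sum>m<N. f m) + (\<Sum>m\<in>{N..<X}. f m)" if "\<And>m. 0 \<le> f m" for f :: "nat \<Rightarrow> real"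
  proof -
    have "(\<Sum>m<X. f m) \<le> (\<Sum>m\<in>{..<N} \<union> {N..<X}. f m)" using that by (intro sum_mono2) auto
    also have "\<dots> = (\<Sum>m<N. f m) + (\<Sum>m\<in>{N..<X}. f m)" by (intro sum.union_disjoint) auto
    finally show ?thesis .
  qed
  have cu: "cutoff R (real m + 1) \<le> R\<^sup>2 / (real m + 1)\<^sup>2" for m by (simp add: cutoff_def)
  have "(\<Sum>m<N. cutoff R (real m + 1) / sqrt (real m + 1)) \<le> (\<Sum>m<N. 1 / sqrt (real m + 1))"
    using cutoff_bounds by (intro sum_mono divide_right_mono) auto
  also have "\<dots> \<le> 2 * sqrt (real N)" by (rule sum_inverse_sqrt_le)
  also have "\<dots> \<le> 2 * sqrt R" using N by simp
  finally have 1: "(\<Sum>m<N. cutoff R (real m + 1) / sqrt (real m + 1)) \<le> 2 * sqrt R" .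
  have "(\<Sum>m\<in>{N..<X}. cutoff R (real m + 1) / sqrt (real m + 1)) \<le> (\<Sum>m\<in>{N..<X}. (R\<^sup>2 / sqrt R) * (1 / (real m + 1)\<^sup>2))"
  proof (rule sum_mono)
    fix m assume "m \<in> {N..<X}"
    then have "R \<le> real m + 1" using N by auto
    then have "cutoff R (real m + 1) / sqrt (real m + 1) \<le> (R\<^sup>2 / (real m + 1)\<^sup>2) / sqrt R"
      using cu[of m] R cutoff_bounds by (intro frac_le) auto
    then show "cutoff R (real m + 1) / sqrt (real m + 1) \<le> (R\<^sup>2 / sqrt R) * (1 / (real m + 1)\<^sup>2)" by (simp add: mult.commute)
  qed
  also have "\<dots> \<le> (R\<^sup>2 / sqrt R) * (1 / real N)"
    unfolding sum_distrib_left[symmetric] using R N by (intro mult_left_mono sum_inverse_squares_tail) auto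
  also have "\<dots> = sqrt R * (R / real N)"
  proof -
    have "R\<^sup>2 / sqrt R = R * sqrt R" using R by (simp add: power2_eq_square real_div_sqrt field_simps)
    then show ?thesis by simp
  qed
  also have "\<dots> \<le> sqrt R * 2" using NR R by (intro mult_left_mono) auto
  finally have 2: "(\<Sum>m\<in>{N..<X}. cutoff R (real m + 1) / sqrt (real m + 1)) \<le> sqrt R * 2" .
  show "(\<Sum>m<X. cutoff R (real m + 1) / sqrt (real m + 1)) \<le> 4 * sqrt R"
    using split[of "\<lambda>m. cutoff R (real m + 1) / sqrt (real m + 1)"] cutoff_bounds 1 2 by simp
  have sq: "(cutoff R n)\<^sup>2 \<le> cutoff R n" for n
    using cutoff_bounds[of R n] by (simp add: power2_eq_square mult_left_le)
  have "(\<Sum>m<N. (cutoff R (real m + 1))\<^sup>2 / (real m + 1)) \<le> (\<Sum>m<Suc (N - 1). 1 / (real m + 1))"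
    using N cutoff_bounds by (simp add: power_le_one sum_mono divide_right_mono)
  also have "\<dots> \<le> 1 + ln (real (N - 1) + 1)" by (rule sum_inverse_le_ln)
  also have "\<dots> \<le> 1 + ln R" using N by (simp add: of_nat_diff)
  finally have 3: "(\<Sum>m<N. (cutoff R (real m + 1))\<^sup>2 / (real m + 1)) \<le> 1 + ln R" .
  have "(\<Sum>m\<in>{N..<X}. (cutoff R (real m + 1))\<^sup>2 / (real m + 1)) \<le> (\<Sum>m\<in>{N..<X}. R * (1 / (real m + 1)\<^sup>2))"
  proof (rule sum_mono)
    fix m assume "m \<in> {N..<X}"
    then have "R \<le> real m + 1" using N by auto
    then have "(cutoff R (real m + 1))\<^sup>2 / (real m + 1) \<le> (R\<^sup>2 / (real m + 1)\<^sup>2) / R"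
      using cu[of m] sq[of "real m + 1"] R by (intro frac_le) auto
    then show "(cutoff R (real m + 1))\<^sup>2 / (real m + 1) \<le> R * (1 / (real m + 1)\<^sup>2)" using R by (simp add: power2_eq_square)
  qed
  also have "\<dots> \<le> R * (1 / real N)"
    unfolding sum_distrib_left[symmetric] using R N by (intro mult_left_mono sum_inverse_squares_tail) auto
  finally have 4: "(\<Sum>m\<in>{N..<X}. (cutoff R (real m + 1))\<^sup>2 / (real m + 1)) \<le> 2" using NR by simp
  \<comment> \<open>The two ranges give 3 + ln R, and 3 <= 5 ln R is the reason for the bound ln R
    >= 3/5.\<close>
  show "(\<Sum>m<X. (cutoff R (real m + 1))\<^sup>2 / (real m + 1)) \<le> 6 * ln R"
    using split[of "\<lambda>m. (cutoff R (real m + 1))\<^sup>2 / (real m + 1)"] ln_ge_three_fifths[OF R] 3 4 by simp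
qed

lemma lattice_group_sum:
  fixes r b :: "int \<times> int \<Rightarrow> real"
  assumes fin: "finite I"
    and count: "\<And>m. real (card {k \<in> I. nat \<lfloor>r k\<rfloor> = m}) \<le> C * (real m + 1)"
    and b: "\<And>k. k \<in> I \<Longrightarrow> b k \<le> B * weight R (nat \<lfloor>r k\<rfloor>)"
    and B: "0 \<le> B"
  shows "(\<Sum>k | k \<in> I \<and> nat \<lfloor>r k\<rfloor> = m. b k) \<le> B * C * (cutoff R (real m + 1) / sqrt (real m + 1))"
proof -
  define n where "n = real m + 1"
  have n: "0 < n" by (simp add: n_def)
  have "(\<Sum>k | k \<in> I \<and> nat \<lfloor>r k\<rfloor> = m. b k) \<le> real (card {k \<in> I. nat \<lfloor>r k\<rfloor> = m}) * (B * (cutoff R n / (n * sqrt n)))"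
    using b by (intro sum_bounded_above) (auto simp: n_def weight_def)
  also have "\<dots> \<le> (C * n) * (B * (cutoff R n / (n * sqrt n)))"
    using count[of m] B n cutoff_bounds by (intro mult_right_mono mult_nonneg_nonneg divide_nonneg_nonneg) (auto simp: n_def)
  also have "\<dots> = B * C * (cutoff R n / sqrt n)" using n by simp
  finally show ?thesis by (simp add: n_def)
qed

text \<open>A shell of O(m + 1) points, each of weight (m + 1)^(-3/2), sums to (m + 1)^(-1/2) times
  the cutoff. Hence sqrt R for the plain sum and ln R for the sum of squared shell sums.\<close>

lemma lattice_group_sums:
  fixes r b :: "int \<times> int \<Rightarrow> real"
  assumes fin: "finite I" and R: "2 \<le> R"
    and count: "\<And>m. real (card {k \<in> I. nat \<lfloor>r k\<rfloor> = m}) \<le> C * (real m + 1)"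
    and b: "\<And>k. k \<in> I \<Longrightarrow> b k \<le> B * weight R (nat \<lfloor>r k\<rfloor>)"
    and b0: "\<And>k. k \<in> I \<Longrightarrow> 0 \<le> b k"
    and B: "0 \<le> B" and C: "0 \<le> C"
  shows "(\<Sum>k\<in>I. b k) \<le> B * C * (4 * sqrt R)"
    and "(\<Sum>m\<in>(\<lambda>k. nat \<lfloor>r k\<rfloor>) ` I. (\<Sum>k | k \<in> I \<and> nat \<lfloor>r k\<rfloor> = m. b k)\<^sup>2) \<le> (B * C)\<^sup>2 * (6 * ln R)"
proof -
  let ?m = "\<lambda>k. nat \<lfloor>r k\<rfloor>"
  obtain X where X: "?m ` I \<subseteq> {..<X}" using fin finite_nat_iff_bounded by blast
  note grp = lattice_group_sum[OF fin count b B]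
  have BC: "0 \<le> B * C" using B C by simp
  have "(\<Sum>k\<in>I. b k) = (\<Sum>m\<in>?m ` I. \<Sum>k | k \<in> I \<and> ?m k = m. b k)" by (rule sum.image_gen[OF fin])
  also have "\<dots> \<le> (\<Sum>m\<in>?m ` I. B * C * (cutoff R (real m + 1) / sqrt (real m + 1)))"
    by (intro sum_mono grp) auto
  also have "\<dots> \<le> (\<Sum>m<X. B * C * (cutoff R (real m + 1) / sqrt (real m + 1)))"
    using X BC cutoff_bounds by (intro sum_mono2) (auto intro!: mult_nonneg_nonneg divide_nonneg_nonneg)
  also have "\<dots> \<le> B * C * (4 * sqrt R)"
    unfolding sum_distrib_left[symmetric] using BC by (intro mult_left_mono cutoff_sums R)
  finally show "(\<Sum>k\<in>I. b k) \<le> B * C * (4 * sqrt R)" .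
  have "(\<Sum>m\<in>?m ` I. (\<Sum>k | k \<in> I \<and> ?m k = m. b k)\<^sup>2) \<le> (\<Sum>m\<in>?m ` I. (B * C * (cutoff R (real m + 1) / sqrt (real m + 1)))\<^sup>2)"
    by (intro sum_mono power_mono grp sum_nonneg) (auto intro: b0)
  also have "\<dots> = (\<Sum>m\<in>?m ` I. (B * C)\<^sup>2 * ((cutoff R (real m + 1))\<^sup>2 / (real m + 1)))"
    by (simp add: power_mult_distrib power_divide)
  also have "\<dots> \<le> (\<Sum>m<X. (B * C)\<^sup>2 * ((cutoff R (real m + 1))\<^sup>2 / (real m + 1)))"
    using X by (intro sum_mono2) auto
  also have "\<dots> \<le> (B * C)\<^sup>2 * (6 * ln R)"
    unfolding sum_distrib_left[symmetric] by (intro mult_left_mono cutoff_sums R) auto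
  finally show "(\<Sum>m\<in>?m ` I. (\<Sum>k | k \<in> I \<and> ?m k = m. b k)\<^sup>2) \<le> (B * C)\<^sup>2 * (6 * ln R)" .
qed

section \<open>The mean square of the error\<close>

lemma cos_transform_cmult: "cos_transform (\<lambda>s. a * G s) t = a * cos_transform G t"
  unfolding cos_transform_def mult.assoc by (rule integral_mult_right_zero)

lemma sum3_square_le: "(x + y + z)\<^sup>2 \<le> 3 * (x\<^sup>2 + y\<^sup>2 + z\<^sup>2)" for x y z :: real
  using zero_le_power2[of "x - y"] zero_le_power2[of "y - z"] zero_le_power2[of "x - z"]
  by (simp add: power2_eq_square algebra_simps)

lemma norm_ivec_ge_1: "k \<noteq> 0 \<Longrightarrow> 1 \<le> norm (ivec k)"
proof -
  assume "k \<noteq> 0"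
  then consider "fst k \<noteq> 0" | "snd k \<noteq> 0" by (auto simp: prod_eq_iff)
  then have "1 \<le> \<bar>real_of_int (fst k)\<bar> \<or> 1 \<le> \<bar>real_of_int (snd k)\<bar>" by cases linarith+
  then show ?thesis
    using norm_fst_le[of "real_of_int (fst k)" "real_of_int (snd k)"]
      norm_snd_le[of "real_of_int (snd k)" "real_of_int (fst k)"] by (auto simp: ivec_def)
qed

text \<open>Only the decay in the larger coordinate is used, the other factor being at most 1; the
  square of the norm is at most twice the square of that coordinate.\<close>

lemma coefficient_product_decay:
  fixes c :: "int \<Rightarrow> real"
  assumes decay: "bump_decay e c" and e: "0 < e" and k: "k \<noteq> 0"
  shows "\<bar>c (fst k) * c (snd k)\<bar> \<le> 2 / (e * norm (ivec k))\<^sup>2"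
proof -
  have c: "\<And>k. \<bar>c k\<bar> \<le> 1" "\<And>k. k \<noteq> 0 \<Longrightarrow> \<bar>c k\<bar> \<le> 1 / (e * of_int k)\<^sup>2"
    using decay by (auto simp: bump_decay_def)
  have n2: "(norm (ivec k))\<^sup>2 = (of_int (fst k))\<^sup>2 + (of_int (snd k))\<^sup>2"
    by (simp add: ivec_def norm_Pair)
  have key: "\<bar>c i * c j\<bar> \<le> 2 / (e * norm (ivec k))\<^sup>2"
    if ij: "(norm (ivec k))\<^sup>2 = (of_int i)\<^sup>2 + (of_int j)\<^sup>2" "(of_int j)\<^sup>2 \<le> (of_int i :: real)\<^sup>2" for i j
  proof -
    have "i \<noteq> 0"
    proof
      assume "i = 0"
      then have "(norm (ivec k))\<^sup>2 \<le> 0" using ij by simp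
      then show False using norm_ivec_ge_1[OF k] by (simp add: power2_eq_square mult_le_0_iff)
    qed
    have "\<bar>c i * c j\<bar> \<le> \<bar>c i\<bar>" using c(1)[of j] by (simp add: abs_mult mult_left_le)
    also have "\<dots> \<le> 1 / (e * of_int i)\<^sup>2" by (rule c(2)[OF \<open>i \<noteq> 0\<close>])
    also have "\<dots> = 2 / (e\<^sup>2 * (2 * (of_int i)\<^sup>2))" by (simp add: power_mult_distrib)
    also have "\<dots> \<le> 2 / (e\<^sup>2 * (norm (ivec k))\<^sup>2)"
    proof (intro divide_left_mono mult_left_mono mult_pos_pos)
      show "(norm (ivec k))\<^sup>2 \<le> 2 * (of_int i)\<^sup>2" using ij by linarith
      have "0 < norm (ivec k)" using norm_ivec_ge_1[OF k] by linarith
      then show "0 < (norm (ivec k))\<^sup>2" by (rule zero_less_power)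
    qed (use e \<open>i \<noteq> 0\<close> in auto)
    finally show ?thesis by (simp add: power_mult_distrib)
  qed
  show ?thesis
  proof (cases "(of_int (snd k))\<^sup>2 \<le> (of_int (fst k) :: real)\<^sup>2")
    case True
    show ?thesis by (rule key[OF n2 True])
  next
    case False
    then show ?thesis using key[of "snd k" "fst k"] n2 by (simp add: add.commute mult.commute)
  qed
qed

context cap_domain
begin

lemma ivec_nonzero: "k \<noteq> 0 \<Longrightarrow> ivec k \<noteq> 0"
  using norm_ivec_ge_1[of k] by auto

lemma dom_cos_profile:
  assumes "ivec k \<noteq> 0"
  obtains A where "slice_profile A (- \<rho> (- ivec k)) (\<rho> (ivec k)) (M / (norm (ivec k) * sqrt (norm (ivec k))))"
    "dom_cos k = cos_transform A"
  by (rule cos_integral_eq_profile[OF assms]) (auto simp: dom_cos_def fun_eq_iff)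

lemma continuous_dom_cos: "k \<noteq> 0 \<Longrightarrow> continuous_on UNIV (dom_cos k)"
  by (rule dom_cos_profile[OF ivec_nonzero]) (auto dest!: slice_profile.integrable_A continuous_cos_transform)

text \<open>The frequencies of \<open>dom_cos k\<close> that lie within distance 1 of the two end points of the slice
  profile carry almost all of it and are handled by almost orthogonality; what remains is summed
  trivially.\<close>

lemma trig_sum_mean_square:
  assumes c0: "0 < c0"
  obtains C where "0 \<le> C"
    "\<And>R N c. 2 \<le> R \<Longrightarrow> bump_decay (c0 / R) c \<Longrightarrow>
      integral {R - 1/2..R + 3/2} (\<lambda>t. (trig_error N c t)\<^sup>2) \<le> C * (R * ln R)"
proof -
  obtain D where D: "0 < D" "\<And>x. \<rho> x \<le> D * norm x" by (rule support_le_norm) blast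
  obtain C1 where C1: "0 < C1"
    "\<And>S m. finite S \<Longrightarrow> (\<And>k. k \<in> S \<Longrightarrow> nat \<lfloor>\<rho> (ivec k)\<rfloor> = m) \<Longrightarrow> real (card S) \<le> C1 * (real m + 1)"
    by (rule lattice_annulus_count) blast
  \<comment> \<open>The shell index plus 1 is at most D |k| + 1 <= (D + 1) |k|, as |k| >= 1 for a
    nonzero lattice vector.\<close>
  define D1 where "D1 = D + 1"
  have D1: "0 < D1" using D by (simp add: D1_def)
  \<comment> \<open>The summand 1 serves the trivial bound on the coefficients, the other summand
    their decay, so one constant covers both branches of the cutoff.\<close>
  define C6 where "C6 = 1 + 2 * D1\<^sup>2 / c0\<^sup>2"
  have C6: "1 \<le> C6" by (simp add: C6_def)
  define C2 where "C2 = C6 * (D1 * sqrt D1)"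
  have C2: "0 \<le> C2" using C6 D1 by (simp add: C2_def)
  define B where "B = 16 * M * C2"
  have B: "0 \<le> B" using M_nonneg C2 by (simp add: B_def)
  \<comment> \<open>48 = 16 * 3 comes from t^4 <= 16 R^4 and from the square of three terms, 14040 =
    2 * 7020 from the two ends; the 4 is the length 2 of the interval times the 2 in 1 <= 2 ln
    R.\<close>
  define C where "C = 48 * (14040 * ((B * C1)\<^sup>2 * 6) + 4 * (B * C1 * 4)\<^sup>2)"
  show thesis
  proof (rule that[of C])
    show "0 \<le> C" by (simp add: C_def)
    fix R :: real and N and c :: "int \<Rightarrow> real"
    assume R: "2 \<le> R" and decay: "bump_decay (c0 / R) c"
    define I where "I = ibox N - {0}"
    \<comment> \<open>For t near R the phase 2 pi t h is then near pi / 2, where 2 - 2 cos is about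
      2.\<close>
    define h where "h = 1 / (4 * R)"
    define v where "v k = c (fst k) * c (snd k)" for k
    define K where "K k = M / (norm (ivec k) * sqrt (norm (ivec k)))" for k
    have h: "0 < h" "h \<le> 1/8" using R by (auto simp: h_def field_simps)
    have fin: "finite I" by (simp add: I_def ibox_def)
    have k1: "1 \<le> norm (ivec k)" "ivec k \<noteq> 0" if "k \<in> I" for k
      using norm_ivec_ge_1[of k] that by (auto simp: I_def)
    have K0: "0 \<le> K k" for k using M_nonneg by (simp add: K_def)
    have coeff: "\<bar>v k\<bar> / (norm (ivec k) * sqrt (norm (ivec k))) \<le> C2 * (cutoff R n / (n * sqrt n))"
      if k: "k \<in> I" and n: "1 \<le> n" "n \<le> D1 * norm (ivec k)" for k n
    proof -
      let ?q = "norm (ivec k)"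
      have q: "0 < ?q" using k1[OF k] by simp
      have "\<bar>v k\<bar> \<le> 2 / ((c0 / R) * ?q)\<^sup>2"
        unfolding v_def using decay c0 R k by (intro coefficient_product_decay) (auto simp: I_def)
      also have "\<dots> = (2 * D1\<^sup>2 / c0\<^sup>2) * (R\<^sup>2 / (D1 * ?q)\<^sup>2)"
        using D1 c0 R q by (simp add: field_simps)
      also have "\<dots> \<le> C6 * (R\<^sup>2 / n\<^sup>2)"
      proof (intro mult_mono divide_left_mono)
        show "n\<^sup>2 \<le> (D1 * ?q)\<^sup>2" using n by (intro power_mono) auto
        show "0 < (D1 * ?q)\<^sup>2 * n\<^sup>2" using n D1 q by simp
      qed (auto simp: C6_def)
      finally have "\<bar>v k\<bar> \<le> C6 * (R\<^sup>2 / n\<^sup>2)" .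
      moreover have "\<bar>v k\<bar> \<le> C6 * 1"
      proof -
        have "\<bar>c i\<bar> \<le> 1" for i using decay by (simp add: bump_decay_def)
        from mult_mono[OF this[of "fst k"] this[of "snd k"]] C6 show ?thesis by (simp add: v_def abs_mult)
      qed
      ultimately have v: "\<bar>v k\<bar> \<le> C6 * cutoff R n" by (auto simp: cutoff_def min_def)
      have "n * sqrt n \<le> (D1 * ?q) * sqrt (D1 * ?q)" using n D1 q by (intro mult_mono) auto
      also have "\<dots> = (D1 * sqrt D1) * (?q * sqrt ?q)" by (simp add: real_sqrt_mult)
      finally have le: "n * sqrt n \<le> (D1 * sqrt D1) * (?q * sqrt ?q)" .
      have "1 / (?q * sqrt ?q) \<le> (D1 * sqrt D1) / (n * sqrt n)"
        using le q n by (simp add: field_simps)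
      with v have "\<bar>v k\<bar> * (1 / (?q * sqrt ?q)) \<le> (C6 * cutoff R n) * ((D1 * sqrt D1) / (n * sqrt n))"
        using C6 cutoff_bounds q by (intro mult_mono) auto
      then show ?thesis by (simp add: C2_def mult_ac)
    qed
    have nk: "1 \<le> real (nat \<lfloor>r\<rfloor>) + 1 \<and> real (nat \<lfloor>r\<rfloor>) + 1 \<le> D1 * norm (ivec k)"
      if "k \<in> I" "0 \<le> r" "r \<le> D * norm (ivec k)" for k r
    proof -
      have "real (nat \<lfloor>r\<rfloor>) \<le> r" using that(2) by simp
      moreover have "D1 * norm (ivec k) = D * norm (ivec k) + norm (ivec k)" by (simp add: D1_def algebra_simps)
      ultimately show ?thesis using that(3) k1(1)[OF that(1)] by linarith
    qed
    let ?P = "\<lambda>k. end_split (dom_cos k) (- \<rho> (- ivec k)) (\<rho> (ivec k)) (K k) h"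
    have "\<exists>G1 G2 G3. ?P k G1 G2 G3" if "k \<in> I" for k
      unfolding K_def by (rule dom_cos_profile[OF k1(2)[OF that]]) (metis slice_profile.end_split_exists h)
    then obtain G1 G2 G3 where "\<forall>k\<in>I. ?P k (G1 k) (G2 k) (G3 k)" by metis
    then have
      Gi: "\<And>k. k \<in> I \<Longrightarrow> integrable lborel (G1 k)" "\<And>k. k \<in> I \<Longrightarrow> integrable lborel (G2 k)" "\<And>k. k \<in> I \<Longrightarrow> integrable lborel (G3 k)"
      and Gt: "\<And>k t. k \<in> I \<Longrightarrow> (2 - 2 * cos (2 * pi * t * h)) * dom_cos k t = cos_transform (G1 k) t + cos_transform (G2 k) t + cos_transform (G3 k) t"
      and Gm: "\<And>k. k \<in> I \<Longrightarrow> mass (G1 k) \<le> 16 * K k * (h * sqrt h)"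
        "\<And>k. k \<in> I \<Longrightarrow> mass (G2 k) \<le> 16 * K k * (h * sqrt h)"
        "\<And>k. k \<in> I \<Longrightarrow> mass (G3 k) \<le> 12 * K k * h\<^sup>2"
      and Gs: "\<And>k s. k \<in> I \<Longrightarrow> G1 k s \<noteq> 0 \<Longrightarrow> \<bar>s - \<rho> (ivec k)\<bar> \<le> 1"
        "\<And>k s. k \<in> I \<Longrightarrow> G2 k s \<noteq> 0 \<Longrightarrow> \<bar>s - - \<rho> (- ivec k)\<bar> \<le> 1"
      unfolding end_split_def by blast+
    define b where "b k = 16 * M * (\<bar>v k\<bar> / (norm (ivec k) * sqrt (norm (ivec k))))" for k
    have b0: "0 \<le> b k" for k using M_nonneg by (simp add: b_def)
    have bK: "\<bar>v k\<bar> * (16 * K k) = b k" for k by (simp add: b_def K_def)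
    have bB: "b k \<le> B * weight R (nat \<lfloor>r\<rfloor>)"
      if "k \<in> I" "0 \<le> r" "r \<le> D * norm (ivec k)" for k r
      unfolding b_def B_def weight_def mult.assoc[of "16 * M"]
      using coeff[OF that(1)] nk[OF that] M_nonneg by (intro mult_left_mono) auto
    have bB1: "b k \<le> B * weight R (nat \<lfloor>\<rho> (ivec k)\<rfloor>)"
      if "k \<in> I" for k using that D(2)[of "ivec k"] by (intro bB support_nonneg) auto
    have bB2: "b k \<le> B * weight R (nat \<lfloor>\<rho> (- ivec k)\<rfloor>)"
      if "k \<in> I" for k using that D(2)[of "- ivec k"] by (intro bB support_nonneg) auto
    have count1: "real (card {k \<in> I. nat \<lfloor>\<rho> (ivec k)\<rfloor> = m}) \<le> C1 * (real m + 1)" for m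
      using fin by (intro C1(2)) auto
    \<comment> \<open>The lower ends are counted through the bijection k to -k.\<close>
    have count2: "real (card {k \<in> I. nat \<lfloor>\<rho> (- ivec k)\<rfloor> = m}) \<le> C1 * (real m + 1)" for m
    proof -
      have "card {k \<in> I. nat \<lfloor>\<rho> (- ivec k)\<rfloor> = m} = card (uminus ` {k \<in> I. nat \<lfloor>\<rho> (- ivec k)\<rfloor> = m})"
        by (rule card_image[symmetric]) (auto simp: inj_on_def)
      also have "real \<dots> \<le> C1 * (real m + 1)"
        using fin by (intro C1(2)) (auto simp: ivec_def)
      finally show ?thesis .
    qed
    define hh where "hh = h * sqrt h"
    have hh: "0 \<le> hh" using h by (simp add: hh_def)
    have hh2: "hh\<^sup>2 \<le> 1 / R ^ 3"
    proof -
      have "hh\<^sup>2 = h ^ 3" using h by (simp add: hh_def power_mult_distrib power2_eq_square power3_eq_cube)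
      also have "\<dots> \<le> (1 / R) ^ 3" using R by (intro power_mono) (auto simp: h_def field_simps)
      finally show ?thesis by (simp add: power_divide)
    qed
    have lnR: "1/2 \<le> ln R" using ln_ge_three_fifths[OF R] by simp
    define U where "U G t = (\<Sum>k\<in>I. cos_transform (\<lambda>s. v k * G k s) t)" for G :: "int \<times> int \<Rightarrow> real \<Rightarrow> real" and t
    have Ucont: "continuous_on S (U G)" if "\<And>k. k \<in> I \<Longrightarrow> integrable lborel (G k)" for S G
      unfolding U_def using that
      by (intro continuous_on_sum continuous_on_subset[OF continuous_cos_transform]) auto
    have scaled_mass: "(LINT s|lborel. \<bar>v k * g s\<bar>) = \<bar>v k\<bar> * mass g" for k g
      by (simp add: abs_mult)
    \<comment> \<open>Common to both ends. The interval is centred at R + 1/2 with radius 1, so that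
      [R, R + 1] shifted by up to 1/2 either way stays inside it.\<close>
    have main: "integral {R - 1/2..R + 3/2} (\<lambda>t. (U G t)\<^sup>2) \<le> 7020 * ((B * C1)\<^sup>2 * 6) * (ln R / R ^ 3)"
      if Gi: "\<And>k. k \<in> I \<Longrightarrow> integrable lborel (G k)"
        and Gm: "\<And>k. k \<in> I \<Longrightarrow> mass (G k) \<le> 16 * K k * hh"
        and Gs: "\<And>k s. k \<in> I \<Longrightarrow> G k s \<noteq> 0 \<Longrightarrow> \<bar>\<bar>s\<bar> - r k\<bar> \<le> 1"
        and r: "\<And>k. k \<in> I \<Longrightarrow> 0 \<le> r k"
        and rb: "\<And>k. k \<in> I \<Longrightarrow> b k \<le> B * weight R (nat \<lfloor>r k\<rfloor>)"
        and rc: "\<And>m. real (card {k \<in> I. nat \<lfloor>r k\<rfloor> = m}) \<le> C1 * (real m + 1)" for G r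
    proof -
      have "integral {(R + 1/2) - 1..(R + 1/2) + 1} (\<lambda>t. (\<Sum>k\<in>I. cos_transform (\<lambda>s. v k * G k s) t)\<^sup>2)
        \<le> 7020 * (\<Sum>n\<in>(\<lambda>k. nat \<lfloor>r k\<rfloor>) ` I. (\<Sum>k | k \<in> I \<and> nat \<lfloor>r k\<rfloor> = n. hh * b k)\<^sup>2)"
      proof (rule cos_transform_almost_orthogonal[OF fin _ _ _ r])
        show "integrable lborel (\<lambda>s. v k * G k s)" if "k \<in> I" for k using Gi[OF that] by simp
        show "(LINT s|lborel. \<bar>v k * G k s\<bar>) \<le> hh * b k" if "k \<in> I" for k
        proof -
          have "\<bar>v k\<bar> * mass (G k) \<le> \<bar>v k\<bar> * (16 * K k * hh)"
            using Gm[OF that] by (rule mult_left_mono) simp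
          also have "\<dots> = hh * b k" unfolding bK[symmetric] by (simp only: mult_ac)
          finally show ?thesis unfolding scaled_mass .
        qed
        show "\<bar>\<bar>s\<bar> - r k\<bar> \<le> 1" if "k \<in> I" "v k * G k s \<noteq> 0" for k s using Gs[OF that(1)] that(2) by simp
      qed
      also have "(\<Sum>n\<in>(\<lambda>k. nat \<lfloor>r k\<rfloor>) ` I. (\<Sum>k | k \<in> I \<and> nat \<lfloor>r k\<rfloor> = n. hh * b k)\<^sup>2)
        = hh\<^sup>2 * (\<Sum>n\<in>(\<lambda>k. nat \<lfloor>r k\<rfloor>) ` I. (\<Sum>k | k \<in> I \<and> nat \<lfloor>r k\<rfloor> = n. b k)\<^sup>2)"
        by (simp only: sum_distrib_left[symmetric] power_mult_distrib)
      also have "\<dots> \<le> (1 / R ^ 3) * ((B * C1)\<^sup>2 * (6 * ln R))"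
        using C1(1) R by (intro mult_mono hh2 lattice_group_sums(2)[OF fin R rc rb b0 B]) (auto intro: sum_nonneg)
      also have "(R + 1/2) - 1 = R - 1/2" by simp
      also have "(R + 1/2) + 1 = R + 3/2" by simp
      finally show ?thesis by (simp add: U_def mult_ac)
    qed
    have m1: "integral {R - 1/2..R + 3/2} (\<lambda>t. (U G1 t)\<^sup>2) \<le> 7020 * ((B * C1)\<^sup>2 * 6) * (ln R / R ^ 3)"
    proof (rule main[of G1 "\<lambda>k. \<rho> (ivec k)"])
      show "\<bar>\<bar>s\<bar> - \<rho> (ivec k)\<bar> \<le> 1" if "k \<in> I" "G1 k s \<noteq> 0" for k s
        using Gs(1)[OF that] support_nonneg[of "ivec k"] by linarith
    qed (use Gi Gm support_nonneg bB1 count1 in \<open>auto simp: hh_def\<close>)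
    have m2: "integral {R - 1/2..R + 3/2} (\<lambda>t. (U G2 t)\<^sup>2) \<le> 7020 * ((B * C1)\<^sup>2 * 6) * (ln R / R ^ 3)"
    proof (rule main[of G2 "\<lambda>k. \<rho> (- ivec k)"])
      show "\<bar>\<bar>s\<bar> - \<rho> (- ivec k)\<bar> \<le> 1" if "k \<in> I" "G2 k s \<noteq> 0" for k s
        using Gs(2)[OF that] support_nonneg[of "- ivec k"] by linarith
    qed (use Gi Gm support_nonneg bB2 count2 in \<open>auto simp: hh_def\<close>)
    have u3: "(U G3 t)\<^sup>2 \<le> (B * C1 * 4)\<^sup>2 / R ^ 3" for t
    proof -
      have "\<bar>U G3 t\<bar> \<le> (\<Sum>k\<in>I. \<bar>cos_transform (\<lambda>s. v k * G3 k s) t\<bar>)"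
        unfolding U_def by (rule sum_abs)
      also have "\<dots> \<le> (\<Sum>k\<in>I. h\<^sup>2 * b k)"
      proof (rule sum_mono)
        fix k assume k: "k \<in> I"
        have "\<bar>cos_transform (\<lambda>s. v k * G3 k s) t\<bar> \<le> \<bar>v k\<bar> * mass (G3 k)"
          using cos_transform_bound[of "\<lambda>s. v k * G3 k s" t] Gi(3)[OF k] by (simp only: scaled_mass integrable_mult_right)
        also have "\<dots> \<le> \<bar>v k\<bar> * (12 * K k * h\<^sup>2)" using Gm(3)[OF k] by (rule mult_left_mono) simp
        \<comment> \<open>Rounding 12 up to 16 lets the same weights \<open>b k\<close> serve the
          interior part.\<close>
        also have "\<dots> \<le> \<bar>v k\<bar> * (16 * K k * h\<^sup>2)" using K0[of k] by (intro mult_left_mono mult_right_mono) auto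
        also have "\<dots> = h\<^sup>2 * b k" unfolding bK[symmetric] by (simp only: mult_ac)
        finally show "\<bar>cos_transform (\<lambda>s. v k * G3 k s) t\<bar> \<le> h\<^sup>2 * b k" .
      qed
      also have "\<dots> \<le> (1 / R\<^sup>2) * (B * C1 * (4 * sqrt R))"
        unfolding sum_distrib_left[symmetric]
      proof (intro mult_mono lattice_group_sums(1)[OF fin R count1 bB1 b0 B])
        have "h\<^sup>2 \<le> (1 / R)\<^sup>2" using R by (intro power_mono) (auto simp: h_def field_simps)
        then show "h\<^sup>2 \<le> 1 / R\<^sup>2" by (simp add: power_divide)
      qed (use C1 b0 in \<open>auto intro: sum_nonneg\<close>)
      finally have "\<bar>U G3 t\<bar> \<le> (1 / R\<^sup>2) * (B * C1 * (4 * sqrt R))" .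
      then have "\<bar>U G3 t\<bar>\<^sup>2 \<le> ((1 / R\<^sup>2) * (B * C1 * (4 * sqrt R)))\<^sup>2" by (intro power_mono) auto
      also have "\<dots> = (B * C1 * 4)\<^sup>2 * (R / R ^ 4)" using R by (simp add: power_mult_distrib power_divide)
      also have "R / R ^ 4 = 1 / R ^ 3" using R by (simp add: eval_nat_numeral)
      finally show ?thesis by simp
    qed
    let ?J = "{R - 1/2..R + 3/2}"
    let ?F = "\<lambda>t. (t\<^sup>2 * (\<Sum>k\<in>I. v k * dom_cos k t))\<^sup>2"
    have pt: "?F t \<le> 48 * R ^ 4 * ((U G1 t)\<^sup>2 + (U G2 t)\<^sup>2 + (B * C1 * 4)\<^sup>2 / R ^ 3)" if t: "t \<in> ?J" for t
    proof -
      define w where "w = 2 - 2 * cos (2 * pi * t * h)"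
      define S where "S = (\<Sum>k\<in>I. v k * dom_cos k t)"
      have w1: "1 \<le> w"
      proof -
        \<comment> \<open>As R >= 2, t / R lies between 3/4 and 7/4, so the phase pi * 2th is at
          least 3 pi / 8 > pi / 3, where the cosine is at most 1/2.\<close>
        have th: "3/8 \<le> 2 * (t * h)" "2 * (t * h) \<le> 1" using t R by (auto simp: h_def field_simps)
        then have "pi * (1/3) \<le> pi * (2 * (t * h))" "pi * (2 * (t * h)) \<le> pi * 1"
          by (intro mult_left_mono; simp)+
        then have "cos (pi * (2 * (t * h))) \<le> cos (pi / 3)" by (intro cos_monotone_0_pi_le) auto
        then show ?thesis by (simp add: w_def cos_60 mult_ac)
      qed
      have wS: "w * S = U G1 t + U G2 t + U G3 t"
      proof -
        have "w * S = (\<Sum>k\<in>I. v k * (w * dom_cos k t))" by (simp add: S_def sum_distrib_left mult_ac)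
        also have "\<dots> = (\<Sum>k\<in>I. v k * (cos_transform (G1 k) t + cos_transform (G2 k) t + cos_transform (G3 k) t))"
          using Gt[of _ t] by (simp add: w_def)
        finally show ?thesis by (simp add: U_def cos_transform_cmult distrib_left sum.distrib)
      qed
      have "S\<^sup>2 \<le> (w * S)\<^sup>2"
        using w1 mult_right_mono[of 1 "w\<^sup>2" "S\<^sup>2"] one_le_power[of w 2] by (simp add: power_mult_distrib)
      also have "\<dots> \<le> 3 * ((U G1 t)\<^sup>2 + (U G2 t)\<^sup>2 + (U G3 t)\<^sup>2)" unfolding wS by (rule sum3_square_le)
      also have "\<dots> \<le> 3 * ((U G1 t)\<^sup>2 + (U G2 t)\<^sup>2 + (B * C1 * 4)\<^sup>2 / R ^ 3)" using u3[of t] by simp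
      finally have S2: "S\<^sup>2 \<le> 3 * ((U G1 t)\<^sup>2 + (U G2 t)\<^sup>2 + (B * C1 * 4)\<^sup>2 / R ^ 3)" .
      have "t ^ 4 \<le> (2 * R) ^ 4" using t R by (intro power_mono) auto
      then have t4: "t ^ 4 \<le> 16 * R ^ 4" by (simp add: power_mult_distrib)
      have "?F t = t ^ 4 * S\<^sup>2" by (simp add: S_def power_mult_distrib)
      also have "\<dots> \<le> (16 * R ^ 4) * (3 * ((U G1 t)\<^sup>2 + (U G2 t)\<^sup>2 + (B * C1 * 4)\<^sup>2 / R ^ 3))"
        using t4 S2 R by (intro mult_mono) auto
      finally show ?thesis by (simp only: mult.assoc mult.left_commute[of _ 3])
    qed
    have Ui: "(\<lambda>t. (U G1 t)\<^sup>2) integrable_on ?J" "(\<lambda>t. (U G2 t)\<^sup>2) integrable_on ?J"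
      using Gi by (intro integrable_continuous_real continuous_intros Ucont; simp)+
    have "integral ?J ?F \<le> integral ?J (\<lambda>t. 48 * R ^ 4 * ((U G1 t)\<^sup>2 + (U G2 t)\<^sup>2 + (B * C1 * 4)\<^sup>2 / R ^ 3))"
    proof (rule integral_le[OF _ _ pt])
      show "?F integrable_on ?J"
        by (intro integrable_continuous_real continuous_intros continuous_on_subset[OF continuous_dom_cos]) (auto simp: I_def)
      show "(\<lambda>t. 48 * R ^ 4 * ((U G1 t)\<^sup>2 + (U G2 t)\<^sup>2 + (B * C1 * 4)\<^sup>2 / R ^ 3)) integrable_on ?J"
        using Ui by (intro integrable_on_mult_right integrable_add) auto
    qed
    also have "\<dots> = 48 * R ^ 4 * (integral ?J (\<lambda>t. (U G1 t)\<^sup>2) + integral ?J (\<lambda>t. (U G2 t)\<^sup>2) + 2 * ((B * C1 * 4)\<^sup>2 / R ^ 3))"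
    proof -
      define q where "q = (B * C1 * 4)\<^sup>2 / R ^ 3"
      have "((\<lambda>t. (U G1 t)\<^sup>2 + (U G2 t)\<^sup>2 + q) has_integral
          (integral ?J (\<lambda>t. (U G1 t)\<^sup>2) + integral ?J (\<lambda>t. (U G2 t)\<^sup>2) + (R + 3/2 - (R - 1/2)) *\<^sub>R q)) ?J"
        using has_integral_const_real[of q "R - 1/2" "R + 3/2"]
        by (intro has_integral_add integrable_integral Ui) simp
      then have "integral ?J (\<lambda>t. (U G1 t)\<^sup>2 + (U G2 t)\<^sup>2 + q)
          = integral ?J (\<lambda>t. (U G1 t)\<^sup>2) + integral ?J (\<lambda>t. (U G2 t)\<^sup>2) + 2 * q"
        by (simp add: integral_unique)
      then show ?thesis unfolding q_def[symmetric] by (simp only: Henstock_Kurzweil_Integration.integral_mult_right)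
    qed
    also have "\<dots> \<le> 48 * R ^ 4 * (2 * (7020 * ((B * C1)\<^sup>2 * 6) * (ln R / R ^ 3)) + (2 * ln R) * (2 * ((B * C1 * 4)\<^sup>2 / R ^ 3)))"
    proof (rule mult_left_mono)
      \<comment> \<open>The interior part carries no logarithm; one is inserted so that it merges
        with the others.\<close>
      have "1 * (2 * ((B * C1 * 4)\<^sup>2 / R ^ 3)) \<le> (2 * ln R) * (2 * ((B * C1 * 4)\<^sup>2 / R ^ 3))"
        using lnR R by (intro mult_right_mono) auto
      with m1 m2 show "integral ?J (\<lambda>t. (U G1 t)\<^sup>2) + integral ?J (\<lambda>t. (U G2 t)\<^sup>2) + 2 * ((B * C1 * 4)\<^sup>2 / R ^ 3)
        \<le> 2 * (7020 * ((B * C1)\<^sup>2 * 6) * (ln R / R ^ 3)) + (2 * ln R) * (2 * ((B * C1 * 4)\<^sup>2 / R ^ 3))"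
        by argo
    qed (use R in simp)
    also have "\<dots> = C * (R * ln R)"
    proof -
      have "R ^ 4 = R * R ^ 3" by (simp add: eval_nat_numeral)
      moreover have "R ^ 3 \<noteq> 0" using R by simp
      ultimately show ?thesis by (simp add: C_def field_simps)
    qed
    finally show "integral ?J (\<lambda>t. (trig_error N c t)\<^sup>2) \<le> C * (R * ln R)"
      by (simp only: I_def v_def trig_error_def)
  qed
qed

end

section \<open>From trigonometric sums to the lattice error\<close>

context cap_domain
begin

lemma dom_cos_0: "dom_cos 0 t = measure lebesgue \<Omega>"
  by (simp add: dom_cos_def ivec_def measure_completion zero_prod_def[symmetric])

text \<open>The mollifier has scale e = c0 / R and the dilation is changed by d = 1 / R; c0 <= r0 /
  2 yields the sandwich condition 2 e <= r0 d. Changing t by d alters t^2 by at most 2 t d + d^2 <=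
  4, hence the bounded loss 4 area, and the 1 is the error of the Fourier expansion.\<close>

lemma lattice_error_bound:
  assumes r0: "0 < r0" "cball 0 r0 \<subseteq> \<Omega>" and R: "2 \<le> R"
    and c0: "0 < c0" "c0 \<le> 1/2" "c0 \<le> r0 / 2"
  obtains N :: nat and c :: "int \<Rightarrow> real" where
    "bump_decay (c0 / R) c"
    "\<And>t. R \<le> t \<Longrightarrow> t \<le> R + 1 \<Longrightarrow> \<bar>lattice_error \<Omega> t\<bar> \<le>
       \<bar>trig_error N c (t + 1 / R)\<bar>
     + \<bar>trig_error N c (t - 1 / R)\<bar>
     + (1 + 4 * measure lebesgue \<Omega>)"
proof -
  define e where "e = c0 / R"
  define d where "d = 1 / R"
  define a where "a = measure lebesgue \<Omega>"
  have e: "0 < e" "e \<le> 1/4" using c0 R by (auto simp: e_def field_simps)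
  have d: "0 < d" "d \<le> 1/2" using R by (auto simp: d_def field_simps)
  have ed: "2 * e \<le> r0 * d" using c0 R by (simp add: e_def d_def field_simps)
  have a: "0 \<le> a" by (simp add: a_def)
  have T: "0 < R + 2" using R by simp
  show thesis
  proof (rule smoothed_count_expansion[OF e T])
    fix N :: nat and c :: "int \<Rightarrow> real"
    assume c: "c 0 = 1" "bump_decay e c"
      and ex: "\<And>t. 0 < t \<Longrightarrow> t \<le> R + 2 \<Longrightarrow>
        \<bar>smoothed_count e t - t\<^sup>2 * (\<Sum>k\<in>ibox N. c (fst k) * c (snd k) * dom_cos k t)\<bar> \<le> 1"
    define F where "F = trig_error N c"
    have zero: "(0 :: int \<times> int) \<in> ibox N" by (simp add: ibox_def zero_prod_def)
    have ex': "\<bar>smoothed_count e t - t\<^sup>2 * a - F t\<bar> \<le> 1" if "0 < t" "t \<le> R + 2" for t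
    proof -
      have "(\<Sum>k\<in>ibox N. c (fst k) * c (snd k) * dom_cos k t) = a + (\<Sum>k\<in>ibox N - {0}. c (fst k) * c (snd k) * dom_cos k t)"
        using sum.remove[OF _ zero, of "\<lambda>k. c (fst k) * c (snd k) * dom_cos k t"] c(1)
        by (simp add: dom_cos_0 a_def ibox_def)
      then show ?thesis using ex[OF that] by (simp add: F_def trig_error_def distrib_left diff_diff_eq)
    qed
    show thesis
    proof (rule that[of c N])
      fix t assume t: "R \<le> t" "t \<le> R + 1"
      have tp: "0 < t" "0 < t - d" using t R d by auto
      have "real (lattice_count \<Omega> t) \<le> smoothed_count e (t + d)"
        by (rule lattice_count_le_smoothed[OF e tp(1) d(1) r0(2) ed])
      moreover have "smoothed_count e (t - d) \<le> real (lattice_count \<Omega> (t - d + d))"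
        by (rule smoothed_le_lattice_count[OF e tp(2) d(1) r0(2) ed])
      moreover have "\<bar>smoothed_count e (t + d) - (t + d)\<^sup>2 * a - F (t + d)\<bar> \<le> 1"
        "\<bar>smoothed_count e (t - d) - (t - d)\<^sup>2 * a - F (t - d)\<bar> \<le> 1"
        using t d tp by (intro ex'; linarith)+
      moreover have "(t + d)\<^sup>2 * a \<le> t\<^sup>2 * a + 4 * a" "t\<^sup>2 * a - 4 * a \<le> (t - d)\<^sup>2 * a"
      proof -
        have "t * d \<le> (R + 1) * d" using t d by (intro mult_right_mono) auto
        also have "\<dots> = 1 + d" using R by (simp add: d_def field_simps)
        finally have td: "t * d \<le> 3/2" using d by linarith
        have d2: "0 \<le> d\<^sup>2" "d\<^sup>2 \<le> 1" using d by (auto simp: power_le_one)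
        have "(t + d)\<^sup>2 \<le> t\<^sup>2 + 4" "t\<^sup>2 - 4 \<le> (t - d)\<^sup>2"
          using td d2 unfolding power2_sum power2_diff mult.assoc by linarith+
        from mult_right_mono[OF this(1) a] mult_right_mono[OF this(2) a]
        show "(t + d)\<^sup>2 * a \<le> t\<^sup>2 * a + 4 * a" "t\<^sup>2 * a - 4 * a \<le> (t - d)\<^sup>2 * a"
          by (simp_all add: distrib_right left_diff_distrib)
      qed
      ultimately have "\<bar>real (lattice_count \<Omega> t) - t\<^sup>2 * a\<bar> \<le> \<bar>F (t + d)\<bar> + \<bar>F (t - d)\<bar> + (1 + 4 * a)"
        using a by (simp only: diff_add_cancel)
      then show "\<bar>lattice_error \<Omega> t\<bar> \<le>
         \<bar>trig_error N c (t + 1 / R)\<bar>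
       + \<bar>trig_error N c (t - 1 / R)\<bar>
       + (1 + 4 * measure lebesgue \<Omega>)"
        unfolding lattice_error_def F_def a_def d_def .
    qed (use c in \<open>auto simp: e_def\<close>)
  qed
qed

lemma lattice_error_mean_square:
  obtains C where "0 \<le> C"
    "\<And>R l. 2 \<le> R \<Longrightarrow> 0 \<le> l \<Longrightarrow> l \<le> 1 \<Longrightarrow> (\<lambda>t. (lattice_error \<Omega> t)\<^sup>2) integrable_on {R..R+l} \<Longrightarrow>
      integral {R..R+l} (\<lambda>t. (lattice_error \<Omega> t)\<^sup>2) \<le> C * (R * ln R)"
proof -
  obtain r0 where r0: "0 < r0" "cball 0 r0 \<subseteq> \<Omega>" by (rule inscribed_ball) blast
  define c0 where "c0 = min (1/2) (r0 / 2)"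
  have c0: "0 < c0" "c0 \<le> 1/2" "c0 \<le> r0 / 2" using r0 by (auto simp: c0_def)
  define q where "q = 1 + 4 * measure lebesgue \<Omega>"
  show thesis
  proof (rule trig_sum_mean_square[OF c0(1)])
    fix C1 assume C1: "0 \<le> C1" and
      ms: "\<And>R N c. 2 \<le> R \<Longrightarrow> bump_decay (c0 / R) c \<Longrightarrow>
      integral {R - 1/2..R + 3/2} (\<lambda>t. (trig_error N c t)\<^sup>2) \<le> C1 * (R * ln R)"
    show thesis
    proof (rule that[of "6 * C1 + 3 * q\<^sup>2"])
      show "0 \<le> 6 * C1 + 3 * q\<^sup>2" using C1 by simp
      fix R l :: real
      assume R: "2 \<le> R" and l: "0 \<le> l" "l \<le> 1" and int: "(\<lambda>t. (lattice_error \<Omega> t)\<^sup>2) integrable_on {R..R+l}"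
      define d where "d = 1 / R"
      have d: "0 < d" "d \<le> 1/2" using R by (auto simp: d_def field_simps)
      show "integral {R..R+l} (\<lambda>t. (lattice_error \<Omega> t)\<^sup>2) \<le> (6 * C1 + 3 * q\<^sup>2) * (R * ln R)"
      proof (rule lattice_error_bound[OF r0 R c0])
        fix N :: nat and c :: "int \<Rightarrow> real"
        assume c: "bump_decay (c0 / R) c"
          and E: "\<And>t. R \<le> t \<Longrightarrow> t \<le> R + 1 \<Longrightarrow> \<bar>lattice_error \<Omega> t\<bar> \<le>
             \<bar>trig_error N c (t + 1 / R)\<bar>
           + \<bar>trig_error N c (t - 1 / R)\<bar>
           + (1 + 4 * measure lebesgue \<Omega>)"
        define F where "F = trig_error N c"
        have Fc: "continuous_on S F" for S
          unfolding F_def trig_error_def[abs_def]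
          by (intro continuous_intros continuous_on_subset[OF continuous_dom_cos]) auto
        have FJ: "integral {R - 1/2..R + 3/2} (\<lambda>t. (F t)\<^sup>2) \<le> C1 * (R * ln R)"
          unfolding F_def by (rule ms[OF R c])
        have shift: "((\<lambda>t. (F (t + x))\<^sup>2) has_integral integral {R + x..R + l + x} (\<lambda>t. (F t)\<^sup>2)) {R..R+l}
            \<and> integral {R + x..R + l + x} (\<lambda>t. (F t)\<^sup>2) \<le> C1 * (R * ln R)" if x: "\<bar>x\<bar> \<le> 1/2" for x
        proof
          have i: "(\<lambda>t. (F t)\<^sup>2) integrable_on {u..v}" for u v
            by (intro integrable_continuous_real continuous_intros Fc)
          have "(((\<lambda>t. (F t)\<^sup>2) \<circ> (+) x) has_integral integral {R + x..R + l + x} (\<lambda>t. (F t)\<^sup>2)) {R..R+l}"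
            unfolding has_integral_shift_Icc_real by (rule integrable_integral[OF i])
          then show "((\<lambda>t. (F (t + x))\<^sup>2) has_integral integral {R + x..R + l + x} (\<lambda>t. (F t)\<^sup>2)) {R..R+l}"
            by (simp add: o_def add.commute)
          \<comment> \<open>Since l <= 1 and |x| <= 1/2, the shifted interval stays in the window of
            length 2 on which the trigonometric sum was estimated.\<close>
          have "integral {R + x..R + l + x} (\<lambda>t. (F t)\<^sup>2) \<le> integral {R - 1/2..R + 3/2} (\<lambda>t. (F t)\<^sup>2)"
            using x l i by (intro integral_subset_le) auto
          then show "integral {R + x..R + l + x} (\<lambda>t. (F t)\<^sup>2) \<le> C1 * (R * ln R)" using FJ by linarith
        qed
        have "integral {R..R+l} (\<lambda>t. (lattice_error \<Omega> t)\<^sup>2)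
            \<le> 3 * (integral {R + d..R + l + d} (\<lambda>t. (F t)\<^sup>2) + integral {R + - d..R + l + - d} (\<lambda>t. (F t)\<^sup>2) + (R + l - R) *\<^sub>R q\<^sup>2)"
        proof (rule has_integral_le)
          show "((\<lambda>t. (lattice_error \<Omega> t)\<^sup>2) has_integral integral {R..R+l} (\<lambda>t. (lattice_error \<Omega> t)\<^sup>2)) {R..R+l}"
            by (rule integrable_integral[OF int])
          show "((\<lambda>t. 3 * ((F (t + d))\<^sup>2 + (F (t + - d))\<^sup>2 + q\<^sup>2)) has_integral
              3 * (integral {R + d..R + l + d} (\<lambda>t. (F t)\<^sup>2) + integral {R + - d..R + l + - d} (\<lambda>t. (F t)\<^sup>2) + (R + l - R) *\<^sub>R q\<^sup>2)) {R..R+l}"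
          proof (intro has_integral_mult_right has_integral_add)
            show "((\<lambda>t. q\<^sup>2) has_integral (R + l - R) *\<^sub>R q\<^sup>2) {R..R+l}"
              using has_integral_const_real[of "q\<^sup>2" R "R + l"] l by simp
          qed (use shift[of d] shift[of "- d"] d in auto)
          fix t assume t: "t \<in> {R..R+l}"
          have "\<bar>lattice_error \<Omega> t\<bar> \<le> \<bar>F (t + d)\<bar> + \<bar>F (t + - d)\<bar> + q"
            using E[of t] t l by (simp add: F_def d_def q_def)
          then have "\<bar>lattice_error \<Omega> t\<bar>\<^sup>2 \<le> (\<bar>F (t + d)\<bar> + \<bar>F (t + - d)\<bar> + q)\<^sup>2" by (intro power_mono) auto
          also have "\<dots> \<le> 3 * (\<bar>F (t + d)\<bar>\<^sup>2 + \<bar>F (t + - d)\<bar>\<^sup>2 + q\<^sup>2)" by (rule sum3_square_le)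
          finally show "(lattice_error \<Omega> t)\<^sup>2 \<le> 3 * ((F (t + d))\<^sup>2 + (F (t + - d))\<^sup>2 + q\<^sup>2)" by simp
        qed
        also have "\<dots> \<le> 3 * (C1 * (R * ln R) + C1 * (R * ln R) + q\<^sup>2 * (R * ln R))"
        proof (intro mult_left_mono add_mono)
          show "integral {R + d..R + l + d} (\<lambda>t. (F t)\<^sup>2) \<le> C1 * (R * ln R)" using shift[of d] d by auto
          show "integral {R + - d..R + l + - d} (\<lambda>t. (F t)\<^sup>2) \<le> C1 * (R * ln R)" using shift[of "- d"] d by auto
          have "1/2 \<le> ln R" using ln_ge_three_fifths[OF R] by simp
          then have "2 * (1/2) \<le> R * ln R" using R by (intro mult_mono) auto
          then have "l * q\<^sup>2 \<le> (R * ln R) * q\<^sup>2" using l by (intro mult_right_mono) auto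
          then show "(R + l - R) *\<^sub>R q\<^sup>2 \<le> q\<^sup>2 * (R * ln R)" by (simp add: mult.commute)
        qed simp
        also have "\<dots> = (6 * C1 + 3 * q\<^sup>2) * (R * ln R)" by (simp add: algebra_simps)
        finally show ?thesis .
      qed
    qed
  qed
qed

text \<open>The interval is cut into at most 2h pieces of equal length at most 1. They start below
  2R, where R ln R has grown by at most a factor 4; together this is the 8.\<close>

lemma G_mean_bound:
  "\<exists>C. \<forall>R h. R \<ge> 2 \<and> 1 \<le> h \<and> h \<le> R \<longrightarrow> G_mean \<Omega> R h \<le> C * sqrt (R * ln R)"
proof -
  let ?E = "\<lambda>t. (lattice_error \<Omega> t)\<^sup>2"
  obtain C where C: "0 \<le> C"
    "\<And>R l. 2 \<le> R \<Longrightarrow> 0 \<le> l \<Longrightarrow> l \<le> 1 \<Longrightarrow> ?E integrable_on {R..R+l} \<Longrightarrow> integral {R..R+l} ?E \<le> C * (R * ln R)"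
    by (rule lattice_error_mean_square) blast
  have "G_mean \<Omega> R h \<le> sqrt (8 * C) * sqrt (R * ln R)" if R: "R \<ge> 2" and h: "1 \<le> h" "h \<le> R" for R h
  proof -
    have RlnR: "0 \<le> R * ln R" using R by simp
    have "integral {R..R+h} ?E \<le> h * (8 * (C * (R * ln R)))"
    proof (cases "?E integrable_on {R..R+h}")
      case False
      \<comment> \<open>A non-integrable function has integral 0 by convention, which satisfies the
        bound.\<close>
      then show ?thesis using C(1) RlnR h by (simp add: not_integrable_integral)
    next
      case int: True
      define n where "n = nat \<lceil>h\<rceil>"
      have n: "0 < n" "h \<le> real n" "real n \<le> 2 * h" using h unfolding n_def by linarith+
      define l where "l = h / real n"
      have l: "0 < l" "l \<le> 1" "real n * l = h" using n h by (auto simp: l_def)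
      have "integral {R..R + real j * l} ?E \<le> real j * (4 * (C * (R * ln R)))" if "j \<le> n" for j
        using that
      proof (induction j)
        case (Suc j)
        have jn: "real (Suc j) * l \<le> h" using Suc.prems l by (metis mult_right_mono of_nat_mono less_imp_le)
        have jl: "0 \<le> real j * l" "real j * l \<le> real (Suc j) * l" using l by (auto simp: algebra_simps)
        let ?S = "R + real j * l"
        have S: "R + real (Suc j) * l = ?S + l" by (simp add: algebra_simps)
        have "integral {R..R + real (Suc j) * l} ?E = integral {R..?S} ?E + integral {?S..R + real (Suc j) * l} ?E"
          using jl jn by (intro Henstock_Kurzweil_Integration.integral_combine[symmetric] integrable_on_subinterval[OF int]) auto
        also have "integral {?S..R + real (Suc j) * l} ?E \<le> C * (?S * ln ?S)"
          unfolding S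
        proof (rule C(2))
          show "?E integrable_on {?S..?S + l}"
            using jl jn S by (intro integrable_on_subinterval[OF int]) auto
          show "2 \<le> ?S" using R jl by linarith
        qed (use l in auto)
        also have "C * (?S * ln ?S) \<le> C * ((2 * R) * (2 * ln R))"
        proof (intro mult_left_mono mult_mono)
          show S2: "?S \<le> 2 * R" using jl jn h by linarith
          have "ln ?S \<le> ln (R * R)"
          proof -
            \<comment> \<open>R >= 2 turns ln (2R) into at most 2 ln R without an additive
              constant.\<close>
            have "2 * R \<le> R * R" using R by (intro mult_right_mono) auto
            then have "?S \<le> R * R" using S2 by linarith
            moreover have "0 < ?S" using jl R by linarith
            ultimately show ?thesis by (intro ln_mono)
          qed
          also have "\<dots> = 2 * ln R" using R by (simp add: ln_mult)
          finally show "ln ?S \<le> 2 * ln R" .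
          show "0 \<le> ln ?S" using R jl by (intro ln_ge_zero) linarith
        qed (use C(1) R in auto)
        finally show ?case using Suc.IH Suc.prems by (simp add: algebra_simps)
      qed simp
      from this[of n] have "integral {R..R+h} ?E \<le> real n * (4 * (C * (R * ln R)))" by (simp add: l(3))
      also have "\<dots> \<le> (2 * h) * (4 * (C * (R * ln R)))"
        using n C(1) RlnR by (intro mult_right_mono) auto
      finally show ?thesis by simp
    qed
    then have "(1 / h) * integral {R..R+h} ?E \<le> 8 * C * (R * ln R)"
      using h by (simp add: field_simps)
    then have "G_mean \<Omega> R h \<le> sqrt (8 * C * (R * ln R))"
      unfolding G_mean_def power2_abs by (rule real_sqrt_le_mono)
    then show ?thesis by (simp only: real_sqrt_mult)
  qed
  then show ?thesis by blast
qed

end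

theorem theorem1p3:
  fixes \<Omega> :: "(real \<times> real) set"
  assumes "open \<Omega>" and "bounded \<Omega>" and "convex \<Omega>" and "0 \<in> \<Omega>"
    and "\<exists>M. \<forall>\<theta>\<in>sphere 0 1. \<forall>\<delta>>0. cap_diam \<Omega> \<theta> \<delta> / sqrt \<delta> \<le> M"
  shows "\<exists>C. \<forall>R h. R \<ge> 2 \<and> 1 \<le> h \<and> h \<le> R \<longrightarrow> G_mean \<Omega> R h \<le> C * sqrt (R * ln R)"
proof -
  obtain M where M: "\<forall>\<theta>\<in>sphere 0 1. \<forall>\<delta>>0. cap_diam \<Omega> \<theta> \<delta> / sqrt \<delta> \<le> M"
    using assms(5) by blast
  \<comment> \<open>The absolute value supplies the nonnegativity that the locale asks of its
    constant.\<close>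
  interpret cap_domain \<Omega> "\<bar>M\<bar>"
  proof
    fix \<theta> :: "real \<times> real" and \<delta> :: real
    assume "norm \<theta> = 1" "0 < \<delta>"
    with M have "cap_diam \<Omega> \<theta> \<delta> / sqrt \<delta> \<le> M" by simp
    then have "cap_diam \<Omega> \<theta> \<delta> \<le> M * sqrt \<delta>"
      using \<open>0 < \<delta>\<close> by (simp add: pos_divide_le_eq)
    also have "\<dots> \<le> \<bar>M\<bar> * sqrt \<delta>" using \<open>0 < \<delta>\<close> by (intro mult_right_mono) auto
    finally show "cap_diam \<Omega> \<theta> \<delta> \<le> \<bar>M\<bar> * sqrt \<delta>" .
  qed (use assms in auto)
  show ?thesis by (rule G_mean_bound)
qed

end
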